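(* Let $S$ be the $\mathbb N^r$-graded ring described in the context. (i) For all $p\in \mathrm{Proj}^r(S)$ the ring extension $S_{(p)}\longrightarrow S_p$ is faithfully flat with closed fiber $\mathbf k(p)$ (the residue field of $S_p$). (ii) For all $\underline a\in\mathbb N^{*r}$, the extension $S^{(\underline a)}\hookrightarrow S$ is integral, $\dim(S^{(\underline a)})=\dim(S)$, and there is a homeomorphism of topological spaces $\mathrm{Proj}^r(S^{(\underline a)})\cong \mathrm{Proj}^r(S)$. For all $p\in\mathrm{Proj}^r(S)$ it holds $\mathrm{ht}(p^{(\underline a)})=\mathrm{ht}(p)$. (iii) Let $M$ be a finitely generated $\mathbb Z^r$-graded $S$-module. For all $p\in \mathrm{Proj}^r(S)$, all $\underline a\in\mathbb N^{*r}$ and all $\underline b\in\mathbb N^r$, it holds $M^{(\underline a,\underline b)}_{(p^{(\underline a)})}=M(\underline b)_{(p)}$ (under the natural map $m/s\mapsto m/s$).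
   Context: $\mathbb N$ is the set of non-negative integers and $\mathbb N^*$ the set of positive integers. Fix $r\ge 1$ and vectors $\gamma_i=(\gamma_1^i,\dots,\gamma_i^i,0,\dots,0)\in\mathbb N^r$ with $\gamma_i^i\neq 0$, $i=1,\dots,r$. $S=\bigoplus_{\underline n\in\mathbb N^r}S_{\underline n}$ is a Noetherian $\mathbb N^r$-graded ring, generated as an $S_{\underline 0}$-algebra by finitely many homogeneous elements $g_i^j$ ($1\le i\le r$, $1\le j\le \mu_i$) with $\deg g_i^j=\gamma_i$; $S_{\underline 0}$ is a local ring with infinite residue field. Irrelevant ideal: for an $\mathbb N^r$-graded ring $A$, let $I_i$ be the ideal generated by the homogeneous components of $A$ of multidegrees $(d_1,\dots,d_i,0,\dots,0)$ with $d_i\neq 0$, and put $A_{++}=I_1\cdots I_r$. $\mathrm{Proj}^r(A)$ is the set of homogeneous prime ideals $p$ of $A$ with $p\not\supset A_{++}$, with the Zariski topology. Homogeneous localization: for a $\mathbb Z^r$-graded module $N$ over a graded ring $A$ and a homogeneous prime $q$ of $A$, $N_{(q)}$ is the set of fractions $m/s$ with $m\in N$ homogeneous, $s\in A\setminus q$ homogeneous and $\deg m=\deg s$. In particular $S_{(p)}$ is a local ring. Veronese transforms: for $\underline a\in\mathbb N^{*r}$ and $\underline n\in\mathbb Z^r$ put $\phi_{\underline a}(\underline n)=\sum_{i=1}^r n_ia_i\gamma_i$. Then $S^{(\underline a)}=\bigoplus_{\underline n\in\mathbb N^r}S_{\phi_{\underline a}(\underline n)}$, a subring of $S$, graded by $(S^{(\underline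 a)})_{\underline n}=S_{\phi_{\underline a}(\underline n)}$. For a $\mathbb Z^r$-graded $S$-module $M$, $M^{(\underline a,\underline b)}=\bigoplus_{\underline n\in\mathbb Z^r}M_{\phi_{\underline a}(\underline n)+\underline b}$, a graded $S^{(\underline a)}$-module with $(M^{(\underline a,\underline b)})_{\underline n}=M_{\phi_{\underline a}(\underline n)+\underline b}$. For a prime $p$ of $S$, $p^{(\underline a)}=p\cap S^{(\underline a)}$. $M(\underline b)$ is the shifted module, $M(\underline b)_{\underline n}=M_{\underline n+\underline b}$. *)

theory Defs
  imports "HOL-Algebra.Algebra" "HOL-Analysis.Abstract_Topology" "HOL-Library.Extended_Nat"
begin

section \<open>Multidegrees\<close>

text \<open>An element of \<open>\<int>^r\<close> is a function \<open>nat \<Rightarrow> int\<close> vanishing outside \<open>{1..r}\<close>; \<open>\<nat>^r\<close> is the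
  subset of the nonnegative ones, so that rings and modules share one type of degrees.\<close>

type_synonym mdeg = "nat \<Rightarrow> int"

definition Zvec :: "nat \<Rightarrow> mdeg set" where
  "Zvec r = {n. \<forall>i. i \<notin> {1..r} \<longrightarrow> n i = 0}"

definition Nvec :: "nat \<Rightarrow> mdeg set" where
  "Nvec r = {n \<in> Zvec r. \<forall>i. 0 \<le> n i}"

definition Nvec_pos :: "nat \<Rightarrow> mdeg set" where
  "Nvec_pos r = {n \<in> Zvec r. \<forall>i \<in> {1..r}. 0 < n i}"

abbreviation deg_zero :: mdeg where
  "deg_zero \<equiv> (\<lambda>_. 0)"

abbreviation deg_add :: "mdeg \<Rightarrow> mdeg \<Rightarrow> mdeg" where
  "deg_add d e \<equiv> (\<lambda>i. d i + e i)"


section \<open>Rings, ideals, dimension\<close>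

definition local_ring :: "('a, 's) ring_scheme \<Rightarrow> bool" where
  "local_ring R \<longleftrightarrow> cring R \<and> (\<exists>!m. maximalideal m R)"

definition max_ideal :: "('a, 's) ring_scheme \<Rightarrow> 'a set" where
  "max_ideal R = (THE m. maximalideal m R)"

definition residue_field :: "('a, 's) ring_scheme \<Rightarrow> 'a set ring" where
  "residue_field R = R Quot (max_ideal R)"

text \<open>The closed fiber \<open>B \<otimes>\<^sub>A A/m = B / mB\<close> of a ring homomorphism \<open>f : A \<rightarrow> B\<close> from a local ring
  \<open>(A, m)\<close>.\<close>

definition closed_fiber ::
    "('a, 's) ring_scheme \<Rightarrow> ('b, 't) ring_scheme \<Rightarrow> ('a \<Rightarrow> 'b) \<Rightarrow> 'b set ring" where
  "closed_fiber A B f = B Quot (Idl\<^bsub>B\<^esub> (f ` max_ideal A))"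

definition prime_chain :: "('a, 's) ring_scheme \<Rightarrow> nat \<Rightarrow> (nat \<Rightarrow> 'a set) \<Rightarrow> bool" where
  "prime_chain R n c \<longleftrightarrow> (\<forall>k\<le>n. primeideal (c k) R) \<and> (\<forall>k<n. c k \<subset> c (Suc k))"

definition krull_dim :: "('a, 's) ring_scheme \<Rightarrow> enat" where
  "krull_dim R = Sup {enat n | n. \<exists>c. prime_chain R n c}"

definition height :: "('a, 's) ring_scheme \<Rightarrow> 'a set \<Rightarrow> enat" where
  "height R p = Sup {enat n | n. \<exists>c. prime_chain R n c \<and> c n = p}"

definition integral_extension :: "'a set \<Rightarrow> ('a, 's) ring_scheme \<Rightarrow> bool" where
  "integral_extension K R \<longleftrightarrow> subring K R \<and>
     (\<forall>x \<in> carrier R. \<exists>f \<in> carrier (K [X]\<^bsub>R\<^esub>).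
        f \<noteq> [] \<and> lead_coeff f = \<one>\<^bsub>R\<^esub> \<and> ring.eval R f x = \<zero>\<^bsub>R\<^esub>)"


section \<open>Modules\<close>

definition reg_module :: "('a, 's) ring_scheme \<Rightarrow> ('a, 'a) module" where
  "reg_module R = \<lparr>carrier = carrier R, monoid.mult = monoid.mult R, one = one R,
     ring.zero = ring.zero R, ring.add = ring.add R, module.smult = monoid.mult R\<rparr>"

definition restrict_scalars :: "('a \<Rightarrow> 'b) \<Rightarrow> ('b, 'c, 'm) module_scheme \<Rightarrow> ('a, 'c) module" where
  "restrict_scalars f M = \<lparr>carrier = carrier M, monoid.mult = monoid.mult M, one = one M,
     ring.zero = ring.zero M, ring.add = ring.add M, module.smult = (\<lambda>a x. f a \<odot>\<^bsub>M\<^esub> x)\<rparr>"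

definition linear_maps ::
    "('a, 's) ring_scheme \<Rightarrow> ('a, 'b, 'm) module_scheme \<Rightarrow> ('a, 'c, 'n) module_scheme
      \<Rightarrow> ('b \<Rightarrow> 'c) set" where
  "linear_maps R M N = {h. h \<in> hom (add_monoid M) (add_monoid N) \<and>
     (\<forall>a \<in> carrier R. \<forall>x \<in> carrier M. h (a \<odot>\<^bsub>M\<^esub> x) = a \<odot>\<^bsub>N\<^esub> h x)}"

definition linear_isos ::
    "('a, 's) ring_scheme \<Rightarrow> ('a, 'b, 'm) module_scheme \<Rightarrow> ('a, 'c, 'n) module_scheme
      \<Rightarrow> ('b \<Rightarrow> 'c) set" where
  "linear_isos R M N = {h \<in> linear_maps R M N. bij_betw h (carrier M) (carrier N)}"

definition finitely_generated ::
    "('a, 's) ring_scheme \<Rightarrow> ('a, 'b, 'm) module_scheme \<Rightarrow> bool" where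
  "finitely_generated R M \<longleftrightarrow> (\<exists>Q \<subseteq> carrier M. finite Q \<and>
     (\<forall>N. submodule N R M \<and> Q \<subseteq> N \<longrightarrow> N = carrier M))"


subsection \<open>Tensor products and faithful flatness\<close>

text \<open>The abelian group \<open>N \<otimes>\<^sub>R M\<close>, as the free abelian group on the pairs modulo the usual
  relations; \<open>tensor_map R N M f\<close> is \<open>id \<otimes> f\<close>, where \<open>M\<close> is the \<^emph>\<open>target\<close> of \<open>f\<close>. The groups are
  written multiplicatively.\<close>

definition tensor_rels ::
    "('a, 's) ring_scheme \<Rightarrow> ('a, 'n, 'k) module_scheme \<Rightarrow> ('a, 'm, 'l) module_scheme
      \<Rightarrow> ('n \<times> 'm \<Rightarrow>\<^sub>0 int) set" where
  "tensor_rels R N M =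
     {frag_of (y \<oplus>\<^bsub>N\<^esub> y', x) - (frag_of (y, x) + frag_of (y', x)) | y y' x.
        y \<in> carrier N \<and> y' \<in> carrier N \<and> x \<in> carrier M} \<union>
     {frag_of (y, x \<oplus>\<^bsub>M\<^esub> x') - (frag_of (y, x) + frag_of (y, x')) | y x x'.
        y \<in> carrier N \<and> x \<in> carrier M \<and> x' \<in> carrier M} \<union>
     {frag_of (a \<odot>\<^bsub>N\<^esub> y, x) - frag_of (y, a \<odot>\<^bsub>M\<^esub> x) | a y x.
        a \<in> carrier R \<and> y \<in> carrier N \<and> x \<in> carrier M}"

definition tensor_rel_group ::
    "('a, 's) ring_scheme \<Rightarrow> ('a, 'n, 'k) module_scheme \<Rightarrow> ('a, 'm, 'l) module_scheme
      \<Rightarrow> ('n \<times> 'm \<Rightarrow>\<^sub>0 int) set" where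
  "tensor_rel_group R N M =
     generate (free_Abelian_group (carrier N \<times> carrier M)) (tensor_rels R N M)"

definition tensor ::
    "('a, 's) ring_scheme \<Rightarrow> ('a, 'n, 'k) module_scheme \<Rightarrow> ('a, 'm, 'l) module_scheme
      \<Rightarrow> ('n \<times> 'm \<Rightarrow>\<^sub>0 int) set monoid" where
  "tensor R N M = free_Abelian_group (carrier N \<times> carrier M) Mod tensor_rel_group R N M"

definition tensor_map ::
    "('a, 's) ring_scheme \<Rightarrow> ('a, 'n, 'k) module_scheme \<Rightarrow> ('a, 'm, 'l) module_scheme
      \<Rightarrow> ('x \<Rightarrow> 'm) \<Rightarrow> ('n \<times> 'x \<Rightarrow>\<^sub>0 int) set \<Rightarrow> ('n \<times> 'm \<Rightarrow>\<^sub>0 int) set" where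
  "tensor_map R N M f C =
     (\<Union>c \<in> C. tensor_rel_group R N M #>\<^bsub>free_Abelian_group (carrier N \<times> carrier M)\<^esub>
        frag_extend (\<lambda>(y, x). frag_of (y, f x)) c)"

text \<open>\<open>N\<close> is faithfully flat over \<open>R\<close> if every sequence \<open>M1 \<rightarrow> M2 \<rightarrow> M3\<close> of \<open>R\<close>-modules is exact if
  and only if \<open>N \<otimes> M1 \<rightarrow> N \<otimes> M2 \<rightarrow> N \<otimes> M3\<close> is. HOL cannot quantify over types inside a formula, so
  the type \<open>'x\<close> of the elements of the test modules is a parameter; a theorem concluding
  \<open>faithfully_flat TYPE('x) R N\<close> for a type variable \<open>'x\<close> covers all test modules.\<close>

definition faithfully_flat ::
    "'x itself \<Rightarrow> ('a, 's) ring_scheme \<Rightarrow> ('a, 'n, 'k) module_scheme \<Rightarrow> bool" where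
  "faithfully_flat _ R N \<longleftrightarrow> Module.module R N \<and>
     (\<forall>(M1 :: ('a, 'x) module) (M2 :: ('a, 'x) module) (M3 :: ('a, 'x) module) f g.
        Module.module R M1 \<and> Module.module R M2 \<and> Module.module R M3 \<and>
        f \<in> linear_maps R M1 M2 \<and> g \<in> linear_maps R M2 M3 \<longrightarrow>
        (f ` carrier M1 = a_kernel M2 M3 g \<longleftrightarrow>
         tensor_map R N M2 f ` carrier (tensor R N M1) =
           kernel (tensor R N M2) (tensor R N M3) (tensor_map R N M3 g)))"

definition faithfully_flat_extension ::
    "'x itself \<Rightarrow> ('a, 's) ring_scheme \<Rightarrow> ('b, 't) ring_scheme \<Rightarrow> ('a \<Rightarrow> 'b) \<Rightarrow> bool" where
  "faithfully_flat_extension T A B f \<longleftrightarrow> ring_hom_cring A B f \<and>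
     faithfully_flat T A (restrict_scalars f (reg_module B))"


section \<open>Fractions\<close>

text \<open>\<open>Q\<close> is the set of admissible pairs (numerator, denominator) and \<open>U\<close> the multiplicative set
  of denominators. A fraction \<open>m/s\<close> is the class of \<open>(m, s)\<close>.\<close>

definition frac_rel ::
    "('a, 'b, 'm) module_scheme \<Rightarrow> ('b \<times> 'a) set \<Rightarrow> 'a set \<Rightarrow> (('b \<times> 'a) \<times> ('b \<times> 'a)) set" where
  "frac_rel M Q U = {((m, s), (n, t)). (m, s) \<in> Q \<and> (n, t) \<in> Q \<and>
     (\<exists>u \<in> U. u \<odot>\<^bsub>M\<^esub> (t \<odot>\<^bsub>M\<^esub> m) = u \<odot>\<^bsub>M\<^esub> (s \<odot>\<^bsub>M\<^esub> n))}"

text \<open>The fields \<open>mult\<close> and \<open>one\<close> are meaningful only if \<open>M\<close> is an algebra, in practice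
  \<open>reg_module R\<close>, for which the result is the ring of fractions.\<close>

definition fractions ::
    "('a, 's) ring_scheme \<Rightarrow> ('a, 'b, 'm) module_scheme \<Rightarrow> ('b \<times> 'a) set \<Rightarrow> 'a set
      \<Rightarrow> (('a \<times> 'a) set, ('b \<times> 'a) set) module" where
  "fractions R M Q U =
     \<lparr>carrier = Q // frac_rel M Q U,
      monoid.mult = (\<lambda>C D. \<Union>(m, s) \<in> C. \<Union>(n, t) \<in> D.
        frac_rel M Q U `` {(m \<otimes>\<^bsub>M\<^esub> n, s \<otimes>\<^bsub>R\<^esub> t)}),
      one = frac_rel M Q U `` {(\<one>\<^bsub>M\<^esub>, \<one>\<^bsub>R\<^esub>)},
      ring.zero = frac_rel M Q U `` {(\<zero>\<^bsub>M\<^esub>, \<one>\<^bsub>R\<^esub>)},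
      ring.add = (\<lambda>C D. \<Union>(m, s) \<in> C. \<Union>(n, t) \<in> D.
        frac_rel M Q U `` {((t \<odot>\<^bsub>M\<^esub> m) \<oplus>\<^bsub>M\<^esub> (s \<odot>\<^bsub>M\<^esub> n), s \<otimes>\<^bsub>R\<^esub> t)}),
      module.smult = (\<lambda>C D. \<Union>(a, s) \<in> C. \<Union>(n, t) \<in> D.
        frac_rel M Q U `` {(a \<odot>\<^bsub>M\<^esub> n, s \<otimes>\<^bsub>R\<^esub> t)})\<rparr>"

definition loc_rel :: "('a, 's) ring_scheme \<Rightarrow> 'a set \<Rightarrow> (('a \<times> 'a) \<times> ('a \<times> 'a)) set" where
  "loc_rel R p = frac_rel (reg_module R) (carrier R \<times> (carrier R - p)) (carrier R - p)"

definition localization ::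
    "('a, 's) ring_scheme \<Rightarrow> 'a set \<Rightarrow> (('a \<times> 'a) set, ('a \<times> 'a) set) module" where
  "localization R p =
     fractions R (reg_module R) (carrier R \<times> (carrier R - p)) (carrier R - p)"


section \<open>Graded rings and modules\<close>

text \<open>Internal direct sum \<open>\<Oplus>\<^sub>d G d\<close> over \<open>d \<in> D\<close>, in the additive group of \<open>R\<close>.\<close>

definition is_direct_sum :: "'i set \<Rightarrow> ('a, 's) ring_scheme \<Rightarrow> ('i \<Rightarrow> 'a set) \<Rightarrow> bool" where
  "is_direct_sum D R G \<longleftrightarrow> (\<forall>d \<in> D. additive_subgroup (G d) R) \<and>
     (\<forall>x \<in> carrier R. \<exists>!c. c \<in> (\<Pi>\<^sub>E d \<in> D. G d) \<and> finite {d \<in> D. c d \<noteq> \<zero>\<^bsub>R\<^esub>} \<and>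
        x = (\<Oplus>\<^bsub>R\<^esub>d \<in> {d \<in> D. c d \<noteq> \<zero>\<^bsub>R\<^esub>}. c d))"

definition graded_ring :: "mdeg set \<Rightarrow> ('a, 's) ring_scheme \<Rightarrow> (mdeg \<Rightarrow> 'a set) \<Rightarrow> bool" where
  "graded_ring D R G \<longleftrightarrow> cring R \<and> is_direct_sum D R G \<and> \<one>\<^bsub>R\<^esub> \<in> G deg_zero \<and>
     (\<forall>d \<in> D. \<forall>e \<in> D. \<forall>x \<in> G d. \<forall>y \<in> G e. x \<otimes>\<^bsub>R\<^esub> y \<in> G (deg_add d e))"

definition graded_module ::
    "mdeg set \<Rightarrow> ('a, 's) ring_scheme \<Rightarrow> (mdeg \<Rightarrow> 'a set)
      \<Rightarrow> mdeg set \<Rightarrow> ('a, 'b, 'm) module_scheme \<Rightarrow> (mdeg \<Rightarrow> 'b set) \<Rightarrow> bool" where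
  "graded_module D R G E M H \<longleftrightarrow> Module.module R M \<and> is_direct_sum E M H \<and>
     (\<forall>d \<in> D. \<forall>e \<in> E. \<forall>a \<in> G d. \<forall>x \<in> H e. a \<odot>\<^bsub>M\<^esub> x \<in> H (deg_add d e))"

definition homogeneous_ideal ::
    "mdeg set \<Rightarrow> ('a, 's) ring_scheme \<Rightarrow> (mdeg \<Rightarrow> 'a set) \<Rightarrow> 'a set \<Rightarrow> bool" where
  "homogeneous_ideal D R G J \<longleftrightarrow> ideal J R \<and> J = Idl\<^bsub>R\<^esub> (J \<inter> (\<Union>d \<in> D. G d))"

definition irrelevant_factor ::
    "nat \<Rightarrow> ('a, 's) ring_scheme \<Rightarrow> (mdeg \<Rightarrow> 'a set) \<Rightarrow> nat \<Rightarrow> 'a set" where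
  "irrelevant_factor r R G i =
     Idl\<^bsub>R\<^esub> (\<Union>d \<in> {d \<in> Nvec r. d i \<noteq> 0 \<and> (\<forall>k>i. d k = 0)}. G d)"

definition irrelevant_ideal ::
    "nat \<Rightarrow> ('a, 's) ring_scheme \<Rightarrow> (mdeg \<Rightarrow> 'a set) \<Rightarrow> 'a set" where
  "irrelevant_ideal r R G = (\<Otimes>\<^bsub>ideals_set R\<^esub>i \<in> {1..r}. irrelevant_factor r R G i)"

definition Proj :: "nat \<Rightarrow> ('a, 's) ring_scheme \<Rightarrow> (mdeg \<Rightarrow> 'a set) \<Rightarrow> 'a set set" where
  "Proj r R G = {p. primeideal p R \<and> homogeneous_ideal (Nvec r) R G p \<and>
     \<not> irrelevant_ideal r R G \<subseteq> p}"

text \<open>The generating sets are the complements of the closed sets \<open>V(J)\<close>. They are already closed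
  under finite intersections and arbitrary unions, so they are all the open sets.\<close>

definition Proj_topology ::
    "nat \<Rightarrow> ('a, 's) ring_scheme \<Rightarrow> (mdeg \<Rightarrow> 'a set) \<Rightarrow> 'a set topology" where
  "Proj_topology r R G =
     topology_generated_by {{p \<in> Proj r R G. \<not> J \<subseteq> p} | J. homogeneous_ideal (Nvec r) R G J}"


subsection \<open>Homogeneous localization\<close>

definition hom_denoms :: "mdeg set \<Rightarrow> (mdeg \<Rightarrow> 'a set) \<Rightarrow> 'a set \<Rightarrow> 'a set" where
  "hom_denoms D G q = {s. \<exists>d \<in> D. s \<in> G d \<and> s \<notin> q}"

definition hom_pairs ::
    "mdeg set \<Rightarrow> (mdeg \<Rightarrow> 'a set) \<Rightarrow> (mdeg \<Rightarrow> 'b set) \<Rightarrow> 'a set \<Rightarrow> ('b \<times> 'a) set" where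
  "hom_pairs D G H q = {(m, s). \<exists>d \<in> D. m \<in> H d \<and> s \<in> G d \<and> s \<notin> q}"

definition hom_loc_rel ::
    "mdeg set \<Rightarrow> (mdeg \<Rightarrow> 'a set) \<Rightarrow> ('a, 'b, 'm) module_scheme \<Rightarrow> (mdeg \<Rightarrow> 'b set) \<Rightarrow> 'a set
      \<Rightarrow> (('b \<times> 'a) \<times> ('b \<times> 'a)) set" where
  "hom_loc_rel D G M H q = frac_rel M (hom_pairs D G H q) (hom_denoms D G q)"

text \<open>\<open>M\<^sub>(\<^sub>q\<^sub>)\<close>, for the module \<open>M = \<Oplus>\<^sub>d H d\<close> over the ring \<open>R = \<Oplus>\<^sub>d G d\<close> graded over \<open>D\<close>.\<close>

definition hom_localization ::
    "mdeg set \<Rightarrow> ('a, 's) ring_scheme \<Rightarrow> (mdeg \<Rightarrow> 'a set)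
      \<Rightarrow> ('a, 'b, 'm) module_scheme \<Rightarrow> (mdeg \<Rightarrow> 'b set) \<Rightarrow> 'a set
      \<Rightarrow> (('a \<times> 'a) set, ('b \<times> 'a) set) module" where
  "hom_localization D R G M H q = fractions R M (hom_pairs D G H q) (hom_denoms D G q)"

definition hom_localization_ring ::
    "mdeg set \<Rightarrow> ('a, 's) ring_scheme \<Rightarrow> (mdeg \<Rightarrow> 'a set) \<Rightarrow> 'a set
      \<Rightarrow> (('a \<times> 'a) set, ('a \<times> 'a) set) module" where
  "hom_localization_ring D R G q = hom_localization D R G (reg_module R) G q"

text \<open>Natural maps \<open>m/s \<mapsto> m/s\<close>: a class \<open>C\<close> for a finer relation is contained in exactly one class
  of a coarser relation \<open>E\<close>, which is the image \<open>E `` C\<close>.\<close>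

definition natural_map :: "('c \<times> 'c) set \<Rightarrow> 'c set \<Rightarrow> 'c set" where
  "natural_map E C = E `` C"


subsection \<open>Veronese transforms\<close>

definition veronese_index :: "nat \<Rightarrow> (nat \<Rightarrow> mdeg) \<Rightarrow> mdeg \<Rightarrow> mdeg \<Rightarrow> mdeg" where
  "veronese_index r \<gamma> a n = (\<lambda>k. \<Sum>i = 1..r. n i * a i * \<gamma> i k)"

definition veronese_grading ::
    "nat \<Rightarrow> (nat \<Rightarrow> mdeg) \<Rightarrow> mdeg \<Rightarrow> (mdeg \<Rightarrow> 'a set) \<Rightarrow> mdeg \<Rightarrow> 'a set" where
  "veronese_grading r \<gamma> a G n = G (veronese_index r \<gamma> a n)"

definition veronese_ring ::
    "nat \<Rightarrow> (nat \<Rightarrow> mdeg) \<Rightarrow> mdeg \<Rightarrow> ('a, 's) ring_scheme \<Rightarrow> (mdeg \<Rightarrow> 'a set)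
      \<Rightarrow> ('a, 's) ring_scheme" where
  "veronese_ring r \<gamma> a S G =
     S\<lparr>carrier := generate (add_monoid S) (\<Union>n \<in> Nvec r. veronese_grading r \<gamma> a G n)\<rparr>"

definition shift_grading :: "mdeg \<Rightarrow> (mdeg \<Rightarrow> 'b set) \<Rightarrow> mdeg \<Rightarrow> 'b set" where
  "shift_grading b H n = H (deg_add n b)"

definition veronese_module_grading ::
    "nat \<Rightarrow> (nat \<Rightarrow> mdeg) \<Rightarrow> mdeg \<Rightarrow> mdeg \<Rightarrow> (mdeg \<Rightarrow> 'b set) \<Rightarrow> mdeg \<Rightarrow> 'b set" where
  "veronese_module_grading r \<gamma> a b H n = H (deg_add (veronese_index r \<gamma> a n) b)"

definition veronese_module ::
    "nat \<Rightarrow> (nat \<Rightarrow> mdeg) \<Rightarrow> mdeg \<Rightarrow> mdeg \<Rightarrow> ('a, 'b, 'm) module_scheme \<Rightarrow> (mdeg \<Rightarrow> 'b set)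
      \<Rightarrow> ('a, 'b, 'm) module_scheme" where
  "veronese_module r \<gamma> a b M H =
     M\<lparr>carrier := generate (add_monoid M) (\<Union>n \<in> Zvec r. veronese_module_grading r \<gamma> a b H n)\<rparr>"

definition veronese_prime ::
    "nat \<Rightarrow> (nat \<Rightarrow> mdeg) \<Rightarrow> mdeg \<Rightarrow> ('a, 's) ring_scheme \<Rightarrow> (mdeg \<Rightarrow> 'a set)
      \<Rightarrow> 'a set \<Rightarrow> 'a set" where
  "veronese_prime r \<gamma> a S G p = p \<inter> carrier (veronese_ring r \<gamma> a S G)"

end

theory Submission
  imports Defs "HOL-Library.Fun_Lexorder"
begin

text \<open>
  The matrix of the \<open>\<gamma> i\<close> is triangular with nonzero diagonal, so the map \<open>\<phi> n = \<Sum>i. n i * \<gamma> i\<close> is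
  injective on \<open>\<nat>^r\<close>, and since \<open>S\<close> is generated in the degrees \<open>\<gamma> i\<close> over its degree-zero part,
  its components vanish outside \<open>\<phi> ` \<nat>^r\<close>. Grading \<open>S\<close> by \<open>n\<close> instead of \<open>\<phi> n\<close> changes neither its
  homogeneous elements nor \<open>Proj\<close> nor the homogeneous localizations (locale \<open>triangular_graded\<close>).
  So \<open>g i j\<close> may be assumed to have the \<open>i\<close>-th unit vector as its degree, and the Veronese subring
  is the part of \<open>S\<close> in the degrees \<open>(a i * n i)\<close>.

  For the flatness, consider a point \<open>p\<close> of \<open>Proj\<close>. For each \<open>i\<close> some \<open>g i j\<close> avoids \<open>p\<close>
  (\<open>Proj_gen_notin\<close>); the monomials in these elements give a multiplicative family \<open>x n\<close> of
  homogeneous elements outside \<open>p\<close>, one in each degree \<open>n\<close>. Let \<open>A\<close> be the homogeneous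
  localization at \<open>p\<close>. Sending \<open>s\<close> of degree \<open>d\<close> to \<open>(s / x d) X^d\<close> is a ring homomorphism from
  \<open>S\<close> to \<open>A[X\<^sub>1, \<dots>, X\<^sub>r]\<close>, and inverting the homogeneous elements outside \<open>p\<close> turns \<open>S\<close> into the
  Laurent polynomial ring over \<open>A\<close>. The localization \<open>S\<^sub>p\<close> is a further localization of that free
  \<open>A\<close>-module, hence flat, and the maximal ideal of \<open>A\<close> generates that of \<open>S\<^sub>p\<close>. In elementary
  terms: \<open>S\<^sub>p \<otimes> M\<close> is the localization of the \<open>S\<close>-module \<open>M[X\<^sub>1, \<dots>, X\<^sub>r]\<close> at \<open>p\<close> (\<open>tensor_rep\<close>,
  \<open>tensor_zero_iff\<close>). Passing from \<open>M\<close> to this localization preserves exactness, and it reflects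
  exactness because an element of \<open>S\<close> outside \<open>p\<close> has a unit of \<open>A\<close> among its coefficients
  (\<open>act_values_unit\<close>).

  As for the Veronese subring \<open>W\<close>, it contains a fixed power of every homogeneous element of \<open>S\<close>,
  and it contains the part of degree zero, so \<open>S\<close> is a finitely generated \<open>W\<close>-module. One
  elimination lemma, in the spirit of the determinant trick, yields both integrality and lying
  over (\<open>elimination\<close>, \<open>lie_over\<close>); together with incomparability these transport chains of primes
  between \<open>W\<close> and \<open>S\<close>, which gives the equality of dimensions. A homogeneous prime is the only
  prime over its contraction (\<open>homog_prime_unique\<close>), so the chains that end in \<open>p \<inter> W\<close> lift to
  chains that end in \<open>p\<close>, which gives the equality of heights. Contraction is also the
  homeomorphism: the homogeneous elements of a prime over \<open>q\<close> generate a homogeneous prime over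
  \<open>q\<close> (\<open>Proj_lift\<close>), and closed sets correspond because homogeneous elements have powers in \<open>W\<close>.

  For the modules, take \<open>N\<close> such that \<open>s^N\<close> lies in \<open>W\<close> for homogeneous \<open>s\<close>. The identity \<open>m / s =
  s^(N-1) m / s^N\<close> makes the natural map surjective, and multiplying a relation by \<open>u^(N-1)\<close> makes
  it injective (\<open>veronese_localization_iso\<close>).
\<close>

section \<open>Multidegrees and direct sums\<close>

lemma Nvec_zero [simp, intro]: "deg_zero \<in> Nvec r"
  by (simp add: Nvec_def Zvec_def)

lemma Nvec_add [simp, intro]: "d \<in> Nvec r \<Longrightarrow> e \<in> Nvec r \<Longrightarrow> deg_add d e \<in> Nvec r"
  by (simp add: Nvec_def Zvec_def)

text \<open>Applying \<open>\<pi> e\<close> to \<open>x = \<Sum>d. c d\<close> isolates \<open>c e\<close>, so a decomposition is unique; it exists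
  because every projection kills \<open>x - \<Sum>d. \<pi> d x\<close>.\<close>

lemma is_direct_sumI:
  fixes R (structure)
  assumes "abelian_group R"
    and sub: "\<And>d. d \<in> D \<Longrightarrow> additive_subgroup (G d) R"
    and mem: "\<And>d x. d \<in> D \<Longrightarrow> x \<in> carrier R \<Longrightarrow> \<pi> d x \<in> G d"
    and add: "\<And>d x y. d \<in> D \<Longrightarrow> x \<in> carrier R \<Longrightarrow> y \<in> carrier R \<Longrightarrow> \<pi> d (x \<oplus> y) = \<pi> d x \<oplus> \<pi> d y"
    and idem: "\<And>d x. d \<in> D \<Longrightarrow> x \<in> G d \<Longrightarrow> \<pi> d x = x"
    and orth: "\<And>d e x. d \<in> D \<Longrightarrow> e \<in> D \<Longrightarrow> d \<noteq> e \<Longrightarrow> x \<in> G d \<Longrightarrow> \<pi> e x = \<zero>"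
    and fin: "\<And>x. x \<in> carrier R \<Longrightarrow> finite {d \<in> D. \<pi> d x \<noteq> \<zero>}"
    and inj: "\<And>x. x \<in> carrier R \<Longrightarrow> (\<And>d. d \<in> D \<Longrightarrow> \<pi> d x = \<zero>) \<Longrightarrow> x = \<zero>"
  shows "is_direct_sum D R G"
proof -
  interpret abelian_group R by fact
  have G_sub: "x \<in> carrier R" if "d \<in> D" "x \<in> G d" for d x
    using sub[OF that(1)] that(2) by (rule additive_subgroup.a_Hcarr)
  have zero: "\<pi> e \<zero> = \<zero>" if "e \<in> D" for e
    using idem[OF that additive_subgroup.zero_closed[OF sub[OF that]]] .
  have sum: "(\<Oplus>d\<in>F. c d) \<in> carrier R \<and> \<pi> e (\<Oplus>d\<in>F. c d) = (if e \<in> F then c e else \<zero>)"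
    if "finite F" "F \<subseteq> D" "\<And>d. d \<in> F \<Longrightarrow> c d \<in> G d" "e \<in> D" for F c e
    using that
  proof (induction F rule: finite_induct)
    case empty
    then show ?case by (simp add: zero)
  next
    case (insert d F)
    have c: "c \<in> F \<rightarrow> carrier R" "c d \<in> carrier R" using insert G_sub by (auto simp: subset_iff)
    have "(\<Oplus>d\<in>insert d F. c d) = c d \<oplus> (\<Oplus>d\<in>F. c d)"
      using insert c by (intro finsum_insert) auto
    moreover have "\<pi> e (c d) = (if e = d then c e else \<zero>)"
      using idem orth insert by auto
    ultimately show ?case using insert c add by (auto simp: G_sub)
  qed
  show ?thesis
    unfolding is_direct_sum_def
  proof (intro conjI ballI)
    fix x assume x: "x \<in> carrier R"
    let ?c = "restrict (\<lambda>d. \<pi> d x) D"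
    let ?F = "{d \<in> D. ?c d \<noteq> \<zero>}"
    have Feq: "?F = {d \<in> D. \<pi> d x \<noteq> \<zero>}" by auto
    have F: "finite ?F" unfolding Feq by (rule fin[OF x])
    have s: "(\<Oplus>d\<in>?F. ?c d) \<in> carrier R" "\<And>e. e \<in> D \<Longrightarrow> \<pi> e (\<Oplus>d\<in>?F. ?c d) = \<pi> e x"
    proof -
      show *: "\<pi> e (\<Oplus>d\<in>?F. ?c d) = \<pi> e x" if "e \<in> D" for e
        using sum[OF F _ _ that, of ?c] mem x that by auto
      have "(\<Oplus>d\<in>?F. ?c d) \<in> carrier R"
        using mem x G_sub by (intro finsum_closed) auto
      then show "(\<Oplus>d\<in>?F. ?c d) \<in> carrier R" .
    qed
    have neg: "\<pi> e (\<ominus> y) = \<ominus> \<pi> e y" if "e \<in> D" "y \<in> carrier R" for e y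
      using add[OF that(1), of y "\<ominus> y"] that zero G_sub[OF that(1) mem[OF that]]
        G_sub[OF that(1) mem[OF that(1), of "\<ominus> y"]]
      by (metis a_inv_closed minus_equality r_neg a_comm)
    have "x \<ominus> (\<Oplus>d\<in>?F. ?c d) = \<zero>"
    proof (rule inj)
      fix e assume e: "e \<in> D"
      have *: "\<pi> e (x \<oplus> \<ominus> y) = \<pi> e x \<oplus> \<ominus> \<pi> e y" if "y \<in> carrier R" for y
        using that x e add neg by simp
      show "\<pi> e (x \<ominus> (\<Oplus>d\<in>?F. ?c d)) = \<zero>"
        unfolding minus_eq *[OF s(1)] s(2)[OF e] by (rule r_neg[OF G_sub[OF e mem[OF e x]]])
    qed (use x s in auto)
    then have eq: "x = (\<Oplus>d\<in>?F. ?c d)"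
      using x s(1) minus_equality[of x "\<ominus> (\<Oplus>d\<in>?F. ?c d)"] by (simp add: minus_eq)
    show "\<exists>!c. c \<in> (\<Pi>\<^sub>E d \<in> D. G d) \<and> finite {d \<in> D. c d \<noteq> \<zero>} \<and>
        x = (\<Oplus>d \<in> {d \<in> D. c d \<noteq> \<zero>}. c d)"
    proof (rule ex1I[of _ ?c])
      show "?c \<in> (\<Pi>\<^sub>E d \<in> D. G d) \<and> finite ?F \<and> x = (\<Oplus>d \<in> ?F. ?c d)"
        using mem x F eq by auto
      fix c assume c: "c \<in> (\<Pi>\<^sub>E d \<in> D. G d) \<and> finite {d \<in> D. c d \<noteq> \<zero>} \<and>
        x = (\<Oplus>d \<in> {d \<in> D. c d \<noteq> \<zero>}. c d)"
      show "c = ?c"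
      proof
        fix e
        show "c e = ?c e"
        proof (cases "e \<in> D")
          case True
          have "\<pi> e x = (if e \<in> {d \<in> D. c d \<noteq> \<zero>} then c e else \<zero>)"
            using sum[of "{d \<in> D. c d \<noteq> \<zero>}" c e] c True by (auto simp: PiE_iff)
          then show ?thesis using True by auto
        next
          case False
          then show ?thesis using c by (auto simp: PiE_iff extensional_def)
        qed
      qed
    qed
  qed (use sub in auto)
qed

section \<open>Homogeneous components\<close>

locale multigraded_ring = cring S for S (structure) +
  fixes r :: nat and G :: "mdeg \<Rightarrow> 'a set"
  assumes graded: "graded_ring (Nvec r) S G"
begin

lemma G_additive: "d \<in> Nvec r \<Longrightarrow> additive_subgroup (G d) S"
  using graded by (auto simp: graded_ring_def is_direct_sum_def)

lemma G_carrier: "d \<in> Nvec r \<Longrightarrow> x \<in> G d \<Longrightarrow> x \<in> carrier S"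
  using G_additive additive_subgroup.a_Hcarr by fast

lemma G_one [simp]: "\<one> \<in> G deg_zero"
  using graded by (auto simp: graded_ring_def)

lemma G_zero [simp]: "d \<in> Nvec r \<Longrightarrow> \<zero> \<in> G d"
  using G_additive additive_subgroup.zero_closed by fast

lemma G_add [simp]: "d \<in> Nvec r \<Longrightarrow> x \<in> G d \<Longrightarrow> y \<in> G d \<Longrightarrow> x \<oplus> y \<in> G d"
  using G_additive additive_subgroup.a_closed by fast

lemma G_neg [simp]: "d \<in> Nvec r \<Longrightarrow> x \<in> G d \<Longrightarrow> \<ominus> x \<in> G d"
  using G_additive additive_subgroup.a_inv_closed by (metis a_inv_def)

lemma G_mult: "d \<in> Nvec r \<Longrightarrow> e \<in> Nvec r \<Longrightarrow> x \<in> G d \<Longrightarrow> y \<in> G e \<Longrightarrow> x \<otimes> y \<in> G (deg_add d e)"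
  using graded by (auto simp: graded_ring_def)

lemma G_pow: "d \<in> Nvec r \<Longrightarrow> x \<in> G d \<Longrightarrow> x [^] (n::nat) \<in> G (\<lambda>i. int n * d i)"
proof (induction n)
  case (Suc n)
  have "(\<lambda>i. int n * d i) \<in> Nvec r" using Suc by (auto simp: Nvec_def Zvec_def)
  then have "x [^] n \<otimes> x \<in> G (\<lambda>i. int n * d i + d i)"
    using Suc by (intro G_mult) auto
  then show ?case by (simp add: algebra_simps)
qed simp

text \<open>Components are zero for degrees outside \<open>\<nat>^r\<close>, so that a difference of degrees may be used
  as a degree without a case distinction.\<close>

definition hcomp :: "mdeg \<Rightarrow> 'a \<Rightarrow> 'a" where
  "hcomp d x = (if d \<in> Nvec r \<and> x \<in> carrier S then
     (THE c. c \<in> (\<Pi>\<^sub>E d \<in> Nvec r. G d) \<and> finite {d \<in> Nvec r. c d \<noteq> \<zero>} \<and>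
        x = (\<Oplus>d \<in> {d \<in> Nvec r. c d \<noteq> \<zero>}. c d)) d else \<zero>)"

definition supp :: "'a \<Rightarrow> mdeg set" where
  "supp x = {d. hcomp d x \<noteq> \<zero>}"

lemma hcomp_prelim:
  assumes "x \<in> carrier S"
  shows "\<And>d. d \<in> Nvec r \<Longrightarrow> hcomp d x \<in> G d" "finite (supp x)" "x = (\<Oplus>d\<in>supp x. hcomp d x)"
proof -
  let ?P = "\<lambda>c. c \<in> (\<Pi>\<^sub>E d \<in> Nvec r. G d) \<and> finite {d \<in> Nvec r. c d \<noteq> \<zero>} \<and>
        x = (\<Oplus>d \<in> {d \<in> Nvec r. c d \<noteq> \<zero>}. c d)"
  have "\<exists>!c. ?P c" using graded assms by (simp add: graded_ring_def is_direct_sum_def)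
  then have P: "?P (The ?P)" by (rule theI')
  have h: "d \<in> Nvec r \<Longrightarrow> hcomp d x = The ?P d" for d
    using assms by (simp add: hcomp_def)
  have s: "supp x = {d \<in> Nvec r. The ?P d \<noteq> \<zero>}"
    using assms unfolding supp_def by (auto simp: h) (auto simp: hcomp_def split: if_splits)
  have cc: "The ?P d \<in> carrier S" if "d \<in> Nvec r" for d
    using P G_carrier[OF that, of "The ?P d"] that unfolding PiE_iff by blast
  show "\<And>d. d \<in> Nvec r \<Longrightarrow> hcomp d x \<in> G d" using P h by (auto simp: PiE_iff)
  show "finite (supp x)" using P s by simp
  have "x = (\<Oplus>d \<in> {d \<in> Nvec r. The ?P d \<noteq> \<zero>}. The ?P d)" using P by blast
  also have "\<dots> = (\<Oplus>d\<in>supp x. hcomp d x)"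
    unfolding s using cc by (intro finsum_cong') (auto simp: h)
  finally show "x = (\<Oplus>d\<in>supp x. hcomp d x)" .
qed

lemma hcomp_G [simp]: "x \<in> carrier S \<Longrightarrow> d \<in> Nvec r \<Longrightarrow> hcomp d x \<in> G d"
  by (rule hcomp_prelim(1))

lemma hcomp_outside: "d \<notin> Nvec r \<Longrightarrow> hcomp d x = \<zero>"
  by (simp add: hcomp_def)

lemma hcomp_closed [simp]: "hcomp d x \<in> carrier S"
  by (cases "d \<in> Nvec r \<and> x \<in> carrier S") (metis G_carrier hcomp_G, auto simp: hcomp_def)

lemma finite_supp [simp]: "x \<in> carrier S \<Longrightarrow> finite (supp x)"
  by (rule hcomp_prelim(2))

lemma supp_Nvec: "supp x \<subseteq> Nvec r"
  using hcomp_outside by (auto simp: supp_def)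

lemma hcomp_decomp: "x \<in> carrier S \<Longrightarrow> x = (\<Oplus>d\<in>supp x. hcomp d x)"
  by (rule hcomp_prelim(3))

lemma hcomp_decomp':
  assumes "x \<in> carrier S" "finite F" "supp x \<subseteq> F" shows "(\<Oplus>d\<in>F. hcomp d x) = x"
proof -
  have "(\<Oplus>d\<in>supp x. hcomp d x) = (\<Oplus>d\<in>F. hcomp d x)"
    using assms by (intro add.finprod_mono_neutral_cong_left) (auto simp: supp_def)
  then show ?thesis using hcomp_decomp[OF assms(1)] by simp
qed

lemma hcomp_unique:
  assumes F: "finite F" "F \<subseteq> Nvec r" and c: "\<And>d. d \<in> F \<Longrightarrow> c d \<in> G d"
    and x: "x = (\<Oplus>d\<in>F. c d)"
  shows "hcomp d x = (if d \<in> F then c d else \<zero>)"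
proof (cases "d \<in> Nvec r")
  case True
  let ?P = "\<lambda>c. c \<in> (\<Pi>\<^sub>E d \<in> Nvec r. G d) \<and> finite {d \<in> Nvec r. c d \<noteq> \<zero>} \<and>
        x = (\<Oplus>d \<in> {d \<in> Nvec r. c d \<noteq> \<zero>}. c d)"
  have carr: "c d \<in> carrier S" if "d \<in> F" for d using c[OF that] that F G_carrier by blast
  have xc: "x \<in> carrier S" unfolding x using carr by (intro finsum_closed) auto
  have ex: "\<exists>!c. ?P c" using graded xc by (simp add: graded_ring_def is_direct_sum_def)
  let ?c = "restrict (\<lambda>d. if d \<in> F then c d else \<zero>) (Nvec r)"
  have sub: "{d \<in> Nvec r. ?c d \<noteq> \<zero>} \<subseteq> F" by auto
  have "(\<Oplus>d \<in> {d \<in> Nvec r. ?c d \<noteq> \<zero>}. ?c d) = (\<Oplus>d\<in>F. c d)"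
    using F sub carr by (intro add.finprod_mono_neutral_cong_left) auto
  then have "?P ?c" using c F x finite_subset[OF sub F(1)] by auto
  then have "The ?P = ?c" using ex by (intro the1_equality)
  then show ?thesis using True xc by (simp add: hcomp_def)
qed (use F hcomp_outside in auto)

lemma hcomp_homog:
  assumes "d \<in> Nvec r" "x \<in> G d"
  shows "hcomp e x = (if e = d then x else \<zero>)"
  using hcomp_unique[of "{d}" "\<lambda>_. x" x e] assms G_carrier[OF assms] by auto

lemma supp_homog: "d \<in> Nvec r \<Longrightarrow> x \<in> G d \<Longrightarrow> supp x \<subseteq> {d}"
  by (auto simp: supp_def hcomp_homog[of d x])

lemma hcomp_add [simp]:
  assumes "x \<in> carrier S" "y \<in> carrier S"
  shows "hcomp d (x \<oplus> y) = hcomp d x \<oplus> hcomp d y"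
proof -
  let ?F = "supp x \<union> supp y"
  have F: "finite ?F" "?F \<subseteq> Nvec r" using assms supp_Nvec by auto
  have "(\<Oplus>d\<in>?F. hcomp d x \<oplus> hcomp d y) = (\<Oplus>d\<in>?F. hcomp d x) \<oplus> (\<Oplus>d\<in>?F. hcomp d y)"
    by (intro finsum_addf) auto
  also have "\<dots> = x \<oplus> y" using assms F by (simp add: hcomp_decomp')
  finally have "x \<oplus> y = (\<Oplus>d\<in>?F. hcomp d x \<oplus> hcomp d y)" by simp
  from hcomp_unique[OF F _ this, of d] F assms show ?thesis
    by (auto simp: supp_def subset_iff)
qed

lemma hcomp_zero [simp]: "hcomp d \<zero> = \<zero>"
  using hcomp_homog[of deg_zero \<zero> d] by auto

lemma hcomp_neg [simp]: "x \<in> carrier S \<Longrightarrow> hcomp d (\<ominus> x) = \<ominus> hcomp d x"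
  using hcomp_add[of x "\<ominus> x" d] by (simp add: r_neg) (metis hcomp_closed minus_equality a_comm)

lemma hcomp_finsum:
  assumes "finite F" "\<And>i. i \<in> F \<Longrightarrow> f i \<in> carrier S"
  shows "hcomp d (\<Oplus>i\<in>F. f i) = (\<Oplus>i\<in>F. hcomp d (f i))"
  using assms
proof (induction F rule: finite_induct)
  case (insert i F)
  then show ?case by (subst (1 2) finsum_insert) (auto simp: Pi_iff)
qed simp

lemma hcomp_eqI:
  assumes "x \<in> carrier S" "y \<in> carrier S" "\<And>d. d \<in> Nvec r \<Longrightarrow> hcomp d x = hcomp d y"
  shows "x = y"
proof -
  have e: "hcomp d x = hcomp d y" for d using assms(3) hcomp_outside by metis
  then have "supp x = supp y" by (simp add: supp_def)
  then show ?thesis using hcomp_decomp[OF assms(1)] hcomp_decomp[OF assms(2)] e by simp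
qed

text \<open>Identities between additive functions of \<open>x\<close> only have to be checked on homogeneous
  elements.\<close>

lemma homogeneous_induct:
  assumes x: "x \<in> carrier S"
    and zero: "P \<zero>"
    and hom: "\<And>d y. d \<in> supp x \<Longrightarrow> d \<in> Nvec r \<Longrightarrow> y \<in> G d \<Longrightarrow> P y"
    and add: "\<And>y z. y \<in> carrier S \<Longrightarrow> z \<in> carrier S \<Longrightarrow> P y \<Longrightarrow> P z \<Longrightarrow> P (y \<oplus> z)"
  shows "P x"
proof -
  have "P (\<Oplus>d\<in>F. hcomp d x)" if "finite F" "F \<subseteq> supp x" for F
    using that
  proof (induction F rule: finite_induct)
    case empty
    then show ?case by (simp add: zero)
  next
    case (insert d F)
    then show ?case using hom[of d "hcomp d x"] supp_Nvec x
      by (subst finsum_insert) (auto intro!: add)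
  qed
  from this[of "supp x"] x show ?thesis using hcomp_decomp[OF x] by simp
qed

lemma hcomp_mult_homog:
  assumes d: "d \<in> Nvec r" "x \<in> G d" and y: "y \<in> carrier S"
  shows "hcomp m (x \<otimes> y) = x \<otimes> hcomp (\<lambda>i. m i - d i) y"
  using y
proof (rule homogeneous_induct[of y])
  fix e z assume e: "e \<in> Nvec r" "z \<in> G e"
  have "(m = deg_add d e) = ((\<lambda>i. m i - d i) = e)" unfolding fun_eq_iff by (smt (verit))
  then show "hcomp m (x \<otimes> z) = x \<otimes> hcomp (\<lambda>i. m i - d i) z"
    using d e G_carrier[OF d] by (simp add: hcomp_homog[OF Nvec_add[OF d(1) e(1)] G_mult[OF d(1)
        e(1) d(2) e(2)]] hcomp_homog[OF e])
next
  fix u v assume "u \<in> carrier S" "v \<in> carrier S"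
   "hcomp m (x \<otimes> u) = x \<otimes> hcomp (\<lambda>i. m i - d i) u" "hcomp m (x \<otimes> v) = x \<otimes> hcomp (\<lambda>i. m i - d i) v"
  then show "hcomp m (x \<otimes> (u \<oplus> v)) = x \<otimes> hcomp (\<lambda>i. m i - d i) (u \<oplus> v)"
    using G_carrier[OF d] by (simp add: r_distr)
qed (use G_carrier[OF d] in simp_all)

lemma hcomp_mult:
  assumes x: "x \<in> carrier S" and y: "y \<in> carrier S"
  shows "hcomp m (x \<otimes> y) = (\<Oplus>d\<in>supp x. hcomp d x \<otimes> hcomp (\<lambda>i. m i - d i) y)"
proof -
  have "x \<otimes> y = (\<Oplus>d\<in>supp x. hcomp d x \<otimes> y)"
    using x y by (subst (1) hcomp_decomp[OF x]) (simp add: finsum_ldistr)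
  also have "hcomp m \<dots> = (\<Oplus>d\<in>supp x. hcomp m (hcomp d x \<otimes> y))"
    using x y by (intro hcomp_finsum) auto
  also have "\<dots> = (\<Oplus>d\<in>supp x. hcomp d x \<otimes> hcomp (\<lambda>i. m i - d i) y)"
    using x y supp_Nvec by (intro finsum_cong') (auto simp: hcomp_mult_homog subset_iff)
  finally show ?thesis .
qed

text \<open>The degrees occurring in a product are sums of degrees occurring in the factors.\<close>

lemma supported_subring:
  assumes E: "deg_zero \<in> E" "\<And>d e. d \<in> E \<Longrightarrow> e \<in> E \<Longrightarrow> deg_add d e \<in> E"
  shows "subring {x \<in> carrier S. supp x \<subseteq> E} S"
proof (rule subringI)
  show "\<one> \<in> {x \<in> carrier S. supp x \<subseteq> E}" using E hcomp_homog[OF Nvec_zero G_one]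
      by (auto simp: supp_def)
next
  fix x y assume xy: "x \<in> {x \<in> carrier S. supp x \<subseteq> E}" "y \<in> {x \<in> carrier S. supp x \<subseteq> E}"
  have "m \<in> E" if "hcomp m (x \<otimes> y) \<noteq> \<zero>" for m
  proof (rule ccontr)
    assume m: "m \<notin> E"
    have "(\<Oplus>d\<in>supp x. hcomp d x \<otimes> hcomp (\<lambda>i. m i - d i) y) = (\<Oplus>d\<in>supp x. \<zero>)"
    proof (rule finsum_cong')
      fix d assume d: "d \<in> supp x"
      have "hcomp (\<lambda>i. m i - d i) y = \<zero>"
      proof (rule ccontr)
        assume "\<not> ?thesis"
        then have "(\<lambda>i. m i - d i) \<in> E" using xy by (auto simp: supp_def)
        then have "deg_add d (\<lambda>i. m i - d i) \<in> E" using E d xy by blast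
        then show False using m by simp
      qed
      then show "hcomp d x \<otimes> hcomp (\<lambda>i. m i - d i) y = \<zero>" by simp
    qed auto
    then show False using that xy by (simp add: hcomp_mult)
  qed
  then show "x \<otimes> y \<in> {x \<in> carrier S. supp x \<subseteq> E}" using xy by (auto simp: supp_def)
  show "x \<oplus> y \<in> {x \<in> carrier S. supp x \<subseteq> E}" using xy
      by (auto simp: supp_def) (metis (mono_tags, lifting) l_zero mem_Collect_eq subset_iff
      zero_closed)
qed (auto simp: supp_def)

end

section \<open>Homogeneous ideals and homogeneous primes\<close>

lemma (in ideal) ideal_finsum_closed:
  assumes "finite F" "\<And>i. i \<in> F \<Longrightarrow> f i \<in> I"
  shows "(\<Oplus>i\<in>F. f i) \<in> I"
  using assms
proof (induction F rule: finite_induct)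
  case (insert i F)
  have "(\<Oplus>i\<in>insert i F. f i) = f i \<oplus> (\<Oplus>i\<in>F. f i)"
    using insert Icarr by (intro finsum_insert) auto
  then show ?case using insert by (auto intro: a_closed)
qed (simp add: zero_closed)

lemma (in ideal) mem_if_add_mem:
  assumes "x \<in> carrier R" "x \<oplus> y \<in> I" "y \<in> I"
  shows "x \<in> I"
proof -
  have "x \<oplus> y \<oplus> \<ominus> y \<in> I"
    using additive_subgroup.a_closed[OF additive_subgroup_axioms assms(2)
      additive_subgroup.a_inv_closed[OF additive_subgroup_axioms assms(3)]] by (simp add: a_inv_def)
  then show ?thesis using assms Icarr by (simp add: a_assoc r_neg)
qed

lemma (in ring) idealI':
  assumes "J \<subseteq> carrier R" "\<zero> \<in> J" "\<And>x y. x \<in> J \<Longrightarrow> y \<in> J \<Longrightarrow> x \<oplus> y \<in> J"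
    "\<And>x y. x \<in> J \<Longrightarrow> y \<in> carrier R \<Longrightarrow> y \<otimes> x \<in> J"
    "\<And>x y. x \<in> J \<Longrightarrow> y \<in> carrier R \<Longrightarrow> x \<otimes> y \<in> J"
  shows "ideal J R"
proof (rule idealI[OF ring_axioms])
  have "\<ominus> x \<in> J" if "x \<in> J" for x
    using assms(4)[OF that, of "\<ominus> \<one>"] assms(1) that by (auto simp: l_minus)
  then show "subgroup J (add_monoid R)"
    using assms by (intro add.subgroupI) (auto simp: a_inv_def)
qed (use assms in auto)

lemma Nvec_diff_finite: "k \<in> Nvec r \<Longrightarrow> l \<in> Nvec r \<Longrightarrow> finite {i. k i \<noteq> l i}"
  by (rule finite_subset[of _ "{1..r}"]) (auto simp: Nvec_def Zvec_def)

text \<open>Two elements of \<open>\<nat>^r\<close> differ in finitely many places, so the lexicographic order is total on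
  them; it supplies leading components.\<close>

lemma Nvec_lex_max:
  assumes "finite A" "A \<noteq> {}" "A \<subseteq> Nvec r"
  obtains m where "m \<in> A" "\<And>k. k \<in> A \<Longrightarrow> k \<noteq> m \<Longrightarrow> less_fun k m"
proof -
  have "\<exists>m\<in>A. \<forall>x\<in>A. x \<noteq> m \<longrightarrow> \<not> less_fun m x"
    using assms less_fun_asym less_fun_trans
    by (intro Finite_Set.bex_max_element) (auto simp: asymp_on_def transp_on_def, blast)
  then show ?thesis using that assms less_fun_trichotomy Nvec_diff_finite by (metis subset_iff)
qed

context multigraded_ring
begin

text \<open>The elements of \<open>J\<close> all of whose components lie in \<open>J\<close> form an ideal. It contains the
  homogeneous elements of \<open>J\<close>, hence is all of \<open>J\<close> when these generate \<open>J\<close>.\<close>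

lemma homogeneous_ideal_iff:
  "homogeneous_ideal (Nvec r) S G J \<longleftrightarrow> ideal J S \<and> (\<forall>x\<in>J. \<forall>d. hcomp d x \<in> J)"
proof (intro iffI conjI)
  assume h: "homogeneous_ideal (Nvec r) S G J"
  then show "ideal J S" by (simp add: homogeneous_ideal_def)
  then interpret J: ideal J S .
  let ?J' = "{x \<in> J. \<forall>d. hcomp d x \<in> J}"
  have idJ': "ideal ?J' S"
  proof (rule idealI')
    fix x y assume x: "x \<in> ?J'" and y: "y \<in> carrier S"
    have "hcomp m (y \<otimes> x) \<in> J" for m
      using x y by (simp add: hcomp_mult J.Icarr) (intro J.ideal_finsum_closed J.I_l_closed, auto)
    then show yx: "y \<otimes> x \<in> ?J'" using x y J.I_l_closed by auto
    then show "x \<otimes> y \<in> ?J'" using x y J.Icarr m_comm by fastforce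
  qed (auto simp: J.Icarr)
  moreover have "J \<inter> (\<Union>d \<in> Nvec r. G d) \<subseteq> ?J'"
    by (auto simp: hcomp_homog)
  with idJ' have "Idl (J \<inter> (\<Union>d \<in> Nvec r. G d)) \<subseteq> ?J'" by (rule genideal_minimal)
  then show "\<forall>x\<in>J. \<forall>d. hcomp d x \<in> J" using h by (auto simp: homogeneous_ideal_def)
next
  assume h: "ideal J S \<and> (\<forall>x\<in>J. \<forall>d. hcomp d x \<in> J)"
  then interpret J: ideal J S by simp
  let ?I = "Idl (J \<inter> (\<Union>d \<in> Nvec r. G d))"
  have sub: "J \<inter> (\<Union>d \<in> Nvec r. G d) \<subseteq> carrier S" using G_carrier by blast
  interpret I: ideal ?I S by (rule genideal_ideal[OF sub])
  have "J \<subseteq> ?I"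
  proof
    fix x assume x: "x \<in> J"
    have "hcomp d x \<in> ?I" if "d \<in> supp x" for d
      using that x h supp_Nvec[of x] genideal_self[OF sub] hcomp_G[OF J.Icarr[OF x], of d] by blast
    then have "(\<Oplus>d\<in>supp x. hcomp d x) \<in> ?I" using x
        by (intro I.ideal_finsum_closed) (auto simp: J.Icarr)
    then show "x \<in> ?I" using hcomp_decomp[of x] x J.Icarr by simp
  qed
  moreover have "?I \<subseteq> J" using h by (intro genideal_minimal) auto
  ultimately show "homogeneous_ideal (Nvec r) S G J" using h by (auto simp: homogeneous_ideal_def)
qed

lemma genideal_homogeneous:
  assumes "H \<subseteq> (\<Union>d \<in> Nvec r. G d)"
  shows "homogeneous_ideal (Nvec r) S G (Idl H)"
proof -
  have H: "H \<subseteq> carrier S" using assms G_carrier by blast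
  have I: "ideal (Idl H) S" by (rule genideal_ideal[OF H])
  have Y: "Idl H \<inter> (\<Union>d \<in> Nvec r. G d) \<subseteq> carrier S" using ideal.Icarr[OF I] by blast
  have "H \<subseteq> Idl H \<inter> (\<Union>d \<in> Nvec r. G d)" using genideal_self[OF H] assms by simp
  then have "Idl H \<subseteq> Idl (Idl H \<inter> (\<Union>d \<in> Nvec r. G d))"
    by (intro genideal_minimal[OF genideal_ideal[OF Y]] subset_trans[OF _ genideal_self[OF Y]])
  moreover have "Idl (Idl H \<inter> (\<Union>d \<in> Nvec r. G d)) \<subseteq> Idl H" by (intro genideal_minimal I) auto
  ultimately show ?thesis using I unfolding homogeneous_ideal_def by blast
qed

lemma homogeneous_mem_iff:
  assumes "ideal J S" "\<forall>x\<in>J. \<forall>d. hcomp d x \<in> J" "x \<in> carrier S"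
  shows "x \<in> J \<longleftrightarrow> (\<forall>d\<in>Nvec r. hcomp d x \<in> J)"
proof
  interpret J: ideal J S by fact
  assume "\<forall>d\<in>Nvec r. hcomp d x \<in> J"
  then have "(\<Oplus>d\<in>supp x. hcomp d x) \<in> J"
    using assms supp_Nvec by (intro J.ideal_finsum_closed) auto
  then show "x \<in> J" using hcomp_decomp[OF assms(3)] by simp
qed (use assms in auto)

text \<open>The argument of leading terms: for \<open>a\<close>, \<open>b\<close> outside \<open>J\<close> let \<open>d\<close> and \<open>e\<close> be the largest
  degrees in which their components are outside \<open>J\<close>. Every product of components that contributes
  to degree \<open>d + e\<close> of \<open>a b\<close> has a factor in \<open>J\<close>, except for the product of those two leading
  components.\<close>

lemma homogeneous_primeI:
  assumes J: "ideal J S" "\<And>x d. x \<in> J \<Longrightarrow> hcomp d x \<in> J" and one: "\<one> \<notin> J"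
    and prime: "\<And>d e x y. d \<in> Nvec r \<Longrightarrow> e \<in> Nvec r \<Longrightarrow> x \<in> G d \<Longrightarrow> y \<in> G e \<Longrightarrow> x \<otimes> y \<in> J \<Longrightarrow> x \<in> J \<or> y \<in> J"
  shows "primeideal J S"
proof (rule primeidealI)
  interpret J: ideal J S by fact
  fix a b assume a: "a \<in> carrier S" and b: "b \<in> carrier S" and ab: "a \<otimes> b \<in> J"
  show "a \<in> J \<or> b \<in> J"
  proof (rule ccontr)
    assume "\<not> ?thesis"
    then have na: "a \<notin> J" and nb: "b \<notin> J" by auto
    define A where "A x = {d. hcomp d x \<notin> J}" for x
    have A: "finite (A x)" "A x \<noteq> {}" "A x \<subseteq> Nvec r" if "x \<in> carrier S" "x \<notin> J" for x
    proof -
      have "A x \<subseteq> supp x" using J.zero_closed by (auto simp: A_def supp_def)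
      then show "finite (A x)" "A x \<subseteq> Nvec r" using that supp_Nvec finite_subset
          by (blast intro: finite_supp)+
      show "A x \<noteq> {}" using that homogeneous_mem_iff[of J x] J by (auto simp: A_def)
    qed
    obtain d where d: "d \<in> A a" and dmax: "\<And>k. k \<in> A a \<Longrightarrow> k \<noteq> d \<Longrightarrow> less_fun k d"
      using Nvec_lex_max[OF A[OF a na]] by blast
    obtain e where e: "e \<in> A b" and emax: "\<And>k. k \<in> A b \<Longrightarrow> k \<noteq> e \<Longrightarrow> less_fun k e"
      using Nvec_lex_max[OF A[OF b nb]] by blast
    let ?t = "\<lambda>k. hcomp k a \<otimes> hcomp (\<lambda>i. deg_add d e i - k i) b"
    have dn: "d \<in> Nvec r" "e \<in> Nvec r" "d \<in> supp a" using d e A[OF a na] A[OF b nb] J.zero_closed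
      by (auto simp: A_def supp_def)
    have other: "?t k \<in> J" if "k \<noteq> d" for k
    proof (cases "k \<in> A a \<and> (\<lambda>i. deg_add d e i - k i) \<in> A b")
      case True
      let ?l = "\<lambda>i. deg_add d e i - k i"
      \<comment> \<open>If both factors were outside \<open>J\<close>, then \<open>k\<close> would be below \<open>d\<close>, hence the complementary
        degree above \<open>e\<close>.\<close>
      from True dmax that obtain j where j: "k j < d j" "\<And>j'. j' < j \<Longrightarrow> k j' = d j'"
          by (metis less_funE)
      have "less_fun e ?l" using j by (intro less_funI exI[of _ j]) auto
      moreover have "?l \<noteq> e" using j by (auto simp: fun_eq_iff intro!: exI[of _ j])
      ultimately show ?thesis using emax True less_fun_asym by blast
    next
      case False
      then show ?thesis by (auto simp: A_def intro: J.I_l_closed J.I_r_closed)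
    qed
    have "(\<Oplus>k\<in>supp a. ?t k) = ?t d \<oplus> (\<Oplus>k\<in>supp a - {d}. ?t k)"
      using a dn(3) finsum_insert[of "supp a - {d}" d ?t] by (simp add: insert_absorb)
    moreover have "(\<Oplus>k\<in>supp a. ?t k) \<in> J" using J(2)[OF ab, of "deg_add d e"]
        by (simp add: hcomp_mult a b)
    moreover have "(\<Oplus>k\<in>supp a - {d}. ?t k) \<in> J" using a other by (intro J.ideal_finsum_closed) auto
    ultimately have "?t d \<in> J"
      using J.mem_if_add_mem[of "?t d"] by simp
    then have "hcomp d a \<otimes> hcomp e b \<in> J" by simp
    then show False using prime[OF dn(1,2), of "hcomp d a" "hcomp e b"] dn d e a b
        by (auto simp: A_def)
  qed
qed (use assms in \<open>auto simp: is_cring\<close>)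

end

text \<open>By the defining property of a prime, applied to one factor after the other; the empty
  product is the whole ring.\<close>

lemma primeideal_finprod_ideals:
  assumes p: "primeideal p S" and A: "finite A" and I: "\<And>i. i \<in> A \<Longrightarrow> ideal (I i) S"
  shows "(\<Otimes>\<^bsub>ideals_set S\<^esub>i\<in>A. I i) \<subseteq> p \<longleftrightarrow> (\<exists>i\<in>A. I i \<subseteq> p)"
proof -
  interpret primeideal p S by fact
  interpret M: comm_monoid "ideals_set S" by (rule ideals_set_is_comm_monoid)
  have car: "carrier (ideals_set S) = {I. ideal I S}" by (simp add: ideals_set_def)
  have mult: "x \<otimes>\<^bsub>ideals_set S\<^esub> y = ideal_prod S x y" for x y by (simp add: ideals_set_def)
  show ?thesis using A I
  proof (induction A rule: finite_induct)
    case empty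
    have "\<not> carrier S \<subseteq> p" using I_notcarr a_subset by blast
    then show ?case using M.finprod_empty[of I] by (simp add: ideals_set_def)
  next
    case (insert i A)
    have Pi: "I \<in> A \<rightarrow> carrier (ideals_set S)" unfolding car using insert.prems by simp
    let ?P = "\<Otimes>\<^bsub>ideals_set S\<^esub>i\<in>A. I i"
    have idP: "ideal ?P S" using M.finprod_closed[OF Pi] car by auto
    have idI: "ideal (I i) S" using insert.prems by simp
    have eq: "(\<Otimes>\<^bsub>ideals_set S\<^esub>i\<in>insert i A. I i) = ideal_prod S (I i) ?P"
      using M.finprod_insert[OF insert(1,2) Pi] idI by (simp add: car mult)
    have "ideal_prod S (I i) ?P \<subseteq> p \<longleftrightarrow> I i \<subseteq> p \<or> ?P \<subseteq> p"
    proof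
      assume h: "ideal_prod S (I i) ?P \<subseteq> p"
      show "I i \<subseteq> p \<or> ?P \<subseteq> p"
      proof (rule ccontr)
        assume "\<not> ?thesis"
        then obtain x y where xy: "x \<in> I i" "x \<notin> p" "y \<in> ?P" "y \<notin> p" by blast
        have "x \<otimes>\<^bsub>S\<^esub> y \<in> p" by (rule subsetD[OF h ideal_prod.prod[OF xy(1,3)]])
        then show False
          using I_prime[OF ideal.Icarr[OF idI xy(1)] ideal.Icarr[OF idP xy(3)]] xy by simp
      qed
    next
      assume "I i \<subseteq> p \<or> ?P \<subseteq> p"
      then show "ideal_prod S (I i) ?P \<subseteq> p" using ideal_prod_inter[OF idI idP]
        by (metis le_inf_iff subset_trans)
    qed
    moreover have "?P \<subseteq> p \<longleftrightarrow> (\<exists>i\<in>A. I i \<subseteq> p)" using insert.IH insert.prems by simp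
    ultimately show ?case unfolding eq by simp
  qed
qed

context multigraded_ring
begin

lemma Proj_iff:
  "p \<in> Proj r S G \<longleftrightarrow> primeideal p S \<and> (\<forall>x\<in>p. \<forall>d. hcomp d x \<in> p) \<and>
     (\<forall>i\<in>{1..r}. \<exists>d\<in>Nvec r. d i \<noteq> 0 \<and> (\<forall>k>i. d k = 0) \<and> \<not> G d \<subseteq> p)"
proof (cases "primeideal p S")
  case True
  then interpret primeideal p S .
  have sub: "(\<Union>d \<in> {d \<in> Nvec r. d i \<noteq> 0 \<and> (\<forall>k>i. d k = 0)}. G d) \<subseteq> carrier S" for i
      using G_carrier by blast
  have fac: "irrelevant_factor r S G i \<subseteq> p \<longleftrightarrow> (\<forall>d\<in>Nvec r. d i \<noteq> 0 \<and> (\<forall>k>i. d k = 0) \<longrightarrow> G d \<subseteq> p)" for i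
    unfolding irrelevant_factor_def Idl_subset_ideal[OF is_ideal sub] by auto
  have "ideal (irrelevant_factor r S G i) S" for i
    unfolding irrelevant_factor_def by (rule genideal_ideal[OF sub])
  then have "irrelevant_ideal r S G \<subseteq> p \<longleftrightarrow> (\<exists>i\<in>{1..r}. irrelevant_factor r S G i \<subseteq> p)"
    unfolding irrelevant_ideal_def using True by (intro primeideal_finprod_ideals) auto
  then show ?thesis unfolding Proj_def using True is_ideal fac by (auto simp: homogeneous_ideal_iff)
qed (auto simp: Proj_def)

lemma supp_add: "x \<in> carrier S \<Longrightarrow> y \<in> carrier S \<Longrightarrow> supp (x \<oplus> y) \<subseteq> supp x \<union> supp y"
  by (auto simp: supp_def)

section \<open>Subrings supported in a submonoid of degrees\<close>

lemma homog_in_veronese: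
  assumes "n \<in> N" "f n \<in> Nvec r" "x \<in> G (f n)"
  shows "x \<in> {x \<in> carrier S. supp x \<subseteq> f ` N}"
  using supp_homog[OF assms(2,3)] G_carrier[OF assms(2,3)] assms(1) by auto

lemma veronese_carrier:
  assumes f: "\<And>n. n \<in> Nvec r \<Longrightarrow> f n \<in> Nvec r"
  shows "generate (add_monoid S) (\<Union>n\<in>Nvec r. G (f n)) = {x \<in> carrier S. supp x \<subseteq> f ` Nvec r}"
proof
  let ?W = "{x \<in> carrier S. supp x \<subseteq> f ` Nvec r}"
  have "subgroup ?W (add_monoid S)"
  proof (rule add.subgroupI)
    show "?W \<noteq> {}" by (auto simp: supp_def intro!: exI[of _ \<zero>])
    fix x y assume "x \<in> ?W" "y \<in> ?W"
    then show "x \<oplus> y \<in> ?W" using supp_add[of x y] by auto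
  qed (auto simp: supp_def simp flip: a_inv_def)
  moreover have "(\<Union>n\<in>Nvec r. G (f n)) \<subseteq> ?W"
  proof clarify
    fix x n assume "n \<in> Nvec r" "x \<in> G (f n)"
    then show "x \<in> carrier S \<and> supp x \<subseteq> f ` Nvec r"
      using homog_in_veronese[of n "Nvec r" f x] f by simp
  qed
  ultimately show "generate (add_monoid S) (\<Union>n\<in>Nvec r. G (f n)) \<subseteq> ?W"
    by (intro add.generate_subgroup_incl)
  show "?W \<subseteq> generate (add_monoid S) (\<Union>n\<in>Nvec r. G (f n))" (is "_ \<subseteq> ?V")
  proof
    fix x assume x: "x \<in> ?W"
    have V: "subgroup ?V (add_monoid S)" using f G_carrier
        by (intro add.generate_is_subgroup) fastforce
    have "x \<in> carrier S" using x by simp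
    then show "x \<in> ?V"
    proof (rule homogeneous_induct)
      show "\<zero> \<in> ?V" using subgroup.one_closed[OF V] by simp
      show "\<And>y z. y \<in> ?V \<Longrightarrow> z \<in> ?V \<Longrightarrow> y \<oplus> z \<in> ?V" using subgroup.m_closed[OF V] by simp
      show "y \<in> ?V" if "d \<in> supp x" "y \<in> G d" for d y
        using that x by (intro generate.incl) auto
    qed
  qed
qed

lemma veronese_subring:
  assumes f: "\<And>n. n \<in> Nvec r \<Longrightarrow> f n \<in> Nvec r" "f deg_zero = deg_zero"
    "\<And>n m. n \<in> Nvec r \<Longrightarrow> m \<in> Nvec r \<Longrightarrow> f (deg_add n m) = deg_add (f n) (f m)"
  shows "subring {x \<in> carrier S. supp x \<subseteq> f ` Nvec r} S"
proof (rule supported_subring)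
  show "deg_zero \<in> f ` Nvec r" using f(2) by (metis Nvec_zero image_eqI)
  fix d e assume "d \<in> f ` Nvec r" "e \<in> f ` Nvec r"
  then obtain n m where "n \<in> Nvec r" "m \<in> Nvec r" "d = f n" "e = f m" by blast
  then have "deg_add d e = f (deg_add n m)" "deg_add n m \<in> Nvec r" using f(3) by auto
  then show "deg_add d e \<in> f ` Nvec r" by blast
qed

text \<open>Two instances matter. For \<open>f n = (a i * n i)\<close> the subring is a Veronese subring of a ring
  whose generators have unit vectors as degrees. For \<open>f n = \<Sum>i. n i * \<gamma> i\<close> it is the whole of \<open>S\<close>,
  and the lemma says that \<open>S\<close> may be graded by \<open>n\<close>.\<close>

lemma veronese_multigraded:
  assumes f: "\<And>n. n \<in> Nvec r \<Longrightarrow> f n \<in> Nvec r" "f deg_zero = deg_zero"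
    "\<And>n m. n \<in> Nvec r \<Longrightarrow> m \<in> Nvec r \<Longrightarrow> f (deg_add n m) = deg_add (f n) (f m)"
    and inj: "inj_on f (Nvec r)"
  defines "W \<equiv> {x \<in> carrier S. supp x \<subseteq> f ` Nvec r}"
  shows "multigraded_ring (S\<lparr>carrier := W\<rparr>) r (\<lambda>n. G (f n))"
    "\<And>n x. n \<in> Nvec r \<Longrightarrow> x \<in> W \<Longrightarrow>
       multigraded_ring.hcomp (S\<lparr>carrier := W\<rparr>) r (\<lambda>n. G (f n)) n x = hcomp (f n) x"
proof -
  let ?V = "S\<lparr>carrier := W\<rparr>"
  have W: "subring W S" unfolding W_def using f by (rule veronese_subring)
  then have cr: "cring ?V" using subcringI' subcring_iff subringE(1) by blast
  then interpret V: cring ?V .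
  have GW: "G (f n) \<subseteq> W" if "n \<in> Nvec r" for n
    unfolding W_def using homog_in_veronese[of n "Nvec r" f] that f(1)[OF that] by auto
  have "is_direct_sum (Nvec r) ?V (\<lambda>n. G (f n))"
  proof (rule is_direct_sumI[of _ _ _ "\<lambda>n. hcomp (f n)"])
    show "abelian_group ?V" ..
    fix n assume n: "n \<in> Nvec r"
    have "subgroup (G (f n)) ((add_monoid S)\<lparr>carrier := W\<rparr>)"
      using W GW[OF n] G_additive[OF f(1)[OF n]]
      by (intro add.subgroup_incl) (auto simp: additive_subgroup_def subring_def)
    then show "additive_subgroup (G (f n)) ?V" by (simp add: additive_subgroup_def)
  next
    fix x assume x: "x \<in> carrier ?V" and z: "\<And>d. d \<in> Nvec r \<Longrightarrow> hcomp (f d) x = \<zero>\<^bsub>?V\<^esub>"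
    have "hcomp d x = \<zero>" if "d \<in> Nvec r" for d using x z by (auto simp: W_def supp_def)
    then show "x = \<zero>\<^bsub>?V\<^esub>" using x hcomp_eqI[of x \<zero>] by (simp add: W_def)
  next
    fix x assume x: "x \<in> carrier ?V"
    have "f ` {d \<in> Nvec r. hcomp (f d) x \<noteq> \<zero>\<^bsub>?V\<^esub>} \<subseteq> supp x" by (auto simp: supp_def)
    then have "finite (f ` {d \<in> Nvec r. hcomp (f d) x \<noteq> \<zero>\<^bsub>?V\<^esub>})"
        using x finite_subset[OF _ finite_supp[of x]] unfolding W_def by simp
    then show "finite {d \<in> Nvec r. hcomp (f d) x \<noteq> \<zero>\<^bsub>?V\<^esub>}"
      using inj by (subst (asm) finite_image_iff) (auto intro: inj_on_subset)
  next
    fix d e x assume de: "d \<in> Nvec r" "e \<in> Nvec r" "d \<noteq> e" and x: "x \<in> G (f d)"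
    have "f e \<noteq> f d" using inj de by (metis inj_onD)
    then show "hcomp (f e) x = \<zero>\<^bsub>?V\<^esub>" using hcomp_homog[OF f(1)[OF de(1)] x, of "f e"] by simp
  next
    fix n x assume n: "n \<in> Nvec r" and x: "x \<in> G (f n)"
    show "hcomp (f n) x = x" using hcomp_homog[OF f(1)[OF n] x] by simp
  qed (use f(1) in \<open>auto simp: W_def\<close>)
  moreover have "x \<otimes> y \<in> G (f (deg_add n m))"
    if "n \<in> Nvec r" "m \<in> Nvec r" "x \<in> G (f n)" "y \<in> G (f m)" for n m x y
    unfolding f(3)[OF that(1,2)] using that f(1) by (intro G_mult)
  moreover have "\<one> \<in> G (f deg_zero)" unfolding f(2) by simp
  ultimately have gr: "graded_ring (Nvec r) ?V (\<lambda>n. G (f n))"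
    unfolding graded_ring_def using cr by simp
  show mg: "multigraded_ring ?V r (\<lambda>n. G (f n))"
    using cr gr by (simp add: multigraded_ring_def multigraded_ring_axioms_def)
  interpret V: multigraded_ring ?V r "\<lambda>n. G (f n)" by (rule mg)
  fix n x assume n: "n \<in> Nvec r" and x: "x \<in> W"
  have "x \<in> carrier ?V" using x by simp
  then show "V.hcomp n x = hcomp (f n) x"
  proof (rule V.homogeneous_induct)
    show "V.hcomp n \<zero>\<^bsub>?V\<^esub> = hcomp (f n) \<zero>\<^bsub>?V\<^esub>" using V.hcomp_zero by simp
    fix d y assume d: "d \<in> Nvec r" and y: "y \<in> G (f d)"
    have "f n = f d \<longleftrightarrow> n = d" using inj d n by (metis inj_onD)
    then show "V.hcomp n y = hcomp (f n) y"
      using V.hcomp_homog[OF d y, of n] hcomp_homog[OF f(1)[OF d] y, of "f n"] by simp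
  next
    fix y z assume "y \<in> carrier ?V" "z \<in> carrier ?V" "V.hcomp n y = hcomp (f n) y" "V.hcomp n z =
        hcomp (f n) z"
    then show "V.hcomp n (y \<oplus>\<^bsub>?V\<^esub> z) = hcomp (f n) (y \<oplus>\<^bsub>?V\<^esub> z)" using V.hcomp_add
        by (auto simp: W_def)
  qed
qed

end

section \<open>Modules and rings of fractions\<close>

lemma (in cring) reg_module_module: "module R (reg_module R)"
proof (rule moduleI)
  show "abelian_group (reg_module R)"
  proof (rule abelian_groupI)
    fix x assume "x \<in> carrier (reg_module R)"
    then show "\<exists>y\<in>carrier (reg_module R). y \<oplus>\<^bsub>reg_module R\<^esub> x = \<zero>\<^bsub>reg_module R\<^esub>"
      by (intro bexI[of _ "\<ominus> x"]) (auto simp: reg_module_def l_neg)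
  qed (auto simp: reg_module_def a_ac)
qed (auto simp: reg_module_def is_cring l_distr r_distr m_assoc)

lemma reg_module_simps [simp]:
  "carrier (reg_module R) = carrier R" "smult (reg_module R) = monoid.mult R"
      "ring.add (reg_module R) = ring.add R"
  "ring.zero (reg_module R) = ring.zero R" "monoid.mult (reg_module R) = monoid.mult R"
      "one (reg_module R) = one R"
  by (simp_all add: reg_module_def)

lemma UN_pairs_const:
  assumes "C \<noteq> {}" "D \<noteq> {}" "\<And>m s n t. (m, s) \<in> C \<Longrightarrow> (n, t) \<in> D \<Longrightarrow> f m s n t = Y"
  shows "(\<Union>(m, s)\<in>C. \<Union>(n, t)\<in>D. f m s n t) = Y"
  using assms by (auto split: prod.splits) blast+

text \<open>One interface for all fractions below: \<open>S\<^sub>p\<close>, homogeneous localizations of rings and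
  modules, their Veronese versions, and the localization of \<open>M[X]\<close>. The set \<open>Q\<close> of pairs lets the
  admissible numerators depend on the denominator, as equality of degrees demands.\<close>

locale fraction_system = module R M for R (structure) and M (structure) +
  fixes Q :: "('c \<times> 'a) set" and U :: "'a set"
  assumes U_sub: "U \<subseteq> carrier R" and U_one: "\<one> \<in> U"
    and U_mult: "u \<in> U \<Longrightarrow> v \<in> U \<Longrightarrow> u \<otimes> v \<in> U"
    and Q_sub: "Q \<subseteq> carrier M \<times> U" and Q_zero: "(\<zero>\<^bsub>M\<^esub>, \<one>) \<in> Q"
    and Q_add: "(m, s) \<in> Q \<Longrightarrow> (n, t) \<in> Q \<Longrightarrow> (t \<odot>\<^bsub>M\<^esub> m \<oplus>\<^bsub>M\<^esub> s \<odot>\<^bsub>M\<^esub> n, s \<otimes> t) \<in> Q"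
    and Q_neg: "(m, s) \<in> Q \<Longrightarrow> (\<ominus>\<^bsub>M\<^esub> m, s) \<in> Q"
begin

abbreviation "E \<equiv> frac_rel M Q U"

definition cls :: "'c \<Rightarrow> 'a \<Rightarrow> ('c \<times> 'a) set" where
  "cls m s = E `` {(m, s)}"

abbreviation "F \<equiv> fractions R M Q U"

lemma QD: "(m, s) \<in> Q \<Longrightarrow> m \<in> carrier M" "(m, s) \<in> Q \<Longrightarrow> s \<in> carrier R" "(m, s) \<in> Q \<Longrightarrow> s \<in> U"
  using Q_sub U_sub by auto

lemma UD: "u \<in> U \<Longrightarrow> u \<in> carrier R" using U_sub by auto

lemma smult_lcomm: "a \<in> carrier R \<Longrightarrow> b \<in> carrier R \<Longrightarrow> x \<in> carrier M \<Longrightarrow>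
   a \<odot>\<^bsub>M\<^esub> (b \<odot>\<^bsub>M\<^esub> x) = b \<odot>\<^bsub>M\<^esub> (a \<odot>\<^bsub>M\<^esub> x)"
  by (metis smult_assoc1 R.m_comm)

lemma equiv_E: "equiv Q E"
proof (rule equivI)
  show "E \<subseteq> Q \<times> Q" by (auto simp: frac_rel_def)
  show "refl_on Q E"
    using U_one by (auto simp: frac_rel_def intro!: refl_onI)
  show "sym E" unfolding sym_def frac_rel_def by clarsimp metis
  show "trans E"
  proof (rule transI, clarify)
    fix m s n t k w assume "((m, s), (n, t)) \<in> E" "((n, t), (k, w)) \<in> E"
    then obtain u v where q: "(m, s) \<in> Q" "(n, t) \<in> Q" "(k, w) \<in> Q" and uv: "u \<in> U" "v \<in> U"
      and 1: "u \<odot>\<^bsub>M\<^esub> (t \<odot>\<^bsub>M\<^esub> m) = u \<odot>\<^bsub>M\<^esub> (s \<odot>\<^bsub>M\<^esub> n)" and 2: "v \<odot>\<^bsub>M\<^esub> (w \<odot>\<^bsub>M\<^esub> n) = v \<odot>\<^bsub>M\<^esub> (t \<odot>\<^bsub>M\<^esub> k)"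
      by (auto simp: frac_rel_def)
    note [simp] = QD[OF q(1)] QD[OF q(2)] QD[OF q(3)] uv[THEN UD]
    let ?z = "u \<otimes> v \<otimes> t"
    \<comment> \<open>The middle denominator \<open>t\<close> has to enter the multiplier.\<close>
    have "?z \<odot>\<^bsub>M\<^esub> (w \<odot>\<^bsub>M\<^esub> m) = (v \<otimes> w) \<odot>\<^bsub>M\<^esub> (u \<odot>\<^bsub>M\<^esub> (t \<odot>\<^bsub>M\<^esub> m))"
      by (simp add: smult_assoc1 smult_lcomm)
    also have "\<dots> = (u \<otimes> s) \<odot>\<^bsub>M\<^esub> (v \<odot>\<^bsub>M\<^esub> (w \<odot>\<^bsub>M\<^esub> n))"
      unfolding 1 by (simp add: smult_assoc1 smult_lcomm)
    also have "\<dots> = ?z \<odot>\<^bsub>M\<^esub> (s \<odot>\<^bsub>M\<^esub> k)"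
      unfolding 2 by (simp add: smult_assoc1 smult_lcomm)
    finally show "((m, s), (k, w)) \<in> E" using q uv U_mult by (auto simp: frac_rel_def)
  qed
qed

lemma cls_eq_iff: "(m, s) \<in> Q \<Longrightarrow> (n, t) \<in> Q \<Longrightarrow>
   cls m s = cls n t \<longleftrightarrow> (\<exists>u\<in>U. u \<odot>\<^bsub>M\<^esub> (t \<odot>\<^bsub>M\<^esub> m) = u \<odot>\<^bsub>M\<^esub> (s \<odot>\<^bsub>M\<^esub> n))"
  unfolding cls_def by (subst eq_equiv_class_iff[OF equiv_E]) (auto simp: frac_rel_def)

lemma cls_eqI: "(m, s) \<in> Q \<Longrightarrow> (n, t) \<in> Q \<Longrightarrow> t \<odot>\<^bsub>M\<^esub> m = s \<odot>\<^bsub>M\<^esub> n \<Longrightarrow> cls m s = cls n t"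
  unfolding cls_eq_iff by (rule bexI[OF _ U_one]) simp

lemma cls_zero_iff: "(m, s) \<in> Q \<Longrightarrow> cls m s = cls \<zero>\<^bsub>M\<^esub> \<one> \<longleftrightarrow> (\<exists>u\<in>U. u \<odot>\<^bsub>M\<^esub> m = \<zero>\<^bsub>M\<^esub>)"
  by (subst cls_eq_iff[OF _ Q_zero]) (use QD[of m s] in \<open>auto simp: UD\<close>)

lemma carrier_F: "carrier F = {cls m s | m s. (m, s) \<in> Q}"
  by (auto simp: fractions_def quotient_def cls_def)

lemma F_cases: assumes "C \<in> carrier F" obtains m s where "(m, s) \<in> Q" "C = cls m s"
  using assms by (auto simp: carrier_F)

lemma cls_closed [simp]: "(m, s) \<in> Q \<Longrightarrow> cls m s \<in> carrier F"
  by (auto simp: carrier_F)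

lemma cls_mem: "(m, s) \<in> Q \<Longrightarrow> (m', s') \<in> cls m s \<Longrightarrow>
   (m', s') \<in> Q \<and> (\<exists>u\<in>U. u \<odot>\<^bsub>M\<^esub> (s' \<odot>\<^bsub>M\<^esub> m) = u \<odot>\<^bsub>M\<^esub> (s \<odot>\<^bsub>M\<^esub> m'))"
  by (auto simp: cls_def frac_rel_def)

lemma cls_self: "(m, s) \<in> Q \<Longrightarrow> (m, s) \<in> cls m s"
  using equiv_class_self[OF equiv_E] by (simp add: cls_def)

lemma cls_add:
  assumes q: "(m, s) \<in> Q" "(n, t) \<in> Q"
  shows "cls m s \<oplus>\<^bsub>F\<^esub> cls n t = cls (t \<odot>\<^bsub>M\<^esub> m \<oplus>\<^bsub>M\<^esub> s \<odot>\<^bsub>M\<^esub> n) (s \<otimes> t)"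
proof -
  have "cls m s \<oplus>\<^bsub>F\<^esub> cls n t = (\<Union>(m, s) \<in> cls m s. \<Union>(n, t) \<in>
      cls n t. cls (t \<odot>\<^bsub>M\<^esub> m \<oplus>\<^bsub>M\<^esub> s \<odot>\<^bsub>M\<^esub> n) (s \<otimes> t))"
    by (simp add: fractions_def cls_def)
  also have "\<dots> = cls (t \<odot>\<^bsub>M\<^esub> m \<oplus>\<^bsub>M\<^esub> s \<odot>\<^bsub>M\<^esub> n) (s \<otimes> t)"
  proof (rule UN_pairs_const)
    fix m' s' n' t' assume m': "(m', s') \<in> cls m s" and n': "(n', t') \<in> cls n t"
    obtain u where u: "u \<in> U" "u \<odot>\<^bsub>M\<^esub> (s' \<odot>\<^bsub>M\<^esub> m) = u \<odot>\<^bsub>M\<^esub> (s \<odot>\<^bsub>M\<^esub> m')" and q': "(m', s') \<in> Q"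
      using cls_mem[OF q(1) m'] by auto
    obtain v where v: "v \<in> U" "v \<odot>\<^bsub>M\<^esub> (t' \<odot>\<^bsub>M\<^esub> n) = v \<odot>\<^bsub>M\<^esub> (t \<odot>\<^bsub>M\<^esub> n')" and r': "(n', t') \<in> Q"
      using cls_mem[OF q(2) n'] by auto
    note [simp] = QD[OF q(1)] QD[OF q(2)] QD[OF q'] QD[OF r'] UD[OF u(1)] UD[OF v(1)]
    have "(u \<otimes> v) \<odot>\<^bsub>M\<^esub> ((s \<otimes> t) \<odot>\<^bsub>M\<^esub> (t' \<odot>\<^bsub>M\<^esub> m' \<oplus>\<^bsub>M\<^esub> s' \<odot>\<^bsub>M\<^esub> n'))
      = (v \<otimes> t \<otimes> t') \<odot>\<^bsub>M\<^esub> (u \<odot>\<^bsub>M\<^esub> (s \<odot>\<^bsub>M\<^esub> m')) \<oplus>\<^bsub>M\<^esub> (u \<otimes> s \<otimes> s') \<odot>\<^bsub>M\<^esub> (v \<odot>\<^bsub>M\<^esub> (t \<odot>\<^bsub>M\<^esub> n'))"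
      by (simp add: smult_r_distr smult_assoc1 smult_lcomm)
    also have "\<dots> = (v \<otimes> t \<otimes> t') \<odot>\<^bsub>M\<^esub> (u \<odot>\<^bsub>M\<^esub> (s' \<odot>\<^bsub>M\<^esub> m)) \<oplus>\<^bsub>M\<^esub> (u \<otimes> s \<otimes> s') \<odot>\<^bsub>M\<^esub> (v \<odot>\<^bsub>M\<^esub> (t' \<odot>\<^bsub>M\<^esub>
        n))"
      by (simp only: u(2) v(2))
    also have "\<dots> = (u \<otimes> v) \<odot>\<^bsub>M\<^esub> ((s' \<otimes> t') \<odot>\<^bsub>M\<^esub> (t \<odot>\<^bsub>M\<^esub> m \<oplus>\<^bsub>M\<^esub> s \<odot>\<^bsub>M\<^esub> n))"
      by (simp add: smult_r_distr smult_assoc1 smult_lcomm)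
    finally show "cls (t' \<odot>\<^bsub>M\<^esub> m' \<oplus>\<^bsub>M\<^esub> s' \<odot>\<^bsub>M\<^esub> n') (s' \<otimes> t') = cls (t \<odot>\<^bsub>M\<^esub> m \<oplus>\<^bsub>M\<^esub> s \<odot>\<^bsub>M\<^esub> n) (s \<otimes> t)"
      using q q' r' u v U_mult by (subst cls_eq_iff) (auto intro: Q_add intro!: bexI[of _ "u \<otimes> v"])
  qed (use cls_self q in auto)
  finally show ?thesis .
qed

lemma F_zero: "\<zero>\<^bsub>F\<^esub> = cls \<zero>\<^bsub>M\<^esub> \<one>"
  by (simp add: fractions_def cls_def)

lemma F_abelian_group: "abelian_group F"
proof (rule abelian_groupI)
  show "\<zero>\<^bsub>F\<^esub> \<in> carrier F" using Q_zero by (auto simp: F_zero)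
next
  fix x y assume "x \<in> carrier F" "y \<in> carrier F"
  then obtain m s n t where q: "(m, s) \<in> Q" "x = cls m s" "(n, t) \<in> Q" "y = cls n t"
      by (metis F_cases)
  then show "x \<oplus>\<^bsub>F\<^esub> y \<in> carrier F" by (simp add: cls_add Q_add)
  show "x \<oplus>\<^bsub>F\<^esub> y = y \<oplus>\<^bsub>F\<^esub> x"
    using q QD[OF q(1)] QD[OF q(3)] by (simp add: cls_add R.m_comm[of t s] M.a_comm[of "t \<odot>\<^bsub>M\<^esub> m"])
next
  fix x y z assume "x \<in> carrier F" "y \<in> carrier F" "z \<in> carrier F"
  then obtain m s n t k w where q: "(m, s) \<in> Q" "x = cls m s" "(n, t) \<in> Q" "y = cls n t" "(k, w) \<in>
      Q" "z = cls k w"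
    by (metis F_cases)
  note [simp] = QD[OF q(1)] QD[OF q(3)] QD[OF q(5)]
  have "w \<odot>\<^bsub>M\<^esub> (t \<odot>\<^bsub>M\<^esub> m \<oplus>\<^bsub>M\<^esub> s \<odot>\<^bsub>M\<^esub> n) \<oplus>\<^bsub>M\<^esub> (s \<otimes> t) \<odot>\<^bsub>M\<^esub> k =
    (t \<otimes> w) \<odot>\<^bsub>M\<^esub> m \<oplus>\<^bsub>M\<^esub> s \<odot>\<^bsub>M\<^esub> (w \<odot>\<^bsub>M\<^esub> n \<oplus>\<^bsub>M\<^esub> t \<odot>\<^bsub>M\<^esub> k)"
    by (simp add: smult_r_distr smult_assoc1 smult_lcomm[of w] M.a_assoc)
  then show "x \<oplus>\<^bsub>F\<^esub> y \<oplus>\<^bsub>F\<^esub> z = x \<oplus>\<^bsub>F\<^esub> (y \<oplus>\<^bsub>F\<^esub> z)"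
    using q by (simp add: cls_add Q_add R.m_assoc)
next
  fix x assume "x \<in> carrier F"
  then obtain m s where q: "(m, s) \<in> Q" "x = cls m s" by (metis F_cases)
  then show "\<zero>\<^bsub>F\<^esub> \<oplus>\<^bsub>F\<^esub> x = x"
    using QD[OF q(1)] by (simp add: F_zero cls_add Q_zero)
  have "cls (\<ominus>\<^bsub>M\<^esub> m) s \<oplus>\<^bsub>F\<^esub> x = cls (s \<odot>\<^bsub>M\<^esub> \<ominus>\<^bsub>M\<^esub> m \<oplus>\<^bsub>M\<^esub> s \<odot>\<^bsub>M\<^esub> m) (s \<otimes> s)"
    using q Q_neg by (simp add: cls_add)
  also have "\<dots> = \<zero>\<^bsub>F\<^esub>"
    using q Q_neg[OF q(1)] Q_add[OF Q_neg[OF q(1)] q(1)] Q_zero QD[OF q(1)] U_one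
    unfolding F_zero by (intro cls_eqI) (auto simp: smult_r_minus M.l_neg)
  finally show "\<exists>y\<in>carrier F. y \<oplus>\<^bsub>F\<^esub> x = \<zero>\<^bsub>F\<^esub>" using q Q_neg cls_closed by blast
qed

end

lemma natural_map_cls:
  assumes "fraction_system R M Q U" "fraction_system R M Q1 U1" "Q1 \<subseteq> Q" "U1 \<subseteq> U" "(m, s) \<in> Q1"
  shows "natural_map (frac_rel M Q U) (fraction_system.cls M Q1 U1 m s) =
      fraction_system.cls M Q U m s"
proof -
  interpret A: fraction_system R M Q U by fact
  interpret B: fraction_system R M Q1 U1 by fact
  have sub: "B.E \<subseteq> A.E" using assms by (auto simp: frac_rel_def)
  have eqv: "sym A.E" "trans A.E" using A.equiv_E by (auto simp: equiv_def)
  have "B.E `` {(m, s)} \<subseteq> A.E `` {(m, s)}" using sub by auto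
  then have "A.E `` (B.E `` {(m, s)}) \<subseteq> A.E `` {(m, s)}" using transD[OF eqv(2)] by fast
  moreover have "(m, s) \<in> B.E `` {(m, s)}" using B.cls_self[OF assms(5)] by (simp add: B.cls_def)
  ultimately show ?thesis unfolding natural_map_def A.cls_def B.cls_def by blast
qed

lemma smult_cls:
  assumes A: "fraction_system R (reg_module R) QA U" and F: "fraction_system R M Q U"
    and cl: "\<And>b s n t. (b, s) \<in> QA \<Longrightarrow> (n, t) \<in> Q \<Longrightarrow> (b \<odot>\<^bsub>M\<^esub> n, s \<otimes>\<^bsub>R\<^esub> t) \<in> Q"
    and q: "(b, s) \<in> QA" "(n, t) \<in> Q"
  shows "fraction_system.cls (reg_module R) QA U b s \<odot>\<^bsub>fractions R M Q U\<^esub> fraction_system.cls M Q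
      U n t
     = fraction_system.cls M Q U (b \<odot>\<^bsub>M\<^esub> n) (s \<otimes>\<^bsub>R\<^esub> t)"
proof -
  interpret A: fraction_system R "reg_module R" QA U by (rule A)
  interpret F: fraction_system R M Q U by (rule F)
  have "A.cls b s \<odot>\<^bsub>F.F\<^esub> F.cls n t = (\<Union>(b, s) \<in> A.cls b s. \<Union>(n, t) \<in>
      F.cls n t. F.cls (b \<odot>\<^bsub>M\<^esub> n) (s \<otimes>\<^bsub>R\<^esub> t))"
    by (simp add: fractions_def F.cls_def)
  also have "\<dots> = F.cls (b \<odot>\<^bsub>M\<^esub> n) (s \<otimes>\<^bsub>R\<^esub> t)"
  proof (rule UN_pairs_const)
    fix b' s' n' t' assume m': "(b', s') \<in> A.cls b s" and n': "(n', t') \<in> F.cls n t"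
    obtain u where u: "u \<in> U" "u \<otimes>\<^bsub>R\<^esub> (s' \<otimes>\<^bsub>R\<^esub> b) = u \<otimes>\<^bsub>R\<^esub> (s \<otimes>\<^bsub>R\<^esub> b')" and q': "(b', s') \<in> QA"
      using A.cls_mem[OF q(1) m'] by auto
    obtain v where v: "v \<in> U" "v \<odot>\<^bsub>M\<^esub> (t' \<odot>\<^bsub>M\<^esub> n) = v \<odot>\<^bsub>M\<^esub> (t \<odot>\<^bsub>M\<^esub> n')" and r': "(n', t') \<in> Q"
      using F.cls_mem[OF q(2) n'] by auto
    note [simp] = A.QD[OF q(1), simplified] F.QD[OF q(2)] A.QD[OF q',
        simplified] F.QD[OF r'] F.UD[OF u(1)] F.UD[OF v(1)]
    have "(u \<otimes>\<^bsub>R\<^esub> v) \<odot>\<^bsub>M\<^esub> ((s \<otimes>\<^bsub>R\<^esub> t) \<odot>\<^bsub>M\<^esub> (b' \<odot>\<^bsub>M\<^esub> n')) =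
        (u \<otimes>\<^bsub>R\<^esub> (s \<otimes>\<^bsub>R\<^esub> b')) \<odot>\<^bsub>M\<^esub> (v \<odot>\<^bsub>M\<^esub> (t \<odot>\<^bsub>M\<^esub> n'))"
      by (simp add: F.smult_assoc1 F.smult_lcomm)
    also have "\<dots> = (u \<otimes>\<^bsub>R\<^esub> (s' \<otimes>\<^bsub>R\<^esub> b)) \<odot>\<^bsub>M\<^esub> (v \<odot>\<^bsub>M\<^esub> (t' \<odot>\<^bsub>M\<^esub> n))"
      by (simp only: u(2) v(2))
    also have "\<dots> = (u \<otimes>\<^bsub>R\<^esub> v) \<odot>\<^bsub>M\<^esub> ((s' \<otimes>\<^bsub>R\<^esub> t') \<odot>\<^bsub>M\<^esub> (b \<odot>\<^bsub>M\<^esub> n))"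
      by (simp add: F.smult_assoc1 F.smult_lcomm)
    finally have e: "(u \<otimes>\<^bsub>R\<^esub> v) \<odot>\<^bsub>M\<^esub> ((s \<otimes>\<^bsub>R\<^esub> t) \<odot>\<^bsub>M\<^esub> (b' \<odot>\<^bsub>M\<^esub> n')) =
        (u \<otimes>\<^bsub>R\<^esub> v) \<odot>\<^bsub>M\<^esub> ((s' \<otimes>\<^bsub>R\<^esub> t') \<odot>\<^bsub>M\<^esub> (b \<odot>\<^bsub>M\<^esub> n))" .
    show "F.cls (b' \<odot>\<^bsub>M\<^esub> n') (s' \<otimes>\<^bsub>R\<^esub> t') = F.cls (b \<odot>\<^bsub>M\<^esub> n) (s \<otimes>\<^bsub>R\<^esub> t)"
      unfolding F.cls_eq_iff[OF cl[OF q' r'] cl[OF q]] using e F.U_mult[OF u(1) v(1)] by blast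
  qed (use A.cls_self[OF q(1)] F.cls_self[OF q(2)] in auto)
  finally show ?thesis .
qed

locale fraction_ring = fraction_system R "reg_module R" Q U for R (structure) and Q U +
  assumes Q_mult: "(m, s) \<in> Q \<Longrightarrow> (n, t) \<in> Q \<Longrightarrow> (m \<otimes> n, s \<otimes> t) \<in> Q"
    and Q_one: "(\<one>, \<one>) \<in> Q"
begin

lemma cls_mult:
  assumes q: "(m, s) \<in> Q" "(n, t) \<in> Q"
  shows "cls m s \<otimes>\<^bsub>F\<^esub> cls n t = cls (m \<otimes> n) (s \<otimes> t)"
proof -
  have "cls m s \<otimes>\<^bsub>F\<^esub> cls n t = cls m s \<odot>\<^bsub>F\<^esub> cls n t" by (simp add: fractions_def)
  also have "\<dots> = cls (m \<odot>\<^bsub>reg_module R\<^esub> n) (s \<otimes> t)"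
    using Q_mult by (intro smult_cls fraction_system_axioms q) simp
  finally show ?thesis by simp
qed

lemma F_one: "\<one>\<^bsub>F\<^esub> = cls \<one> \<one>"
  by (simp add: fractions_def cls_def)

lemma F_cring: "cring F"
proof (rule cringI)
  show "abelian_group F" by (rule F_abelian_group)
  show "comm_monoid F"
  proof (rule comm_monoidI)
    show "\<one>\<^bsub>F\<^esub> \<in> carrier F" using Q_one by (simp add: F_one)
  next
    fix x y assume "x \<in> carrier F" "y \<in> carrier F"
    then obtain m s n t where q: "(m, s) \<in> Q" "x = cls m s" "(n, t) \<in> Q" "y = cls n t"
        by (metis F_cases)
    then show "x \<otimes>\<^bsub>F\<^esub> y \<in> carrier F" by (simp add: cls_mult Q_mult)
    show "x \<otimes>\<^bsub>F\<^esub> y = y \<otimes>\<^bsub>F\<^esub> x"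
      using q QD[OF q(1)] QD[OF q(3)] by (simp add: cls_mult R.m_comm)
  next
    fix x y z assume "x \<in> carrier F" "y \<in> carrier F" "z \<in> carrier F"
    then obtain m s n t k w where q: "(m, s) \<in> Q" "x = cls m s" "(n, t) \<in> Q" "y = cls n t" "(k,
        w) \<in> Q" "z = cls k w"
      by (metis F_cases)
    then show "x \<otimes>\<^bsub>F\<^esub> y \<otimes>\<^bsub>F\<^esub> z = x \<otimes>\<^bsub>F\<^esub> (y \<otimes>\<^bsub>F\<^esub> z)"
      using QD[OF q(1)] QD[OF q(3)] QD[OF q(5)] by (simp add: cls_mult Q_mult R.m_assoc)
  next
    fix x assume "x \<in> carrier F"
    then obtain m s where q: "(m, s) \<in> Q" "x = cls m s" by (metis F_cases)
    then show "\<one>\<^bsub>F\<^esub> \<otimes>\<^bsub>F\<^esub> x = x"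
      using QD[OF q(1)] by (simp add: F_one cls_mult Q_one)
  qed
next
  fix x y z assume "x \<in> carrier F" "y \<in> carrier F" "z \<in> carrier F"
  then obtain m s n t k w where q: "(m, s) \<in> Q" "x = cls m s" "(n, t) \<in> Q" "y = cls n t" "(k, w) \<in>
      Q" "z = cls k w"
    by (metis F_cases)
  note [simp] = QD[OF q(1), simplified] QD[OF q(3), simplified] QD[OF q(5), simplified]
  note a = Q_add[simplified] cls_add[simplified]
  have "cls ((t \<otimes> m \<oplus> s \<otimes> n) \<otimes> k) (s \<otimes> t \<otimes> w) = cls (t \<otimes> w \<otimes> (m \<otimes> k) \<oplus> s \<otimes> w \<otimes> (n \<otimes> k)) (s \<otimes> w \<otimes>
      (t \<otimes> w))"
  proof (rule cls_eqI)
    show "((t \<otimes> m \<oplus> s \<otimes> n) \<otimes> k, s \<otimes> t \<otimes> w) \<in> Q" using q a Q_mult by simp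
    show "(t \<otimes> w \<otimes> (m \<otimes> k) \<oplus> s \<otimes> w \<otimes> (n \<otimes> k), s \<otimes> w \<otimes> (t \<otimes> w)) \<in> Q" using q a Q_mult by simp
    show "(s \<otimes> w \<otimes> (t \<otimes> w)) \<odot>\<^bsub>reg_module R\<^esub> ((t \<otimes> m \<oplus> s \<otimes> n) \<otimes> k) =
      (s \<otimes> t \<otimes> w) \<odot>\<^bsub>reg_module R\<^esub> (t \<otimes> w \<otimes> (m \<otimes> k) \<oplus> s \<otimes> w \<otimes> (n \<otimes> k))"
      by (simp add: R.l_distr R.r_distr R.m_ac)
  qed
  then show "(x \<oplus>\<^bsub>F\<^esub> y) \<otimes>\<^bsub>F\<^esub> z = x \<otimes>\<^bsub>F\<^esub> z \<oplus>\<^bsub>F\<^esub> y \<otimes>\<^bsub>F\<^esub> z"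
    using q by (simp add: a cls_mult Q_mult)
qed

end

lemma natural_map_ring_hom:
  assumes "fraction_ring R Q U" "fraction_ring R Q1 U1" "Q1 \<subseteq> Q" "U1 \<subseteq> U"
  shows "ring_hom_cring (fractions R (reg_module R) Q1 U1) (fractions R (reg_module R) Q U)
    (natural_map (frac_rel (reg_module R) Q U))"
proof -
  interpret A: fraction_ring R Q U by fact
  interpret B: fraction_ring R Q1 U1 by fact
  note n = natural_map_cls[OF A.fraction_system_axioms B.fraction_system_axioms assms(3,4)]
  have s: "(m, s) \<in> Q1 \<Longrightarrow> (m, s) \<in> Q" for m s using assms(3) by auto
  show ?thesis
  proof (intro ring_hom_cring.intro ring_hom_cring_axioms.intro A.F_cring B.F_cring ring_hom_memI)
    fix x y assume "x \<in> carrier B.F" "y \<in> carrier B.F"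
    then obtain m s n t where q: "(m, s) \<in> Q1" "x = B.cls m s" "(n, t) \<in> Q1" "y = B.cls n t"
        by (metis B.F_cases)
    then show "natural_map A.E x \<in> carrier A.F" using s by (simp add: n)
    show "natural_map A.E (x \<otimes>\<^bsub>B.F\<^esub> y) = natural_map A.E x \<otimes>\<^bsub>A.F\<^esub> natural_map A.E y"
      using q s by (simp add: n B.cls_mult A.cls_mult B.Q_mult)
    show "natural_map A.E (x \<oplus>\<^bsub>B.F\<^esub> y) = natural_map A.E x \<oplus>\<^bsub>A.F\<^esub> natural_map A.E y"
      using q s by (simp add: n B.cls_add[simplified] A.cls_add[simplified] B.Q_add[simplified])
  next
    show "natural_map A.E \<one>\<^bsub>B.F\<^esub> = \<one>\<^bsub>A.F\<^esub>" using B.Q_one by (simp add: A.F_one B.F_one n)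
  qed
qed

text \<open>The pieces \<open>GG n\<close> and \<open>HH n\<close> are arbitrary compatible families of additive subgroups. They
  will be the pieces of \<open>S\<close> and \<open>M\<close> themselves, and also their pieces in the degrees of a Veronese
  transform, still inside \<open>S\<close> and \<open>M\<close> and with the same prime \<open>p\<close>.\<close>

lemma hom_fraction_system:
  fixes R (structure) and M (structure)
  assumes M: "module R M" and p: "primeideal p R"
    and GG: "\<And>n y. n \<in> Nvec r \<Longrightarrow> y \<in> GG n \<Longrightarrow> y \<in> carrier R" "\<one> \<in> GG deg_zero"
      "\<And>n m y z. n \<in> Nvec r \<Longrightarrow> m \<in> Nvec r \<Longrightarrow> y \<in> GG n \<Longrightarrow> z \<in> GG m \<Longrightarrow> y \<otimes> z \<in> GG (deg_add n m)"
    and HH: "\<And>n. n \<in> Nvec r \<Longrightarrow> additive_subgroup (HH n) M"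
      "\<And>n m y z. n \<in> Nvec r \<Longrightarrow> m \<in> Nvec r \<Longrightarrow> y \<in> GG n \<Longrightarrow> z \<in> HH m \<Longrightarrow> y \<odot>\<^bsub>M\<^esub> z \<in> HH (deg_add n m)"
  shows "fraction_system R M (hom_pairs (Nvec r) GG HH p) (hom_denoms (Nvec r) GG p)"
proof -
  interpret M: module R M by (rule M)
  interpret p: primeideal p R by (rule p)
  have one: "\<one> \<notin> p" using p.I_notcarr p.one_imp_carrier by auto
  have mult: "y \<otimes> z \<notin> p" if "y \<in> carrier R" "z \<in> carrier R" "y \<notin> p" "z \<notin> p" for y z
      using p.I_prime that by blast
  have HHc: "z \<in> carrier M" if "n \<in> Nvec r" "z \<in> HH n" for n z
      using additive_subgroup.a_Hcarr[OF HH(1)[OF that(1)] that(2)] .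
  note HHa = additive_subgroup.a_closed[OF HH(1)]
  note HHz = additive_subgroup.zero_closed[OF HH(1)]
  note HHn = additive_subgroup.a_inv_closed[OF HH(1)]
  have QI: "(m, s) \<in> hom_pairs (Nvec r) GG HH p" if "n \<in> Nvec r" "m \<in> HH n" "s \<in> GG n" "s \<notin> p"
      for n m s
    using that unfolding hom_pairs_def by blast
  have QE: "\<exists>n. n \<in> Nvec r \<and> m \<in> HH n \<and> s \<in> GG n \<and> s \<notin> p" if "(m, s) \<in> hom_pairs (Nvec r) GG HH p"
      for m s
    using that unfolding hom_pairs_def by blast
  show ?thesis
  proof (intro fraction_system.intro M fraction_system_axioms.intro)
    show "hom_denoms (Nvec r) GG p \<subseteq> carrier R" unfolding hom_denoms_def using GG(1) by blast
    show "\<one> \<in> hom_denoms (Nvec r) GG p" unfolding hom_denoms_def using one GG(2) Nvec_zero by blast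
    show "hom_pairs (Nvec r) GG HH p \<subseteq> carrier M \<times> hom_denoms (Nvec r) GG p"
      unfolding hom_pairs_def hom_denoms_def using HHc by blast
    show "(\<zero>\<^bsub>M\<^esub>, \<one>) \<in> hom_pairs (Nvec r) GG HH p"
        by (rule QI[OF Nvec_zero HHz[OF Nvec_zero] GG(2) one])
  next
    fix u v assume "u \<in> hom_denoms (Nvec r) GG p" "v \<in> hom_denoms (Nvec r) GG p"
    then obtain n m where h: "n \<in> Nvec r" "u \<in> GG n" "u \<notin> p" "m \<in> Nvec r" "v \<in> GG m" "v \<notin> p"
      unfolding hom_denoms_def by blast
    show "u \<otimes> v \<in> hom_denoms (Nvec r) GG p"
      unfolding hom_denoms_def using GG(3)[OF h(1,4,2,5)] mult[OF GG(1)[OF h(1,2)] GG(1)[OF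
          h(4,5)] h(3,6)] Nvec_add[OF h(1,4)] by blast
  next
    fix m s n t assume "(m, s) \<in> hom_pairs (Nvec r) GG HH p" "(n, t) \<in> hom_pairs (Nvec r) GG HH p"
    then obtain d e where h: "d \<in> Nvec r" "m \<in> HH d" "s \<in> GG d" "s \<notin> p" "e \<in> Nvec r" "n \<in> HH e"
        "t \<in> GG e" "t \<notin> p"
      using QE by metis
    have "deg_add e d = deg_add d e" by (simp add: add.commute)
    then have "t \<odot>\<^bsub>M\<^esub> m \<in> HH (deg_add d e)" using HH(2)[OF h(5,1,7,2)] by simp
    then show "(t \<odot>\<^bsub>M\<^esub> m \<oplus>\<^bsub>M\<^esub> s \<odot>\<^bsub>M\<^esub> n, s \<otimes> t) \<in> hom_pairs (Nvec r) GG HH p"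
      by (intro QI[OF Nvec_add[OF h(1,5)]] HHa[OF Nvec_add[OF h(1,5)]] HH(2)[OF h(1,5,3,6)]
          GG(3)[OF h(1,5,3,7)]
         mult[OF GG(1)[OF h(1,3)] GG(1)[OF h(5,7)] h(4,8)])
  next
    fix m s assume "(m, s) \<in> hom_pairs (Nvec r) GG HH p"
    then obtain d where h: "d \<in> Nvec r" "m \<in> HH d" "s \<in> GG d" "s \<notin> p" using QE by blast
    show "(\<ominus>\<^bsub>M\<^esub> m, s) \<in> hom_pairs (Nvec r) GG HH p"
      using QI[OF h(1) HHn[OF h(1,2)] h(3,4)] by (simp add: a_inv_def)
  qed
qed

lemma hom_fraction_ring:
  fixes R (structure)
  assumes R: "cring R" and p: "primeideal p R"
    and GG: "\<And>n. n \<in> Nvec r \<Longrightarrow> additive_subgroup (GG n) R" "\<one> \<in> GG deg_zero"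
      "\<And>n m y z. n \<in> Nvec r \<Longrightarrow> m \<in> Nvec r \<Longrightarrow> y \<in> GG n \<Longrightarrow> z \<in> GG m \<Longrightarrow> y \<otimes> z \<in> GG (deg_add n m)"
  shows "fraction_ring R (hom_pairs (Nvec r) GG GG p) (hom_denoms (Nvec r) GG p)"
proof -
  interpret R: cring R by (rule R)
  interpret p: primeideal p R by (rule p)
  have one: "\<one> \<notin> p" using p.I_notcarr p.one_imp_carrier by auto
  have GGc: "z \<in> carrier R" if "n \<in> Nvec r" "z \<in> GG n" for n z
      using additive_subgroup.a_Hcarr[OF GG(1)[OF that(1)] that(2)] .
  have "additive_subgroup (GG n) (reg_module R)" if "n \<in> Nvec r" for n
    using GG(1)[OF that] by (simp add: additive_subgroup_def subgroup_def m_inv_def)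
  then have "fraction_system R (reg_module R) (hom_pairs (Nvec r) GG GG p) (hom_denoms (Nvec r) GG
      p)"
    using GGc GG(2,3) by (intro hom_fraction_system R.reg_module_module p) simp_all
  moreover have "(m \<otimes> n, s \<otimes> t) \<in> hom_pairs (Nvec r) GG GG p"
    if q: "(m, s) \<in> hom_pairs (Nvec r) GG GG p" "(n, t) \<in> hom_pairs (Nvec r) GG GG p" for m s n t
  proof -
    obtain d e where h: "d \<in> Nvec r" "m \<in> GG d" "s \<in> GG d" "s \<notin> p" "e \<in> Nvec r" "n \<in> GG e" "t \<in>
        GG e" "t \<notin> p"
      using q unfolding hom_pairs_def by blast
    have "s \<otimes> t \<notin> p" using p.I_prime[OF GGc[OF h(1,3)] GGc[OF h(5,7)]] h(4,8) by blast
    then show ?thesis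
      unfolding hom_pairs_def using Nvec_add[OF h(1,5)] GG(3)[OF h(1,5,2,6)] GG(3)[OF h(1,5,3,7)]
          by blast
  qed
  moreover have "(\<one>, \<one>) \<in> hom_pairs (Nvec r) GG GG p"
    unfolding hom_pairs_def using GG(2) one Nvec_zero by blast
  ultimately show ?thesis by (intro fraction_ring.intro fraction_ring_axioms.intro) blast+
qed

section \<open>Tensor products\<close>

locale two_modules = N: module R N + M: module R M
  for R (structure) and N :: "('a, 'n, 'k) module_scheme" and M :: "('a, 'm, 'l) module_scheme"
begin

abbreviation "FG \<equiv> free_Abelian_group (carrier N \<times> carrier M)"
abbreviation "K \<equiv> tensor_rel_group R N M"
abbreviation "TP \<equiv> tensor R N M"

definition tens :: "'n \<Rightarrow> 'm \<Rightarrow> ('n \<times> 'm \<Rightarrow>\<^sub>0 int) set" where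
  "tens y x = K #>\<^bsub>FG\<^esub> frag_of (y, x)"

lemma FG_diff: "a \<in> carrier FG \<Longrightarrow> b \<in> carrier FG \<Longrightarrow> a - b \<in> carrier FG"
  unfolding carrier_free_Abelian_group_iff by (rule order_trans[OF keys_diff]) simp

lemma FG_add: "a \<in> carrier FG \<Longrightarrow> b \<in> carrier FG \<Longrightarrow> a + b \<in> carrier FG"
  unfolding carrier_free_Abelian_group_iff by (rule order_trans[OF keys_add]) simp

lemma rels_sub: "tensor_rels R N M \<subseteq> carrier FG"
proof -
  have "c \<in> carrier FG" if "c \<in> tensor_rels R N M" for c
    using that unfolding tensor_rels_def Un_iff mem_Collect_eq
    by (elim disjE exE conjE) (simp_all only:, (intro FG_diff FG_add,
        (simp only: frag_of_in_free_Abelian_group, simp)+)+)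
  then show ?thesis by auto
qed

lemma K_subgroup: "subgroup K FG"
  unfolding tensor_rel_group_def by (intro group.generate_is_subgroup rels_sub
      group_free_Abelian_group)

sublocale FG: comm_group FG
  by (rule abelian_free_Abelian_group)

lemma K_normal: "K \<lhd> FG"
  using K_subgroup by (simp add: FG.normal_iff_subgroup)

sublocale KN: normal K FG
  by (rule K_normal)

sublocale TP: comm_group TP
  unfolding tensor_def by (rule FG.abelian_FactGroup[OF K_subgroup])

lemma coset_eqI:
  assumes "a \<in> carrier FG" "b \<in> carrier FG" "a - b \<in> K"
  shows "K #>\<^bsub>FG\<^esub> a = K #>\<^bsub>FG\<^esub> b"
proof -
  have "a \<in> K #>\<^bsub>FG\<^esub> b" unfolding r_coset_def using assms(3)
    by (auto intro!: bexI[of _ "a - b"])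
  then show ?thesis using FG.repr_independence[OF _ assms(2) K_subgroup] by simp
qed

lemma coset_closed: "a \<in> carrier FG \<Longrightarrow> K #>\<^bsub>FG\<^esub> a \<in> carrier TP"
  unfolding tensor_def FactGroup_def RCOSETS_def by auto

lemma coset_mult: "a \<in> carrier FG \<Longrightarrow> b \<in> carrier FG \<Longrightarrow>
   (K #>\<^bsub>FG\<^esub> a) \<otimes>\<^bsub>TP\<^esub> (K #>\<^bsub>FG\<^esub> b) = K #>\<^bsub>FG\<^esub> (a + b)"
  unfolding tensor_def FactGroup_def by (simp add: KN.rcos_sum)

lemma tens_closed [simp]: "y \<in> carrier N \<Longrightarrow> x \<in> carrier M \<Longrightarrow> tens y x \<in> carrier TP"
  unfolding tens_def by (rule coset_closed) simp

lemma rel_in_K: "c \<in> tensor_rels R N M \<Longrightarrow> c \<in> K"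
  unfolding tensor_rel_group_def by (rule generate.incl)

lemma tens_add_left:
  assumes "y \<in> carrier N" "y' \<in> carrier N" "x \<in> carrier M"
  shows "tens (y \<oplus>\<^bsub>N\<^esub> y') x = tens y x \<otimes>\<^bsub>TP\<^esub> tens y' x"
proof -
  have "frag_of (y \<oplus>\<^bsub>N\<^esub> y', x) - (frag_of (y, x) + frag_of (y', x)) \<in> K"
    by (rule rel_in_K) (use assms in \<open>unfold tensor_rels_def, blast\<close>)
  note rel = this
  have fr: "frag_of (y, x) \<in> carrier FG" "frag_of (y', x) \<in> carrier FG" "frag_of (y \<oplus>\<^bsub>N\<^esub> y', x) \<in>
      carrier FG"
    unfolding frag_of_in_free_Abelian_group using assms by auto
  show ?thesis unfolding tens_def coset_mult[OF fr(1,2)]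
    by (rule coset_eqI[OF fr(3) FG_add[OF fr(1,2)] rel])
qed

lemma tens_add_right:
  assumes "y \<in> carrier N" "x' \<in> carrier M" "x \<in> carrier M"
  shows "tens y (x \<oplus>\<^bsub>M\<^esub> x') = tens y x \<otimes>\<^bsub>TP\<^esub> tens y x'"
proof -
  have "frag_of (y, x \<oplus>\<^bsub>M\<^esub> x') - (frag_of (y, x) + frag_of (y, x')) \<in> K"
    by (rule rel_in_K) (use assms in \<open>unfold tensor_rels_def, blast\<close>)
  note rel = this
  have fr: "frag_of (y, x) \<in> carrier FG" "frag_of (y, x') \<in> carrier FG" "frag_of (y, x \<oplus>\<^bsub>M\<^esub> x') \<in>
      carrier FG"
    unfolding frag_of_in_free_Abelian_group using assms by auto
  show ?thesis unfolding tens_def coset_mult[OF fr(1,2)]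
    by (rule coset_eqI[OF fr(3) FG_add[OF fr(1,2)] rel])
qed

lemma tens_balanced:
  assumes "a \<in> carrier R" "y \<in> carrier N" "x \<in> carrier M"
  shows "tens (a \<odot>\<^bsub>N\<^esub> y) x = tens y (a \<odot>\<^bsub>M\<^esub> x)"
proof -
  have "frag_of (a \<odot>\<^bsub>N\<^esub> y, x) - frag_of (y, a \<odot>\<^bsub>M\<^esub> x) \<in> K"
    by (rule rel_in_K) (use assms in \<open>unfold tensor_rels_def, blast\<close>)
  moreover have "frag_of (a \<odot>\<^bsub>N\<^esub> y, x) \<in> carrier FG" "frag_of (y, a \<odot>\<^bsub>M\<^esub> x) \<in> carrier FG"
    unfolding frag_of_in_free_Abelian_group using assms by auto
  ultimately show ?thesis unfolding tens_def by (intro coset_eqI)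
qed

lemma tens_zero_right [simp]: "y \<in> carrier N \<Longrightarrow> tens y \<zero>\<^bsub>M\<^esub> = \<one>\<^bsub>TP\<^esub>"
  using tens_add_right[of y "\<zero>\<^bsub>M\<^esub>" "\<zero>\<^bsub>M\<^esub>"] TP.l_cancel_one[of "tens y \<zero>\<^bsub>M\<^esub>" "tens y \<zero>\<^bsub>M\<^esub>"] by simp

lemma TP_cases:
  assumes "z \<in> carrier TP" obtains c where "c \<in> carrier FG" "z = K #>\<^bsub>FG\<^esub> c"
  using assms unfolding tensor_def FactGroup_def RCOSETS_def by auto

lemma one_eq_K: "\<one>\<^bsub>TP\<^esub> = K #>\<^bsub>FG\<^esub> 0"
proof -
  have "K = K #>\<^bsub>FG\<^esub> \<one>\<^bsub>FG\<^esub>" by (rule FG.coset_mult_one[symmetric]) (rule KN.subset)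
  then show ?thesis unfolding tensor_def by (simp add: FactGroup_def)
qed

lemma tensor_induct:
  assumes z: "z \<in> carrier TP" and one: "P \<one>\<^bsub>TP\<^esub>"
    and t: "\<And>y x. y \<in> carrier N \<Longrightarrow> x \<in> carrier M \<Longrightarrow> P (tens y x)"
    and d: "\<And>a b. a \<in> carrier TP \<Longrightarrow> b \<in> carrier TP \<Longrightarrow> P a \<Longrightarrow> P b \<Longrightarrow> P (a \<otimes>\<^bsub>TP\<^esub> inv\<^bsub>TP\<^esub> b)"
  shows "P z"
proof -
  obtain c where c: "c \<in> carrier FG" "z = K #>\<^bsub>FG\<^esub> c" by (rule TP_cases[OF z])
  have "Poly_Mapping.keys c \<subseteq> carrier N \<times> carrier M" using c by simp
  then have "P (K #>\<^bsub>FG\<^esub> c)"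
  proof (rule free_Abelian_group_induct)
    show "P (K #>\<^bsub>FG\<^esub> 0)" using one one_eq_K by simp
  next
    fix a b
    assume 2: "Poly_Mapping.keys a \<subseteq> carrier N \<times> carrier M"
        "Poly_Mapping.keys b \<subseteq> carrier N \<times> carrier M"
      "P (K #>\<^bsub>FG\<^esub> a)" "P (K #>\<^bsub>FG\<^esub> b)"
    then have ab: "a \<in> carrier FG" "b \<in> carrier FG" by auto
    have "(K #>\<^bsub>FG\<^esub> (a - b)) \<otimes>\<^bsub>TP\<^esub> (K #>\<^bsub>FG\<^esub> b) = K #>\<^bsub>FG\<^esub> a"
      using coset_mult[OF FG_diff[OF ab] ab(2)] by simp
    then have "K #>\<^bsub>FG\<^esub> (a - b) = (K #>\<^bsub>FG\<^esub> a) \<otimes>\<^bsub>TP\<^esub> inv\<^bsub>TP\<^esub> (K #>\<^bsub>FG\<^esub> b)"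
      using coset_closed FG_diff ab by (intro TP.inv_solve_right[THEN iffD2]) (auto simp del:
          carrier_free_Abelian_group_iff)
    then show "P (K #>\<^bsub>FG\<^esub> (a - b))" using 2 d coset_closed[OF ab(1)] coset_closed[OF ab(2)] by simp
  next
    fix p assume "p \<in> carrier N \<times> carrier M"
    then show "P (K #>\<^bsub>FG\<^esub> frag_of p)" using t by (cases p) (auto simp: tens_def)
  qed
  then show ?thesis using c by simp
qed

text \<open>The homomorphism from the free abelian group that extends \<open>\<beta>\<close> kills the defining relations.\<close>

lemma tensor_universal:
  assumes L: "comm_group L"
    and cl: "\<And>y x. y \<in> carrier N \<Longrightarrow> x \<in> carrier M \<Longrightarrow> \<beta> y x \<in> carrier L"
    and add_left: "\<And>y y' x. y \<in> carrier N \<Longrightarrow> y' \<in> carrier N \<Longrightarrow> x \<in> carrier M \<Longrightarrow> \<beta> (y \<oplus>\<^bsub>N\<^esub> y') x =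
        \<beta> y x \<otimes>\<^bsub>L\<^esub> \<beta> y' x"
    and add_right: "\<And>y x x'. y \<in> carrier N \<Longrightarrow> x \<in> carrier M \<Longrightarrow> x' \<in> carrier M \<Longrightarrow> \<beta> y (x \<oplus>\<^bsub>M\<^esub> x') =
        \<beta> y x \<otimes>\<^bsub>L\<^esub> \<beta> y x'"
    and bal: "\<And>a y x. a \<in> carrier R \<Longrightarrow> y \<in> carrier N \<Longrightarrow> x \<in> carrier M \<Longrightarrow> \<beta> (a \<odot>\<^bsub>N\<^esub> y) x =
        \<beta> y (a \<odot>\<^bsub>M\<^esub> x)"
  obtains h where "h \<in> hom TP L" "\<And>y x. y \<in> carrier N \<Longrightarrow> x \<in> carrier M \<Longrightarrow> h (tens y x) = \<beta> y x"
proof -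
  interpret L: comm_group L by fact
  have "(\<lambda>(y, x). \<beta> y x) ` (carrier N \<times> carrier M) \<subseteq> carrier L" using cl by auto
  from L.free_Abelian_group_universal[OF this] obtain h0 where h0: "h0 \<in> hom FG L"
    and h0f: "\<And>p. p \<in> carrier N \<times> carrier M \<Longrightarrow> h0 (frag_of p) = (\<lambda>(y, x). \<beta> y x) p" by blast
  interpret h0: group_hom FG L h0
    using h0 by (simp add: group_hom_def group_hom_axioms_def L.group_axioms)
  have h0_add: "h0 (a + b) = h0 a \<otimes>\<^bsub>L\<^esub> h0 b" if "a \<in> carrier FG" "b \<in> carrier FG" for a b
    using h0.hom_mult[OF that] by simp
  have h0_diff: "h0 (a - b) = \<one>\<^bsub>L\<^esub>" if ab: "a \<in> carrier FG" "b \<in> carrier FG" "h0 a = h0 b" for a b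
  proof -
    have "h0 (a - b) \<otimes>\<^bsub>L\<^esub> h0 b = h0 b" using h0_add[OF FG_diff[OF ab(1,2)] ab(2)] ab by simp
    then show ?thesis using h0.hom_closed[OF ab(2)] h0.hom_closed[OF FG_diff[OF ab(1,2)]]
        L.r_cancel_one by simp
  qed
  have fr: "frag_of (y, x) \<in> carrier FG" "h0 (frag_of (y, x)) = \<beta> y x"
      if "y \<in> carrier N" "x \<in> carrier M" for y x
    using that h0f[of "(y, x)"] by auto
  have "c \<in> kernel FG L h0" if c: "c \<in> tensor_rels R N M" for c
  proof -
    have "h0 c = \<one>\<^bsub>L\<^esub>" using c unfolding tensor_rels_def Un_iff mem_Collect_eq
      by (elim disjE exE conjE; hypsubst)
         (rule h0_diff; (intro fr(1) FG_add; blast)?; simp add: fr h0_add add_left add_right bal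
             del: carrier_free_Abelian_group_iff)+
    then show ?thesis using c rels_sub by (auto simp: kernel_def simp del:
        carrier_free_Abelian_group_iff)
  qed
  then have "K \<subseteq> kernel FG L h0"
    unfolding tensor_rel_group_def by (intro FG.generate_subgroup_incl h0.subgroup_kernel) auto
  then obtain h where "h \<in> hom (FG Mod K) L" "\<And>c. c \<in> carrier FG \<Longrightarrow> h (K #>\<^bsub>FG\<^esub> c) = h0 c"
    using h0.FactGroup_universal_kernel[OF K_normal] by blast
  then show thesis using that[of h] fr by (simp add: tensor_def tens_def del:
      carrier_free_Abelian_group_iff)
qed

end

text \<open>The homomorphism \<open>ext\<close> of free abelian groups induced by \<open>f\<close> maps relations to relations, so
  it descends to cosets and the union in the definition of \<open>tensor_map\<close> is a single coset.\<close>

locale tensor_functor = A: two_modules R N M1 + B: two_modules R N M2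
  for R (structure) and N :: "('a, 'n, 'k) module_scheme" and M1 :: "('a, 'm, 'l) module_scheme"
   and M2 :: "('a, 'm2, 'l2) module_scheme" +
  fixes f assumes f: "f \<in> linear_maps R M1 M2"
begin

lemma f_closed [simp]: "x \<in> carrier M1 \<Longrightarrow> f x \<in> carrier M2"
  using f by (auto simp: linear_maps_def hom_def)

lemma f_add [simp]: "x \<in> carrier M1 \<Longrightarrow> y \<in> carrier M1 \<Longrightarrow> f (x \<oplus>\<^bsub>M1\<^esub> y) = f x \<oplus>\<^bsub>M2\<^esub> f y"
  using f by (auto simp: linear_maps_def hom_def)

lemma f_smult [simp]: "a \<in> carrier R \<Longrightarrow> x \<in> carrier M1 \<Longrightarrow> f (a \<odot>\<^bsub>M1\<^esub> x) = a \<odot>\<^bsub>M2\<^esub> f x"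
  using f by (auto simp: linear_maps_def)

abbreviation "ext \<equiv> frag_extend (\<lambda>(y, x). frag_of (y, f x))"

lemma ext_closed: "c \<in> carrier A.FG \<Longrightarrow> ext c \<in> carrier B.FG"
proof -
  assume "c \<in> carrier A.FG"
  then have "Poly_Mapping.keys c \<subseteq> carrier N \<times> carrier M1" by simp
  then show ?thesis
  proof (rule free_Abelian_group_induct)
    fix x y assume "ext x \<in> carrier B.FG" "ext y \<in> carrier B.FG"
    then show "ext (x - y) \<in> carrier B.FG" unfolding frag_extend_diff by (rule B.FG_diff)
  qed auto
qed

lemma ext_rels:
  assumes "c \<in> tensor_rels R N M1"
  shows "ext c \<in> tensor_rels R N M2"
  using assms unfolding tensor_rels_def Un_iff mem_Collect_eq
proof (elim disjE exE conjE, goal_cases)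
  case (1 y y' x)
  then show ?case by (intro disjI1 exI[of _ y] exI[of _ y'] exI[of _
      "f x"]) (simp_all add: frag_extend_diff frag_extend_add)
next
  case (2 y x x')
  then show ?case by (intro disjI2 disjI1 exI[of _ y] exI[of _ "f x"] exI[of _
      "f x'"]) (simp_all add: frag_extend_diff frag_extend_add)
next
  case (3 a y x)
  then show ?case by (intro disjI2 exI[of _ a] exI[of _ y] exI[of _
      "f x"]) (simp_all add: frag_extend_diff frag_extend_add)
qed

lemma ext_K: assumes "c \<in> A.K" shows "ext c \<in> B.K"
  using assms unfolding tensor_rel_group_def[of R N M1]
proof (induction rule: generate.induct)
  case one
  then show ?case using subgroup.one_closed[OF B.K_subgroup] by simp
next
  case (incl c)
  then have "ext c \<in> tensor_rels R N M2" by (rule ext_rels)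
  then show ?case by (rule B.rel_in_K)
next
  case (inv c)
  then have c: "c \<in> carrier A.FG" and "ext c \<in> tensor_rels R N M2" using A.rels_sub ext_rels
      by blast+
  then have "- ext c \<in> B.K"
    using subgroup.m_inv_closed[OF B.K_subgroup B.rel_in_K, of "ext c"] ext_closed[OF c] by simp
  then show ?case using c by (simp add: frag_extend_minus)
next
  case (eng c d)
  then show ?case using subgroup.m_closed[OF B.K_subgroup] by (simp add: frag_extend_add)
qed

lemma tensor_map_coset:
  assumes c: "c \<in> carrier A.FG"
  shows "tensor_map R N M2 f (A.K #>\<^bsub>A.FG\<^esub> c) = B.K #>\<^bsub>B.FG\<^esub> ext c"
proof -
  have "B.K #>\<^bsub>B.FG\<^esub> ext d = B.K #>\<^bsub>B.FG\<^esub> ext c" if d: "d \<in> A.K #>\<^bsub>A.FG\<^esub> c" for d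
  proof -
    obtain k where k: "k \<in> A.K" "d = k + c" using d by (auto simp: r_coset_def)
    have kc: "k \<in> carrier A.FG" using k A.KN.subset by blast
    have "ext d - ext c = ext k" by (simp add: k frag_extend_add)
    then show ?thesis using k ext_K ext_closed A.FG_add[OF kc c] c
        by (intro B.coset_eqI) (auto simp del: carrier_free_Abelian_group_iff)
  qed
  moreover have "c \<in> A.K #>\<^bsub>A.FG\<^esub> c" using A.FG.rcos_self[OF c A.K_subgroup] .
  ultimately show ?thesis unfolding tensor_map_def by blast
qed

lemma tensor_map_tens [simp]:
  assumes "y \<in> carrier N" "x \<in> carrier M1"
  shows "tensor_map R N M2 f (A.tens y x) = B.tens y (f x)"
  unfolding A.tens_def B.tens_def using tensor_map_coset[of "frag_of (y, x)"] assms by simp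

lemma tensor_map_hom: "tensor_map R N M2 f \<in> hom A.TP B.TP"
proof (rule homI)
  fix x y assume "x \<in> carrier A.TP" "y \<in> carrier A.TP"
  then obtain c d where cd: "c \<in> carrier A.FG" "x = A.K #>\<^bsub>A.FG\<^esub> c" "d \<in> carrier A.FG" "y =
      A.K #>\<^bsub>A.FG\<^esub> d"
    by (metis A.TP_cases)
  show "tensor_map R N M2 f x \<in> carrier B.TP"
    unfolding cd tensor_map_coset[OF cd(1)] by (intro B.coset_closed ext_closed cd)
  show "tensor_map R N M2 f (x \<otimes>\<^bsub>A.TP\<^esub> y) = tensor_map R N M2 f x \<otimes>\<^bsub>B.TP\<^esub> tensor_map R N M2 f y"
    unfolding cd A.coset_mult[OF cd(1,3)] tensor_map_coset[OF cd(1)] tensor_map_coset[OF cd(3)]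
      tensor_map_coset[OF A.FG_add[OF cd(1,3)]] B.coset_mult[OF ext_closed[OF cd(1)] ext_closed[OF
          cd(3)]]
    by (simp add: frag_extend_add)
qed

end

section \<open>The two local rings at a homogeneous prime\<close>

lemma (in cring) max_ideal_eqI:
  assumes I: "ideal I R" and one: "\<one> \<notin> I"
    and unit: "\<And>a. a \<in> carrier R \<Longrightarrow> a \<notin> I \<Longrightarrow> \<exists>b\<in>carrier R. b \<otimes> a = \<one>"
  shows "max_ideal R = I"
proof -
  interpret I: ideal I R by fact
  have sub: "J \<subseteq> I" if J: "ideal J R" and ne: "J \<noteq> carrier R" for J
  proof
    fix a assume a: "a \<in> J"
    show "a \<in> I"
    proof (rule ccontr)
      assume "a \<notin> I"
      then obtain b where "b \<in> carrier R" "b \<otimes> a = \<one>" using unit ideal.Icarr[OF J a] by blast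
      then have "\<one> \<in> J" using ideal.I_l_closed[OF J a, of b] by simp
      then show False using ideal.one_imp_carrier[OF J] ne by simp
    qed
  qed
  have neq: "I \<noteq> carrier R" using one by auto
  have "maximalideal I R"
    using I neq sub by (intro maximalidealI) auto
  moreover have "J = I" if "maximalideal J R" for J
  proof -
    interpret J: maximalideal J R by fact
    have "J \<subseteq> I" using sub J.is_ideal J.I_notcarr by auto
    then show ?thesis using J.I_maximal[OF I] I.a_subset neq by auto
  qed
  ultimately show ?thesis unfolding max_ideal_def by (intro the_equality)
qed

lemma restrict_scalars_simps [simp]:
  "carrier (restrict_scalars f M) = carrier M" "ring.add (restrict_scalars f M) = ring.add M"
  "ring.zero (restrict_scalars f M) = ring.zero M" "smult (restrict_scalars f M) =
      (\<lambda>a. smult M (f a))"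
  by (simp_all add: restrict_scalars_def)

lemma (in ring_hom_cring) restrict_scalars_module: "module R (restrict_scalars h (reg_module S))"
proof (rule moduleI)
  show "abelian_group (restrict_scalars h (reg_module S))"
  proof (rule abelian_groupI)
    fix x assume "x \<in> carrier (restrict_scalars h (reg_module S))"
    then show "\<exists>y\<in>carrier (restrict_scalars h (reg_module S)).
       y \<oplus>\<^bsub>restrict_scalars h (reg_module S)\<^esub> x = \<zero>\<^bsub>restrict_scalars h (reg_module S)\<^esub>"
      by (intro bexI[of _ "\<ominus>\<^bsub>S\<^esub> x"]) (auto simp: S.l_neg)
  qed (auto simp: S.a_ac)
qed (auto simp: R.is_cring S.l_distr S.r_distr S.m_assoc)

text \<open>The elements \<open>x d\<close> are the monomials in elements outside \<open>p\<close> whose degrees are the unit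
  vectors. Dividing a homogeneous element by the one of its degree gives a fraction of degree
  zero. In this locale \<open>A.F\<close> is the homogeneous localization at \<open>p\<close>, \<open>B.F\<close> is the localization at
  \<open>p\<close>, and \<open>\<iota>\<close> is the natural map between them.\<close>

locale graded_point = multigraded_ring S r G for S (structure) and r G +
  fixes p :: "'a set" and x :: "mdeg \<Rightarrow> 'a"
  assumes p_prime: "primeideal p S"
    and p_homog: "y \<in> p \<Longrightarrow> hcomp d y \<in> p"
    and x_G: "d \<in> Nvec r \<Longrightarrow> x d \<in> G d"
    and x_notin: "d \<in> Nvec r \<Longrightarrow> x d \<notin> p"
    and x_zero: "x deg_zero = \<one>"
    and x_add: "d \<in> Nvec r \<Longrightarrow> e \<in> Nvec r \<Longrightarrow> x (deg_add d e) = x d \<otimes> x e"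
begin

sublocale p: primeideal p S by (rule p_prime)

lemma one_notin_p: "\<one> \<notin> p"
  using p.I_notcarr p.one_imp_carrier by auto

lemma mult_notin_p: "a \<in> carrier S \<Longrightarrow> b \<in> carrier S \<Longrightarrow> a \<notin> p \<Longrightarrow> b \<notin> p \<Longrightarrow> a \<otimes> b \<notin> p"
  using p.I_prime by blast

abbreviation "QA \<equiv> hom_pairs (Nvec r) G G p"
abbreviation "UA \<equiv> hom_denoms (Nvec r) G p"
abbreviation "QB \<equiv> carrier S \<times> (carrier S - p)"
abbreviation "UB \<equiv> carrier S - p"

lemma QA_I: "d \<in> Nvec r \<Longrightarrow> m \<in> G d \<Longrightarrow> s \<in> G d \<Longrightarrow> s \<notin> p \<Longrightarrow> (m, s) \<in> QA"
  by (auto simp: hom_pairs_def)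

lemma QA_E: assumes "(m, s) \<in> QA"
  obtains d where "d \<in> Nvec r" "m \<in> G d" "s \<in> G d" "s \<notin> p" "m \<in> carrier S" "s \<in> carrier S"
proof -
  from assms obtain d where "d \<in> Nvec r" "m \<in> G d" "s \<in> G d" "s \<notin> p" by (auto simp: hom_pairs_def)
  then show thesis using that G_carrier by blast
qed

sublocale A: fraction_ring S QA UA
  by (rule hom_fraction_ring[where GG = G, OF is_cring p_prime]) (fact G_additive G_one G_mult)+

sublocale B: fraction_ring S QB UB
proof (intro fraction_ring.intro fraction_system.intro reg_module_module
    fraction_system_axioms.intro fraction_ring_axioms.intro)
  fix m s assume ms: "(m, s) \<in> QB"
  have "\<ominus>\<^bsub>reg_module S\<^esub> m = \<ominus> m" by (simp add: a_inv_def m_inv_def)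
  then show "(\<ominus>\<^bsub>reg_module S\<^esub> m, s) \<in> QB" using ms by auto
qed (use one_notin_p mult_notin_p in auto)

abbreviation "\<iota> \<equiv> natural_map (loc_rel S p)"

lemma A_eq: "hom_localization_ring (Nvec r) S G p = A.F"
  by (simp add: hom_localization_ring_def hom_localization_def)

lemma B_eq: "localization S p = B.F"
  by (simp add: localization_def)

lemma sub_AB: "QA \<subseteq> QB" "UA \<subseteq> UB"
  using A.QD(1,2) A.U_sub by (auto simp: hom_denoms_def hom_pairs_def)

lemma \<iota>_cls [simp]: "(m, s) \<in> QA \<Longrightarrow> \<iota> (A.cls m s) = B.cls m s"
  unfolding loc_rel_def using natural_map_cls[OF B.fraction_system_axioms A.fraction_system_axioms
      sub_AB] .

sublocale \<iota>: ring_hom_cring A.F B.F \<iota>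
  unfolding loc_rel_def using natural_map_ring_hom[OF B.fraction_ring_axioms
      A.fraction_ring_axioms sub_AB] .

definition max_A where "max_A = {A.cls m s | m s. (m, s) \<in> QA \<and> m \<in> p}"
definition max_B where "max_B = {B.cls m s | m s. m \<in> p \<and> s \<in> carrier S \<and> s \<notin> p}"

lemma cls_p_indep_A:
  assumes "(m, s) \<in> QA" "(n, t) \<in> QA" "A.cls m s = A.cls n t" "m \<in> p" shows "n \<in> p"
proof -
  from assms obtain u where u: "u \<in> UA" "u \<otimes> (t \<otimes> m) = u \<otimes> (s \<otimes> n)" by (auto simp: A.cls_eq_iff)
  obtain d where 1: "m \<in> carrier S" "s \<in> carrier S" "s \<notin> p" using assms(1) by (metis QA_E)
  obtain e where 2: "n \<in> carrier S" "t \<in> carrier S" using assms(2) by (metis QA_E)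
  have 3: "u \<in> carrier S" "u \<notin> p" using u sub_AB by auto
  have "u \<otimes> (t \<otimes> m) \<in> p" using assms(4) 2 3 p.I_l_closed by simp
  then have "u \<otimes> s \<otimes> n \<in> p" using u 1 2 3 by (simp add: m_assoc)
  then show ?thesis using mult_notin_p[of "u \<otimes> s" n] mult_notin_p[of u s] 1 2 3 by auto
qed

lemma cls_p_indep_B:
  assumes "(m, s) \<in> QB" "(n, t) \<in> QB" "B.cls m s = B.cls n t" "m \<in> p" shows "n \<in> p"
proof -
  from assms obtain u where u: "u \<in> UB" "u \<otimes> (t \<otimes> m) = u \<otimes> (s \<otimes> n)" by (auto simp: B.cls_eq_iff)
  have 1: "m \<in> carrier S" "s \<in> carrier S" "s \<notin> p" "n \<in> carrier S" "t \<in> carrier S" "u \<in> carrier S"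
      "u \<notin> p"
    using assms u by auto
  have "u \<otimes> (t \<otimes> m) \<in> p" using assms(4) 1 p.I_l_closed by simp
  then have "u \<otimes> s \<otimes> n \<in> p" using u 1 by (simp add: m_assoc)
  then show ?thesis using mult_notin_p[of "u \<otimes> s" n] mult_notin_p[of u s] 1 by auto
qed

lemma A_unit:
  assumes "(m, s) \<in> QA" "m \<notin> p"
  shows "(s, m) \<in> QA" "A.cls s m \<otimes>\<^bsub>A.F\<^esub> A.cls m s = \<one>\<^bsub>A.F\<^esub>"
proof -
  obtain d where d: "d \<in> Nvec r" "m \<in> G d" "s \<in> G d" "s \<notin> p" "m \<in> carrier S" "s \<in> carrier S"
    using assms(1) by (metis QA_E)
  show sm: "(s, m) \<in> QA" using d assms by (auto intro: QA_I)
  show "A.cls s m \<otimes>\<^bsub>A.F\<^esub> A.cls m s = \<one>\<^bsub>A.F\<^esub>"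
    unfolding A.F_one A.cls_mult[OF sm assms(1)]
    using d A.Q_mult[OF sm assms(1)] A.Q_one by (intro A.cls_eqI) (auto simp: m_comm)
qed

lemma max_ideal_A: "max_ideal A.F = max_A"
proof -
  have max_A_iff: "A.cls m s \<in> max_A \<longleftrightarrow> m \<in> p" if "(m, s) \<in> QA" for m s
    using that cls_p_indep_A unfolding max_A_def by blast
  show ?thesis
  proof (rule \<iota>.R.max_ideal_eqI)
    show "ideal max_A A.F"
    proof (rule \<iota>.R.idealI')
      show "max_A \<subseteq> carrier A.F" by (auto simp: max_A_def)
      show "\<zero>\<^bsub>A.F\<^esub> \<in> max_A" using A.Q_zero by (simp add: A.F_zero max_A_iff)
      fix a b assume a: "a \<in> max_A"
      then obtain m s where ms: "(m, s) \<in> QA" "a = A.cls m s" "m \<in> p" by (auto simp: max_A_def)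
      { assume "b \<in> max_A"
        then obtain n t where nt: "(n, t) \<in> QA" "b = A.cls n t" "n \<in> p" by (auto simp: max_A_def)
        have "t \<otimes> m \<oplus> s \<otimes> n \<in> p" using ms nt A.QD(2) p.I_l_closed by auto
        then show "a \<oplus>\<^bsub>A.F\<^esub> b \<in> max_A" using ms nt A.Q_add[OF ms(1) nt(1)]
          by (simp add: A.cls_add[OF ms(1) nt(1)] max_A_iff) }
      assume "b \<in> carrier A.F"
      then obtain n t where nt: "(n, t) \<in> QA" "b = A.cls n t" by (metis A.F_cases)
      have nc: "n \<in> carrier S" using nt A.QD(1) by simp
      show "b \<otimes>\<^bsub>A.F\<^esub> a \<in> max_A" using ms nt A.Q_mult p.I_l_closed nc
          by (simp add: A.cls_mult max_A_iff)
      show "a \<otimes>\<^bsub>A.F\<^esub> b \<in> max_A" using ms nt A.Q_mult p.I_r_closed nc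
          by (simp add: A.cls_mult max_A_iff)
    qed
    show "\<one>\<^bsub>A.F\<^esub> \<notin> max_A" using A.Q_one one_notin_p by (simp add: A.F_one max_A_iff)
    fix a assume "a \<in> carrier A.F" "a \<notin> max_A"
    then obtain m s where "(m, s) \<in> QA" "a = A.cls m s" "m \<notin> p" by (metis A.F_cases max_A_iff)
    then show "\<exists>b\<in>carrier A.F. b \<otimes>\<^bsub>A.F\<^esub> a = \<one>\<^bsub>A.F\<^esub>" using A_unit A.cls_closed by blast
  qed
qed

lemma max_B_iff: "(m, s) \<in> QB \<Longrightarrow> B.cls m s \<in> max_B \<longleftrightarrow> m \<in> p"
  using cls_p_indep_B[of _ _ m s] p.Icarr unfolding max_B_def by auto

lemma max_B_ideal: "ideal max_B B.F"
proof -
  show ?thesis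
  proof (rule \<iota>.S.idealI')
    show "max_B \<subseteq> carrier B.F" using p.Icarr by (auto simp: max_B_def)
    show "\<zero>\<^bsub>B.F\<^esub> \<in> max_B" using B.Q_zero by (simp add: B.F_zero max_B_iff)
    fix a b assume a: "a \<in> max_B"
    then obtain m s where ms: "(m, s) \<in> QB" "a = B.cls m s" "m \<in> p" using p.Icarr
        by (auto simp: max_B_def)
    { assume "b \<in> max_B"
      then obtain n t where nt: "(n, t) \<in> QB" "b = B.cls n t" "n \<in> p" using p.Icarr
          by (auto simp: max_B_def)
      have "t \<otimes> m \<oplus> s \<otimes> n \<in> p" using ms nt p.I_l_closed by auto
      then show "a \<oplus>\<^bsub>B.F\<^esub> b \<in> max_B" using ms nt B.Q_add[OF ms(1) nt(1)]
        by (simp add: B.cls_add[OF ms(1) nt(1)] max_B_iff) }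
    assume "b \<in> carrier B.F"
    then obtain n t where nt: "(n, t) \<in> QB" "b = B.cls n t" by (metis B.F_cases)
    have nc: "n \<in> carrier S" using nt by simp
    show "b \<otimes>\<^bsub>B.F\<^esub> a \<in> max_B" using ms nt B.Q_mult[OF nt(1) ms(1)] p.I_l_closed nc
        by (simp add: B.cls_mult max_B_iff)
    show "a \<otimes>\<^bsub>B.F\<^esub> b \<in> max_B" using ms nt B.Q_mult[OF ms(1) nt(1)] p.I_r_closed nc
        by (simp add: B.cls_mult max_B_iff)
  qed
qed

lemma max_ideal_B: "max_ideal B.F = max_B"
proof -
  show ?thesis
  proof (rule \<iota>.S.max_ideal_eqI[OF max_B_ideal])
    show "\<one>\<^bsub>B.F\<^esub> \<notin> max_B" using B.Q_one one_notin_p by (simp add: B.F_one max_B_iff)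
    fix a assume "a \<in> carrier B.F" "a \<notin> max_B"
    then obtain m s where ms: "(m, s) \<in> QB" "a = B.cls m s" "m \<notin> p" by (metis B.F_cases max_B_iff)
    have sm: "(s, m) \<in> QB" using ms by auto
    have "B.cls s m \<otimes>\<^bsub>B.F\<^esub> a = \<one>\<^bsub>B.F\<^esub>"
      unfolding B.F_one ms(2) B.cls_mult[OF sm ms(1)]
      using B.Q_mult[OF sm ms(1)] B.Q_one ms by (intro B.cls_eqI) (auto simp: m_comm)
    then show "\<exists>b\<in>carrier B.F. b \<otimes>\<^bsub>B.F\<^esub> a = \<one>\<^bsub>B.F\<^esub>" using B.cls_closed[OF sm] by blast
  qed
qed

lemma B_split_denominator:
  assumes "m \<in> carrier S" "s \<in> carrier S" "s \<notin> p"
  shows "B.cls m s = B.cls \<one> s \<otimes>\<^bsub>B.F\<^esub> B.cls m \<one>"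
  using assms one_notin_p by (subst B.cls_mult) auto

lemma B_clear_denominator:
  assumes "m \<in> carrier S" "s \<in> carrier S" "s \<notin> p"
  shows "B.cls m \<one> = B.cls s \<one> \<otimes>\<^bsub>B.F\<^esub> B.cls m s"
proof -
  have "B.cls m \<one> = B.cls (s \<otimes> m) (\<one> \<otimes> s)"
    using assms one_notin_p by (intro B.cls_eqI) auto
  then show ?thesis using assms one_notin_p by (subst B.cls_mult) auto
qed

text \<open>The components \<open>hcomp d m\<close> of an element \<open>m\<close> of \<open>p\<close> lie in \<open>p\<close>, and over \<open>S\<^sub>p\<close> each of them
  is the multiple \<open>x d\<close> of the fraction \<open>hcomp d m / x d\<close>, which comes from the maximal ideal of
  \<open>A.F\<close>. So the closed fiber is the residue field.\<close>

lemma max_A_extended: "Idl\<^bsub>B.F\<^esub> (\<iota> ` max_A) = max_B"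
proof -
  have im: "\<iota> ` max_A \<subseteq> max_B"
  proof (clarsimp simp: max_A_def)
    fix m s assume "(m, s) \<in> QA" "m \<in> p"
    then show "B.cls m s \<in> max_B" using sub_AB by (subst max_B_iff) auto
  qed
  then have sub: "\<iota> ` max_A \<subseteq> carrier B.F" using ideal.Icarr[OF max_B_ideal] by blast
  let ?I = "Idl\<^bsub>B.F\<^esub> (\<iota> ` max_A)"
  interpret I: ideal ?I B.F by (rule \<iota>.S.genideal_ideal[OF sub])
  let ?J = "{m \<in> carrier S. B.cls m \<one> \<in> ?I}"
  have q1: "(m, \<one>) \<in> QB" if "m \<in> carrier S" for m using that one_notin_p by auto
  interpret J: ideal ?J S
  proof (rule idealI')
    show "\<zero> \<in> ?J" using I.zero_closed by (simp add: B.F_zero)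
    fix a b assume a: "a \<in> ?J"
    { assume b: "b \<in> ?J"
      have "B.cls (a \<oplus> b) \<one> = B.cls a \<one> \<oplus>\<^bsub>B.F\<^esub> B.cls b \<one>"
        using a b by (subst B.cls_add) (auto simp: q1 one_notin_p)
      then show "a \<oplus> b \<in> ?J" using a b I.a_closed by auto }
    assume b: "b \<in> carrier S"
    have "B.cls (b \<otimes> a) \<one> = B.cls b \<one> \<otimes>\<^bsub>B.F\<^esub> B.cls a \<one>"
      using a b by (subst B.cls_mult) (auto simp: q1 one_notin_p)
    then show "b \<otimes> a \<in> ?J" using a b I.I_l_closed[of "B.cls a \<one>" "B.cls b \<one>"] q1[OF b] by simp
    moreover have "a \<otimes> b = b \<otimes> a" using a b by (intro m_comm) auto
    ultimately show "a \<otimes> b \<in> ?J" by simp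
  qed auto
  have "max_B \<subseteq> ?I"
  proof
    fix z assume "z \<in> max_B"
    then obtain m s where ms: "m \<in> p" "s \<in> carrier S" "s \<notin> p" "z = B.cls m s" unfolding max_B_def
        by blast
    have mc: "m \<in> carrier S" by (rule p.Icarr[OF ms(1)])
    have "hcomp d m \<in> ?J" if d: "d \<in> supp m" for d
    proof -
      have dN: "d \<in> Nvec r" using d supp_Nvec by blast
      have q: "(hcomp d m, x d) \<in> QA"
        by (rule QA_I[OF dN hcomp_G[OF mc dN] x_G[OF dN] x_notin[OF dN]])
      have "A.cls (hcomp d m) (x d) \<in> max_A"
        unfolding max_A_def mem_Collect_eq
        by (rule exI[of _ "hcomp d m"], rule exI[of _ "x d"], intro conjI refl q p_homog[OF ms(1)])
      from subsetD[OF \<iota>.S.genideal_self[OF sub] imageI[OF this]]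
      have i: "B.cls (hcomp d m) (x d) \<in> ?I" unfolding \<iota>_cls[OF q] .
      have xc: "x d \<in> carrier S" "x d \<notin> p"
          by (rule G_carrier[OF dN x_G[OF dN]], rule x_notin[OF dN])
      have "B.cls (hcomp d m) \<one> = B.cls (x d) \<one> \<otimes>\<^bsub>B.F\<^esub> B.cls (hcomp d m) (x d)"
        by (rule B_clear_denominator[OF hcomp_closed xc])
      also have "\<dots> \<in> ?I" by (rule I.I_l_closed[OF i B.cls_closed[OF q1[OF xc(1)]]])
      finally show ?thesis by (intro CollectI conjI hcomp_closed)
    qed
    then have "(\<Oplus>d\<in>supp m. hcomp d m) \<in> ?J" by (rule J.ideal_finsum_closed[OF finite_supp[OF mc]])
    then have "m \<in> ?J" using hcomp_decomp[OF mc] by (rule ssubst[rotated])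
    then have m1: "B.cls m \<one> \<in> ?I" unfolding mem_Collect_eq by (rule conjunct2)
    have q2: "(\<one>, s) \<in> QB" by (intro SigmaI DiffI one_closed ms)
    have "B.cls \<one> s \<otimes>\<^bsub>B.F\<^esub> B.cls m \<one> \<in> ?I" by (rule I.I_l_closed[OF m1 B.cls_closed[OF q2]])
    then show "z \<in> ?I" unfolding ms(4) B_split_denominator[OF mc ms(2,3)] .
  qed
  moreover have "?I \<subseteq> max_B" by (rule \<iota>.S.genideal_minimal[OF max_B_ideal im])
  ultimately show ?thesis by auto
qed

lemma closed_fiber_eq:
  "closed_fiber (hom_localization_ring (Nvec r) S G p) (localization S p) \<iota> =
      residue_field (localization S p)"
  unfolding closed_fiber_def residue_field_def A_eq B_eq max_ideal_A max_ideal_B max_A_extended ..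

end

context graded_point
begin

section \<open>Polynomials over a module\<close>

text \<open>The coefficient of \<open>X^d\<close> in the image of \<open>s\<close> under the ring homomorphism from \<open>S\<close> to the
  polynomial ring over \<open>A.F\<close> that sends \<open>s\<close> of degree \<open>d\<close> to \<open>(s / x d) X^d\<close>.\<close>

definition gcoef :: "mdeg \<Rightarrow> 'a \<Rightarrow> ('a \<times> 'a) set" where
  "gcoef d s = (if d \<in> Nvec r then A.cls (hcomp d s) (x d) else \<zero>\<^bsub>A.F\<^esub>)"

lemma x_carrier: "d \<in> Nvec r \<Longrightarrow> x d \<in> carrier S"
  using G_carrier[OF _ x_G] .

lemma QA_x: "d \<in> Nvec r \<Longrightarrow> a \<in> G d \<Longrightarrow> (a, x d) \<in> QA"
  using x_G x_notin by (intro QA_I)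

lemma gcoef_closed [simp]: "s \<in> carrier S \<Longrightarrow> gcoef d s \<in> carrier A.F"
  unfolding gcoef_def using QA_x[of d "hcomp d s"] by auto

lemma A_cls_zero: "d \<in> Nvec r \<Longrightarrow> A.cls \<zero> (x d) = \<zero>\<^bsub>A.F\<^esub>"
  unfolding A.F_zero using QA_x[of d \<zero>] A.Q_zero x_carrier[of d] by (intro A.cls_eqI) auto

lemma gcoef_eq_zero: "hcomp d s = \<zero> \<Longrightarrow> gcoef d s = \<zero>\<^bsub>A.F\<^esub>"
  by (simp add: gcoef_def A_cls_zero)

lemma A_cls_add:
  assumes "d \<in> Nvec r" "a \<in> G d" "b \<in> G d"
  shows "A.cls (a \<oplus> b) (x d) = A.cls a (x d) \<oplus>\<^bsub>A.F\<^esub> A.cls b (x d)"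
proof -
  have c: "a \<in> carrier S" "b \<in> carrier S" "x d \<in> carrier S" using assms G_carrier x_carrier
      by blast+
  have q: "(a, x d) \<in> QA" "(b, x d) \<in> QA" "(a \<oplus> b, x d) \<in> QA" using assms by (auto intro: QA_x)
  show ?thesis unfolding A.cls_add[OF q(1,2)]
    using A.Q_add[OF q(1,2)] q(3) c by (intro A.cls_eqI) (auto simp: r_distr m_ac)
qed

lemma gcoef_add: "s \<in> carrier S \<Longrightarrow> t \<in> carrier S \<Longrightarrow> gcoef d (s \<oplus> t) = gcoef d s \<oplus>\<^bsub>A.F\<^esub> gcoef d t"
  by (simp add: gcoef_def A_cls_add)

lemma gcoef_homog: "d \<in> Nvec r \<Longrightarrow> s \<in> G d \<Longrightarrow> gcoef d s = A.cls s (x d)"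
  by (simp add: gcoef_def hcomp_homog)

lemma gcoef_mult_homog:
  assumes "d \<in> Nvec r" "e \<in> Nvec r" "s \<in> G d" "t \<in> G e"
  shows "gcoef (deg_add d e) (s \<otimes> t) = gcoef d s \<otimes>\<^bsub>A.F\<^esub> gcoef e t"
  using assms QA_x by (simp add: gcoef_homog G_mult A.cls_mult x_add)

lemma gcoef_one: "gcoef deg_zero \<one> = \<one>\<^bsub>A.F\<^esub>"
  by (simp add: gcoef_homog x_zero A.F_one)

lemma gcoef_x: "d \<in> Nvec r \<Longrightarrow> gcoef d (x d) = \<one>\<^bsub>A.F\<^esub>"
  using QA_x[OF _ x_G] A.Q_one x_carrier by (simp add: gcoef_homog x_G A.F_one) (intro A.cls_eqI,
      auto)

text \<open>A homogeneous element outside \<open>p\<close> and the monomial of its degree are both denominators.\<close>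

lemma gcoef_unit:
  assumes "d \<in> Nvec r" "s \<in> carrier S" "hcomp d s \<notin> p"
  obtains b where "b \<in> carrier A.F" "b \<otimes>\<^bsub>A.F\<^esub> gcoef d s = \<one>\<^bsub>A.F\<^esub>"
proof -
  have "(hcomp d s, x d) \<in> QA" using assms by (intro QA_x) auto
  from A_unit[OF this assms(3)] show thesis using that[of "A.cls (x d) (hcomp d s)"] assms(1)
      by (simp add: gcoef_def)
qed

end

text \<open>For a module \<open>M\<close> over \<open>A.F\<close>, \<open>MX\<close> is the \<open>S\<close>-module \<open>M[X\<^sub>1, \<dots>, X\<^sub>r]\<close>: finitely supported
  functions from \<open>\<nat>^r\<close> to \<open>M\<close>, on which \<open>s\<close> acts by multiplication with the polynomial of its
  coefficients \<open>gcoef d s\<close>. The monomial with coefficient \<open>m\<close> and exponent \<open>n\<close> is \<open>delta n m\<close>.\<close>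

locale flat_module = graded_point S r G p x + M: module "A.F" M
  for S :: "('a, 's) ring_scheme" (structure) and r G p x and M :: "(('a \<times> 'a) set, 'm) module"
begin

definition delta :: "mdeg \<Rightarrow> 'm \<Rightarrow> mdeg \<Rightarrow> 'm" where
  "delta n m = (\<lambda>l. if l = n then m else \<zero>\<^bsub>M\<^esub>)"

definition MXc :: "(mdeg \<Rightarrow> 'm) set" where
  "MXc = {F. (\<forall>n. F n \<in> carrier M) \<and> (\<forall>n. n \<notin> Nvec r \<longrightarrow> F n = \<zero>\<^bsub>M\<^esub>) \<and> finite {n. F n \<noteq> \<zero>\<^bsub>M\<^esub>}}"

definition act :: "'a \<Rightarrow> (mdeg \<Rightarrow> 'm) \<Rightarrow> mdeg \<Rightarrow> 'm" where
  "act s F = (\<lambda>l. \<Oplus>\<^bsub>M\<^esub>d\<in>supp s. gcoef d s \<odot>\<^bsub>M\<^esub> F (\<lambda>i. l i - d i))"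

text \<open>The fields \<open>mult\<close> and \<open>one\<close> have no meaning for a module and are filled arbitrarily.\<close>

definition MX :: "('a, mdeg \<Rightarrow> 'm) module" where
  "MX = \<lparr>carrier = MXc, monoid.mult = (\<lambda>F F'. F), one = (\<lambda>_. \<zero>\<^bsub>M\<^esub>),
     ring.zero = (\<lambda>_. \<zero>\<^bsub>M\<^esub>), ring.add = (\<lambda>F F' n. F n \<oplus>\<^bsub>M\<^esub> F' n), module.smult = act\<rparr>"

lemma MX_simps [simp]: "carrier MX = MXc" "\<zero>\<^bsub>MX\<^esub> = (\<lambda>_. \<zero>\<^bsub>M\<^esub>)"
  "F \<oplus>\<^bsub>MX\<^esub> F' = (\<lambda>n. F n \<oplus>\<^bsub>M\<^esub> F' n)" "s \<odot>\<^bsub>MX\<^esub> F = act s F"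
  by (simp_all add: MX_def)

lemma MXc_D: "F \<in> MXc \<Longrightarrow> F n \<in> carrier M"
  by (simp add: MXc_def)

lemma MXc_zero: "F \<in> MXc \<Longrightarrow> n \<notin> Nvec r \<Longrightarrow> F n = \<zero>\<^bsub>M\<^esub>"
  by (simp add: MXc_def)

lemma MXc_finite: "F \<in> MXc \<Longrightarrow> finite {n. F n \<noteq> \<zero>\<^bsub>M\<^esub>}"
  by (simp add: MXc_def)

lemma MXcI: "(\<And>n. F n \<in> carrier M) \<Longrightarrow> (\<And>n. n \<notin> Nvec r \<Longrightarrow> F n = \<zero>\<^bsub>M\<^esub>) \<Longrightarrow>
   finite {n. F n \<noteq> \<zero>\<^bsub>M\<^esub>} \<Longrightarrow> F \<in> MXc"
  by (simp add: MXc_def)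

lemma zero_MXc [simp]: "(\<lambda>_. \<zero>\<^bsub>M\<^esub>) \<in> MXc"
  by (simp add: MXc_def)

lemma add_MXc [simp]: "F \<in> MXc \<Longrightarrow> F' \<in> MXc \<Longrightarrow> (\<lambda>n. F n \<oplus>\<^bsub>M\<^esub> F' n) \<in> MXc"
proof -
  assume F: "F \<in> MXc" "F' \<in> MXc"
  have "{n. F n \<oplus>\<^bsub>M\<^esub> F' n \<noteq> \<zero>\<^bsub>M\<^esub>} \<subseteq> {n. F n \<noteq> \<zero>\<^bsub>M\<^esub>} \<union> {n. F' n \<noteq> \<zero>\<^bsub>M\<^esub>}" by auto
  from finite_subset[OF this] show ?thesis using F MXc_D[OF F(1)] MXc_D[OF F(2)]
      by (intro MXcI) (auto simp: MXc_zero MXc_finite)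
qed

lemma neg_MXc: "F \<in> MXc \<Longrightarrow> (\<lambda>n. \<ominus>\<^bsub>M\<^esub> F n) \<in> MXc"
proof -
  assume F: "F \<in> MXc"
  have "{n. \<ominus>\<^bsub>M\<^esub> F n \<noteq> \<zero>\<^bsub>M\<^esub>} \<subseteq> {n. F n \<noteq> \<zero>\<^bsub>M\<^esub>}" by auto
  from finite_subset[OF this] show ?thesis using F MXc_D[OF F]
      by (intro MXcI) (auto simp: MXc_zero MXc_finite)
qed

lemma delta_MXc [simp]: "n \<in> Nvec r \<Longrightarrow> m \<in> carrier M \<Longrightarrow> delta n m \<in> MXc"
proof -
  assume h: "n \<in> Nvec r" "m \<in> carrier M"
  have "{l. delta n m l \<noteq> \<zero>\<^bsub>M\<^esub>} \<subseteq> {n}" by (auto simp: delta_def)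
  from finite_subset[OF this] show ?thesis using h by (intro MXcI) (auto simp: delta_def)
qed

lemma MX_induct [consumes 1, case_names zero delta add]:
  assumes F: "F \<in> MXc" and z: "P (\<lambda>_. \<zero>\<^bsub>M\<^esub>)"
    and d: "\<And>n m. n \<in> Nvec r \<Longrightarrow> m \<in> carrier M \<Longrightarrow> P (delta n m)"
    and a: "\<And>F F'. F \<in> MXc \<Longrightarrow> F' \<in> MXc \<Longrightarrow> P F \<Longrightarrow> P F' \<Longrightarrow> P (\<lambda>n. F n \<oplus>\<^bsub>M\<^esub> F' n)"
  shows "P F"
proof -
  have "\<And>F. F \<in> MXc \<Longrightarrow> {n. F n \<noteq> \<zero>\<^bsub>M\<^esub>} \<subseteq> D \<Longrightarrow> P F" if "finite D" for D
    using that
  proof (induction D rule: finite_induct)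
    case empty
    then have "F = (\<lambda>_. \<zero>\<^bsub>M\<^esub>)" by auto
    then show ?case using z by simp
  next
    case (insert k D)
    show ?case
    proof (cases "k \<in> Nvec r")
      case True
      let ?F = "F(k := \<zero>\<^bsub>M\<^esub>)"
      have fin: "finite {n. ?F n \<noteq> \<zero>\<^bsub>M\<^esub>}"
        using MXc_finite[OF insert.prems(1)] by (rule rev_finite_subset) auto
      have Fc: "F n \<in> carrier M" for n by (rule MXc_D[OF insert.prems(1)])
      have F': "?F \<in> MXc" using Fc fin MXc_zero[OF insert.prems(1)] by (intro MXcI) auto
      have "{n. ?F n \<noteq> \<zero>\<^bsub>M\<^esub>} \<subseteq> D" using insert.prems(2) by auto
      then have P: "P ?F" by (rule insert.IH[OF F'])
      have "F = (\<lambda>n. delta k (F k) n \<oplus>\<^bsub>M\<^esub> ?F n)" using Fc by (intro ext) (auto simp: delta_def)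
      moreover have "P (\<lambda>n. delta k (F k) n \<oplus>\<^bsub>M\<^esub> ?F n)"
        by (intro a F' P d delta_MXc True Fc)
      ultimately show ?thesis by simp
    next
      case False
      then have "{n. F n \<noteq> \<zero>\<^bsub>M\<^esub>} \<subseteq> D" using insert.prems MXc_zero by auto
      then show ?thesis using insert by simp
    qed
  qed
  then show ?thesis using F MXc_finite by blast
qed

lemma act_eq_sum:
  assumes "s \<in> carrier S" "F \<in> MXc" "finite D" "supp s \<subseteq> D"
  shows "act s F l = (\<Oplus>\<^bsub>M\<^esub>d\<in>D. gcoef d s \<odot>\<^bsub>M\<^esub> F (\<lambda>i. l i - d i))"
  unfolding act_def using assms MXc_D[OF assms(2)]
  by (intro M.M.add.finprod_mono_neutral_cong_left) (auto simp: supp_def gcoef_eq_zero)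

lemma act_closed_pt [simp]: "s \<in> carrier S \<Longrightarrow> F \<in> MXc \<Longrightarrow> act s F l \<in> carrier M"
  unfolding act_def using MXc_D[of F] by (intro M.M.finsum_closed) auto

lemma act_add_left:
  assumes "s \<in> carrier S" "t \<in> carrier S" "F \<in> MXc"
  shows "act (s \<oplus> t) F = (\<lambda>n. act s F n \<oplus>\<^bsub>M\<^esub> act t F n)"
proof
  fix l
  let ?D = "supp s \<union> supp t"
  have D: "finite ?D" using assms by simp
  have "act (s \<oplus> t) F l = (\<Oplus>\<^bsub>M\<^esub>d\<in>?D. gcoef d (s \<oplus> t) \<odot>\<^bsub>M\<^esub> F (\<lambda>i. l i - d i))"
    using assms D supp_add[OF assms(1,2)] by (intro act_eq_sum) auto
  also have "\<dots> = (\<Oplus>\<^bsub>M\<^esub>d\<in>?D. gcoef d s \<odot>\<^bsub>M\<^esub> F (\<lambda>i. l i - d i) \<oplus>\<^bsub>M\<^esub> gcoef d t \<odot>\<^bsub>M\<^esub> F (\<lambda>i. l i - d i))"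
    using assms MXc_D[OF assms(3)] by (intro M.M.finsum_cong') (auto simp: gcoef_add
        M.smult_l_distr)
  also have "\<dots> = (\<Oplus>\<^bsub>M\<^esub>d\<in>?D. gcoef d s \<odot>\<^bsub>M\<^esub> F (\<lambda>i. l i - d i)) \<oplus>\<^bsub>M\<^esub> (\<Oplus>\<^bsub>M\<^esub>d\<in>?D. gcoef d t \<odot>\<^bsub>M\<^esub> F
      (\<lambda>i. l i - d i))"
    using assms MXc_D[OF assms(3)] by (intro M.M.finsum_addf) auto
  also have "\<dots> = act s F l \<oplus>\<^bsub>M\<^esub> act t F l"
    using assms D by (simp add: act_eq_sum[of s F ?D] act_eq_sum[of t F ?D])
  finally show "act (s \<oplus> t) F l = act s F l \<oplus>\<^bsub>M\<^esub> act t F l" .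
qed

lemma act_add_right:
  assumes "s \<in> carrier S" "F \<in> MXc" "F' \<in> MXc"
  shows "act s (\<lambda>n. F n \<oplus>\<^bsub>M\<^esub> F' n) = (\<lambda>n. act s F n \<oplus>\<^bsub>M\<^esub> act s F' n)"
proof
  fix l
  have "act s (\<lambda>n. F n \<oplus>\<^bsub>M\<^esub> F' n) l =
    (\<Oplus>\<^bsub>M\<^esub>d\<in>supp s. gcoef d s \<odot>\<^bsub>M\<^esub> F (\<lambda>i. l i - d i) \<oplus>\<^bsub>M\<^esub> gcoef d s \<odot>\<^bsub>M\<^esub> F' (\<lambda>i. l i - d i))"
    unfolding act_def using assms MXc_D[OF assms(2)] MXc_D[OF assms(3)]
        by (intro M.M.finsum_cong') (auto simp: M.smult_r_distr)
  also have "\<dots> = act s F l \<oplus>\<^bsub>M\<^esub> act s F' l"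
    unfolding act_def using assms MXc_D[OF assms(2)] MXc_D[OF assms(3)]
        by (intro M.M.finsum_addf) auto
  finally show "act s (\<lambda>n. F n \<oplus>\<^bsub>M\<^esub> F' n) l = act s F l \<oplus>\<^bsub>M\<^esub> act s F' l" .
qed

lemma act_homog:
  assumes "d \<in> Nvec r" "s \<in> G d" "F \<in> MXc"
  shows "act s F l = gcoef d s \<odot>\<^bsub>M\<^esub> F (\<lambda>i. l i - d i)"
proof -
  have s: "s \<in> carrier S" by (rule G_carrier[OF assms(1,2)])
  show ?thesis using act_eq_sum[OF s assms(3) _ supp_homog[OF assms(1,2)],
      of l] s MXc_D[OF assms(3)] by simp
qed

lemma act_zero_left [simp]: "F \<in> MXc \<Longrightarrow> act \<zero> F = (\<lambda>_. \<zero>\<^bsub>M\<^esub>)"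
  by (simp add: act_def supp_def)

lemma act_zero_right [simp]: "s \<in> carrier S \<Longrightarrow> act s (\<lambda>_. \<zero>\<^bsub>M\<^esub>) = (\<lambda>_. \<zero>\<^bsub>M\<^esub>)"
  unfolding act_def by (rule ext) (simp add: M.M.add.finprod_one_eqI)

lemma act_closed:
  assumes s: "s \<in> carrier S" and F: "F \<in> MXc"
  shows "act s F \<in> MXc"
  using s
proof (rule homogeneous_induct)
  fix d y assume d: "d \<in> Nvec r" and y: "y \<in> G d"
  have yc: "y \<in> carrier S" by (rule G_carrier[OF d y])
  have eq: "act y F l = gcoef d y \<odot>\<^bsub>M\<^esub> F (\<lambda>i. l i - d i)" for l by (rule act_homog[OF d y F])
  have out: "act y F l = \<zero>\<^bsub>M\<^esub>" if l: "l \<notin> Nvec r" for l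
  proof -
    have "(\<lambda>i. l i - d i) \<notin> Nvec r"
    proof
      assume "(\<lambda>i. l i - d i) \<in> Nvec r"
      from Nvec_add[OF d this] show False using l by simp
    qed
    from MXc_zero[OF F this] show ?thesis using yc by (simp add: eq)
  qed
  have "{l. act y F l \<noteq> \<zero>\<^bsub>M\<^esub>} \<subseteq> (\<lambda>n i. n i + d i) ` {n. F n \<noteq> \<zero>\<^bsub>M\<^esub>}"
  proof
    fix l assume "l \<in> {l. act y F l \<noteq> \<zero>\<^bsub>M\<^esub>}"
    then have "F (\<lambda>i. l i - d i) \<noteq> \<zero>\<^bsub>M\<^esub>" using yc by (auto simp: eq)
    then show "l \<in> (\<lambda>n i. n i + d i) ` {n. F n \<noteq> \<zero>\<^bsub>M\<^esub>}"
      by (intro image_eqI[of _ _ "\<lambda>i. l i - d i"]) simp_all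
  qed
  from finite_subset[OF this finite_imageI[OF MXc_finite[OF F]]]
  have "finite {l. act y F l \<noteq> \<zero>\<^bsub>M\<^esub>}" .
  then show "act y F \<in> MXc" by (intro MXcI out act_closed_pt yc F)
qed (use F in \<open>simp_all add: act_add_left\<close>)

text \<open>Additivity in both ring elements reduces the claim to homogeneous ones, where both sides are
  a single coefficient times a shift of \<open>F\<close>.\<close>

lemma act_assoc:
  assumes s: "s \<in> carrier S" and t: "t \<in> carrier S" and F: "F \<in> MXc"
  shows "act (s \<otimes> t) F = act s (act t F)"
  using s
proof (rule homogeneous_induct)
  show "act (\<zero> \<otimes> t) F = act \<zero> (act t F)" using t F act_closed by simp
next
  fix y z assume "y \<in> carrier S" "z \<in> carrier S" "act (y \<otimes> t) F = act y (act t F)"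
      "act (z \<otimes> t) F = act z (act t F)"
  then show "act ((y \<oplus> z) \<otimes> t) F = act (y \<oplus> z) (act t F)"
    using t F act_closed by (simp add: l_distr act_add_left)
next
  fix d y assume d: "d \<in> Nvec r" and y: "y \<in> G d"
  have yc: "y \<in> carrier S" by (rule G_carrier[OF d y])
  show "act (y \<otimes> t) F = act y (act t F)"
    using t
  proof (rule homogeneous_induct)
    show "act (y \<otimes> \<zero>) F = act y (act \<zero> F)" using yc F by simp
  next
    fix u v assume "u \<in> carrier S" "v \<in> carrier S" "act (y \<otimes> u) F = act y (act u F)"
        "act (y \<otimes> v) F = act y (act v F)"
    then show "act (y \<otimes> (u \<oplus> v)) F = act y (act (u \<oplus> v) F)"
      using yc F act_closed by (simp add: r_distr act_add_left act_add_right)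
  next
    fix e u assume e: "e \<in> Nvec r" and u: "u \<in> G e"
    have uc: "u \<in> carrier S" by (rule G_carrier[OF e u])
    show "act (y \<otimes> u) F = act y (act u F)"
    proof
      fix l
      have "act (y \<otimes> u) F l = gcoef (deg_add d e) (y \<otimes> u) \<odot>\<^bsub>M\<^esub> F (\<lambda>i. l i - deg_add d e i)"
        by (rule act_homog[OF Nvec_add[OF d e] G_mult[OF d e y u] F])
      also have "\<dots> = gcoef d y \<odot>\<^bsub>M\<^esub> (gcoef e u \<odot>\<^bsub>M\<^esub> F (\<lambda>i. l i - d i - e i))"
        using yc uc MXc_D[OF F] by (simp add: gcoef_mult_homog[OF d e y u] M.smult_assoc1
            diff_diff_eq)
      also have "\<dots> = act y (act u F) l"
        using act_closed[OF uc F] by (simp add: act_homog[OF d y] act_homog[OF e u F])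
      finally show "act (y \<otimes> u) F l = act y (act u F) l" .
    qed
  qed
qed

lemma act_one: "F \<in> MXc \<Longrightarrow> act \<one> F = F"
  by (rule ext) (use MXc_D[of F] in \<open>simp add: act_homog[OF Nvec_zero G_one] gcoef_one\<close>)

lemma MX_module: "module S MX"
proof (rule moduleI)
  show "abelian_group MX"
  proof (rule abelian_groupI)
    fix F assume F: "F \<in> carrier MX"
    show "\<exists>y\<in>carrier MX. y \<oplus>\<^bsub>MX\<^esub> F = \<zero>\<^bsub>MX\<^esub>"
      using F neg_MXc by (intro bexI[of _ "\<lambda>n. \<ominus>\<^bsub>M\<^esub> F n"]) (auto simp: fun_eq_iff M.M.l_neg[OF
          MXc_D])
  qed (auto simp: M.M.a_ac MXc_D[of _ _] fun_eq_iff dest: MXc_D)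
qed (auto simp: is_cring act_closed act_add_left act_add_right act_assoc act_one)

text \<open>\<open>L.F\<close> is the localization of \<open>M[X]\<close> at \<open>p\<close>, which the next section identifies with \<open>S\<^sub>p \<otimes>
  M\<close>. The module \<open>N\<close> is \<open>S\<^sub>p\<close> over \<open>A.F\<close>, and \<open>T.TP\<close> is the tensor product of \<open>N\<close> and \<open>M\<close>.\<close>

abbreviation "QL \<equiv> MXc \<times> (carrier S - p)"

sublocale MX: module S MX by (rule MX_module)

sublocale L: fraction_system S MX QL UB
proof (intro fraction_system.intro fraction_system_axioms.intro MX_module)
  fix m s assume ms: "(m, s) \<in> QL"
  then show "(\<ominus>\<^bsub>MX\<^esub> m, s) \<in> QL" using MX.M.a_inv_closed[of m] by simp
qed (use one_notin_p mult_notin_p act_closed in auto)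

abbreviation "N \<equiv> restrict_scalars \<iota> (reg_module B.F)"

lemma N_module: "module A.F N"
  by (rule \<iota>.restrict_scalars_module)

sublocale T: two_modules "A.F" N M
  by (intro two_modules.intro N_module M.module_axioms)

lemma act_delta:
  assumes "d \<in> Nvec r" "s \<in> G d" "n \<in> Nvec r" "m \<in> carrier M"
  shows "act s (delta n m) = delta (deg_add d n) (gcoef d s \<odot>\<^bsub>M\<^esub> m)"
proof
  fix l
  have s: "s \<in> carrier S" by (rule G_carrier[OF assms(1,2)])
  have "((\<lambda>i. l i - d i) = n) = (l = deg_add d n)" unfolding fun_eq_iff by (smt (verit))
  then show "act s (delta n m) l = delta (deg_add d n) (gcoef d s \<odot>\<^bsub>M\<^esub> m) l"
    using s assms by (simp add: act_homog) (simp add: delta_def)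
qed

end

context flat_module
begin

section \<open>Tensoring with the localization\<close>

abbreviation "x_over_one n \<equiv> B.cls (x n) \<one>"
abbreviation "over_one u \<equiv> B.cls u \<one>"

lemma over_one_closed [simp]: "u \<in> carrier S \<Longrightarrow> over_one u \<in> carrier B.F"
  using one_notin_p by (intro B.cls_closed) auto

lemma x_over_one_closed [simp]: "n \<in> Nvec r \<Longrightarrow> x_over_one n \<in> carrier B.F"
  using x_carrier by simp

lemma over_one_add: "u \<in> carrier S \<Longrightarrow> v \<in> carrier S \<Longrightarrow> over_one (u \<oplus> v) =
    over_one u \<oplus>\<^bsub>B.F\<^esub> over_one v"
  using one_notin_p by (subst B.cls_add) auto

lemma over_one_mult: "u \<in> carrier S \<Longrightarrow> v \<in> carrier S \<Longrightarrow> over_one (u \<otimes> v) =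
    over_one u \<otimes>\<^bsub>B.F\<^esub> over_one v"
  using one_notin_p by (subst B.cls_mult) auto

lemma over_one_zero: "over_one \<zero> = \<zero>\<^bsub>B.F\<^esub>"
  by (simp add: B.F_zero)

text \<open>The defining identity of the coefficients: \<open>(u / x d) * x d = u\<close> for \<open>u\<close> of degree \<open>d\<close>.\<close>

lemma over_one_gcoef:
  assumes "d \<in> Nvec r" "u \<in> G d" shows "\<iota> (gcoef d u) \<otimes>\<^bsub>B.F\<^esub> x_over_one d = over_one u"
proof -
  have u: "u \<in> carrier S" by (rule G_carrier[OF assms])
  show ?thesis using B_clear_denominator[OF u x_carrier[OF assms(1)] x_notin[OF assms(1)]]
    x_carrier[OF assms(1)] x_notin[OF assms(1)] u
    by (simp add: gcoef_homog[OF assms] \<iota>_cls[OF QA_x[OF assms]] \<iota>.S.m_comm)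
qed

lemma N_simps: "carrier N = carrier B.F" "ring.add N = ring.add B.F" "a \<odot>\<^bsub>N\<^esub> y = \<iota> a \<otimes>\<^bsub>B.F\<^esub> y"
    "ring.zero N = ring.zero B.F"
  by simp_all

text \<open>The element \<open>y \<Sum>n. x n \<otimes> F n\<close> of \<open>S\<^sub>p \<otimes> M\<close>. It is the image of \<open>F / w\<close> when \<open>y\<close> is \<open>1 / w\<close>,
  and all elements of the tensor product arise in this way.\<close>

definition tsum :: "('a \<times> 'a) set \<Rightarrow> (mdeg \<Rightarrow> 'm) \<Rightarrow> (('a \<times> 'a) set \<times> 'm \<Rightarrow>\<^sub>0 int) set" where
  "tsum y F = (\<Otimes>\<^bsub>T.TP\<^esub>n\<in>{n. F n \<noteq> \<zero>\<^bsub>M\<^esub>}. T.tens (y \<otimes>\<^bsub>B.F\<^esub> x_over_one n) (F n))"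

lemma tens_cl: "y \<in> carrier B.F \<Longrightarrow> m \<in> carrier M \<Longrightarrow> T.tens y m \<in> carrier T.TP"
  using T.tens_closed by simp

lemma tsum_eq:
  assumes y: "y \<in> carrier B.F" and F: "F \<in> MXc" and D: "finite D" "D \<subseteq> Nvec r" "{n. F n \<noteq> \<zero>\<^bsub>M\<^esub>} \<subseteq> D"
  shows "tsum y F = (\<Otimes>\<^bsub>T.TP\<^esub>n\<in>D. T.tens (y \<otimes>\<^bsub>B.F\<^esub> x_over_one n) (F n))"
  unfolding tsum_def
proof (rule T.TP.finprod_mono_neutral_cong_left)
  fix n assume n: "n \<in> D - {n. F n \<noteq> \<zero>\<^bsub>M\<^esub>}"
  then have "F n = \<zero>\<^bsub>M\<^esub>" "n \<in> Nvec r" using D by auto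
  then show "T.tens (y \<otimes>\<^bsub>B.F\<^esub> x_over_one n) (F n) = \<one>\<^bsub>T.TP\<^esub>" using y T.tens_zero_right by simp
next
  show "(\<lambda>n. T.tens (y \<otimes>\<^bsub>B.F\<^esub> x_over_one n) (F n)) \<in> D \<rightarrow> carrier T.TP"
    using y D(2) MXc_D[OF F] by (intro Pi_I tens_cl) auto
qed (use D in auto)

lemma supp_F: "F \<in> MXc \<Longrightarrow> {n. F n \<noteq> \<zero>\<^bsub>M\<^esub>} \<subseteq> Nvec r"
  using MXc_zero by blast

lemma tsum_closed: "y \<in> carrier B.F \<Longrightarrow> F \<in> MXc \<Longrightarrow> tsum y F \<in> carrier T.TP"
  unfolding tsum_def using supp_F[of F] MXc_D[of F] by (intro T.TP.finprod_closed Pi_I tens_cl) auto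

lemma tsum_add_right:
  assumes y: "y \<in> carrier B.F" and F: "F \<in> MXc" and F': "F' \<in> MXc"
  shows "tsum y (\<lambda>n. F n \<oplus>\<^bsub>M\<^esub> F' n) = tsum y F \<otimes>\<^bsub>T.TP\<^esub> tsum y F'"
proof -
  let ?D = "{n. F n \<noteq> \<zero>\<^bsub>M\<^esub>} \<union> {n. F' n \<noteq> \<zero>\<^bsub>M\<^esub>}"
  have D: "finite ?D" "?D \<subseteq> Nvec r" using MXc_finite F F' supp_F by auto
  have mem: "n \<in> ?D \<Longrightarrow> y \<otimes>\<^bsub>B.F\<^esub> x_over_one n \<in> carrier B.F" for n using D(2) y by auto
  have "tsum y (\<lambda>n. F n \<oplus>\<^bsub>M\<^esub> F' n) = (\<Otimes>\<^bsub>T.TP\<^esub>n\<in>?D. T.tens (y \<otimes>\<^bsub>B.F\<^esub> x_over_one n) (F n \<oplus>\<^bsub>M\<^esub> F' n))"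
    by (rule tsum_eq[OF y add_MXc[OF F F'] D]) auto
  also have "\<dots> = (\<Otimes>\<^bsub>T.TP\<^esub>n\<in>?D. T.tens (y \<otimes>\<^bsub>B.F\<^esub> x_over_one n) (F n) \<otimes>\<^bsub>T.TP\<^esub> T.tens (y \<otimes>\<^bsub>B.F\<^esub>
      x_over_one n) (F' n))"
    using mem MXc_D[OF F] MXc_D[OF F'] tens_cl T.tens_add_right by (intro T.TP.finprod_cong') auto
  also have "\<dots> = (\<Otimes>\<^bsub>T.TP\<^esub>n\<in>?D. T.tens (y \<otimes>\<^bsub>B.F\<^esub> x_over_one n) (F n)) \<otimes>\<^bsub>T.TP\<^esub> (\<Otimes>\<^bsub>T.TP\<^esub>n\<in>?D. T.tens
      (y \<otimes>\<^bsub>B.F\<^esub> x_over_one n) (F' n))"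
    using mem MXc_D[OF F] MXc_D[OF F'] tens_cl by (intro T.TP.finprod_multf) auto
  also have "\<dots> = tsum y F \<otimes>\<^bsub>T.TP\<^esub> tsum y F'"
    using tsum_eq[OF y F D] tsum_eq[OF y F' D] by auto
  finally show ?thesis .
qed

lemma tsum_add_left:
  assumes y: "y \<in> carrier B.F" "y' \<in> carrier B.F" and F: "F \<in> MXc"
  shows "tsum (y \<oplus>\<^bsub>B.F\<^esub> y') F = tsum y F \<otimes>\<^bsub>T.TP\<^esub> tsum y' F"
proof -
  let ?D = "{n. F n \<noteq> \<zero>\<^bsub>M\<^esub>}"
  have mem: "n \<in> ?D \<Longrightarrow> n \<in> Nvec r" for n using supp_F[OF F] by blast
  have "tsum (y \<oplus>\<^bsub>B.F\<^esub> y') F = (\<Otimes>\<^bsub>T.TP\<^esub>n\<in>?D. T.tens (y \<otimes>\<^bsub>B.F\<^esub> x_over_one n) (F n) \<otimes>\<^bsub>T.TP\<^esub> T.tens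
      (y' \<otimes>\<^bsub>B.F\<^esub> x_over_one n) (F n))"
    unfolding tsum_def using mem y MXc_D[OF F] tens_cl T.tens_add_left
    by (intro T.TP.finprod_cong') (auto simp: \<iota>.S.l_distr)
  also have "\<dots> = tsum y F \<otimes>\<^bsub>T.TP\<^esub> tsum y' F"
    unfolding tsum_def using mem y MXc_D[OF F] tens_cl by (intro T.TP.finprod_multf) auto
  finally show ?thesis .
qed

lemma tsum_zero_right [simp]: "tsum y (\<lambda>_. \<zero>\<^bsub>M\<^esub>) = \<one>\<^bsub>T.TP\<^esub>"
  by (simp add: tsum_def)

lemma tsum_zero_left: "F \<in> MXc \<Longrightarrow> tsum \<zero>\<^bsub>B.F\<^esub> F = \<one>\<^bsub>T.TP\<^esub>"
  using tsum_add_left[of "\<zero>\<^bsub>B.F\<^esub>" "\<zero>\<^bsub>B.F\<^esub>" F] tsum_closed[of "\<zero>\<^bsub>B.F\<^esub>" F] T.TP.l_cancel_one by simp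

lemma tsum_neg: "y \<in> carrier B.F \<Longrightarrow> F \<in> MXc \<Longrightarrow> tsum y (\<lambda>n. \<ominus>\<^bsub>M\<^esub> F n) = inv\<^bsub>T.TP\<^esub> tsum y F"
proof -
  assume y: "y \<in> carrier B.F" and F: "F \<in> MXc"
  have "tsum y (\<lambda>n. \<ominus>\<^bsub>M\<^esub> F n) \<otimes>\<^bsub>T.TP\<^esub> tsum y F = \<one>\<^bsub>T.TP\<^esub>"
    unfolding tsum_add_right[OF y neg_MXc[OF F] F, symmetric] using MXc_D[OF F]
        by (simp add: M.M.l_neg)
  then show ?thesis using tsum_closed[OF y F] tsum_closed[OF y neg_MXc[OF F]] T.TP.inv_equality
      by simp
qed

lemma tsum_delta:
  assumes y: "y \<in> carrier B.F" and n: "n \<in> Nvec r" and m: "m \<in> carrier M"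
  shows "tsum y (delta n m) = T.tens (y \<otimes>\<^bsub>B.F\<^esub> x_over_one n) m"
proof -
  have "tsum y (delta n m) = (\<Otimes>\<^bsub>T.TP\<^esub>k\<in>{n}. T.tens (y \<otimes>\<^bsub>B.F\<^esub> x_over_one k) (delta n m k))"
    using n by (intro tsum_eq[OF y delta_MXc[OF n m]]) (auto simp: delta_def)
  then show ?thesis using tens_cl[of "y \<otimes>\<^bsub>B.F\<^esub> x_over_one n" m] y n m by (simp add: delta_def)
qed

text \<open>Elements of \<open>S\<close> move across the tensor sign. By additivity only \<open>u\<close> of some degree \<open>d\<close> and a
  monomial have to be considered; then \<open>u\<close> acts on \<open>M\<close> through its coefficient, an element of
  \<open>A.F\<close>, and this coefficient times \<open>x d\<close> is \<open>u\<close>.\<close>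

lemma tsum_act:
  assumes y: "y \<in> carrier B.F" and u: "u \<in> carrier S" and F: "F \<in> MXc"
  shows "tsum y (act u F) = tsum (y \<otimes>\<^bsub>B.F\<^esub> over_one u) F"
  using F
proof (induction F rule: MX_induct)
  case zero
  then show ?case using u by simp
next
  case (add F F')
  then show ?case using u y act_closed by (simp add: act_add_right tsum_add_right)
next
  case (delta n m)
  show ?case using u
  proof (rule homogeneous_induct)
    show "tsum y (act \<zero> (delta n m)) = tsum (y \<otimes>\<^bsub>B.F\<^esub> over_one \<zero>) (delta n m)"
      using delta y by (simp add: over_one_zero tsum_zero_left)
  next
    fix u v assume uv: "u \<in> carrier S" "v \<in> carrier S" and
      "tsum y (act u (delta n m)) = tsum (y \<otimes>\<^bsub>B.F\<^esub> over_one u) (delta n m)"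
      "tsum y (act v (delta n m)) = tsum (y \<otimes>\<^bsub>B.F\<^esub> over_one v) (delta n m)"
    then show "tsum y (act (u \<oplus> v) (delta n m)) = tsum (y \<otimes>\<^bsub>B.F\<^esub> over_one (u \<oplus> v)) (delta n m)"
      using delta y act_closed[OF uv(1)] act_closed[OF uv(2)]
      by (simp add: act_add_left tsum_add_right over_one_add \<iota>.S.r_distr tsum_add_left)
  next
    fix d v assume d: "d \<in> Nvec r" and v: "v \<in> G d"
    have vc: "v \<in> carrier S" by (rule G_carrier[OF d v])
    have ph: "gcoef d v \<in> carrier A.F" "\<iota> (gcoef d v) \<in> carrier B.F" using vc by auto
    have xx: "x_over_one (deg_add d n) = x_over_one d \<otimes>\<^bsub>B.F\<^esub> x_over_one n"
      using x_carrier d delta(1) by (simp add: x_add over_one_mult)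
    have "tsum y (act v (delta n m)) = T.tens (y \<otimes>\<^bsub>B.F\<^esub> x_over_one (deg_add d n)) (gcoef d v \<odot>\<^bsub>M\<^esub>
        m)"
      unfolding act_delta[OF d v delta] using ph delta by (intro tsum_delta y Nvec_add d) auto
    also have "\<dots> = T.tens (gcoef d v \<odot>\<^bsub>N\<^esub> (y \<otimes>\<^bsub>B.F\<^esub> x_over_one (deg_add d n))) m"
      using y ph delta d by (intro T.tens_balanced[symmetric]) auto
    also have "gcoef d v \<odot>\<^bsub>N\<^esub> (y \<otimes>\<^bsub>B.F\<^esub> x_over_one (deg_add d n)) =
        y \<otimes>\<^bsub>B.F\<^esub> (\<iota> (gcoef d v) \<otimes>\<^bsub>B.F\<^esub> x_over_one d) \<otimes>\<^bsub>B.F\<^esub> x_over_one n"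
      using y ph d delta(1) unfolding xx N_simps by (simp add: \<iota>.S.m_ac)
    also have "\<dots> = y \<otimes>\<^bsub>B.F\<^esub> over_one v \<otimes>\<^bsub>B.F\<^esub> x_over_one n" by (simp only: over_one_gcoef[OF d v])
    also have "T.tens \<dots> m = tsum (y \<otimes>\<^bsub>B.F\<^esub> over_one v) (delta n m)"
      using y vc delta by (intro tsum_delta[symmetric]) auto
    finally show "tsum y (act v (delta n m)) = tsum (y \<otimes>\<^bsub>B.F\<^esub> over_one v) (delta n m)" .
  qed
qed

abbreviation "recip w \<equiv> B.cls \<one> w"

lemma recip_closed [simp]: "w \<in> UB \<Longrightarrow> recip w \<in> carrier B.F"
  by (intro B.cls_closed) auto

lemma recip_cancel: "u \<in> UB \<Longrightarrow> w \<in> UB \<Longrightarrow> recip (u \<otimes> w) \<otimes>\<^bsub>B.F\<^esub> over_one u = recip w"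
proof -
  assume u: "u \<in> UB" and w: "w \<in> UB"
  have q: "(\<one>, u \<otimes> w) \<in> QB" "(u, \<one>) \<in> QB" "(\<one>, w) \<in> QB" using u w mult_notin_p[of u w] one_notin_p
      by auto
  show "recip (u \<otimes> w) \<otimes>\<^bsub>B.F\<^esub> over_one u = recip w"
    unfolding B.cls_mult[OF q(1,2)] using B.Q_mult[OF q(1,2)] q(3) u w
    by (intro B.cls_eqI) (auto simp: m_ac)
qed

lemma tsum_rescale: "u \<in> UB \<Longrightarrow> w \<in> UB \<Longrightarrow> F \<in> MXc \<Longrightarrow> tsum (recip (u \<otimes> w)) (act u F) = tsum (recip w) F"
  using mult_notin_p[of u w] by (subst tsum_act) (auto simp: recip_cancel)

lemma x_over_one_zero: "x_over_one deg_zero = \<one>\<^bsub>B.F\<^esub>"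
  by (simp add: x_zero B.F_one)

text \<open>A pure tensor of \<open>s / t\<close> and \<open>m\<close> comes from the polynomial of the coefficients of \<open>s\<close> times
  \<open>m\<close>, with denominator \<open>t\<close>; sums are brought to a common denominator.\<close>

lemma tensor_rep:
  assumes "z \<in> carrier T.TP"
  obtains F w where "F \<in> MXc" "w \<in> UB" "z = tsum (recip w) F"
proof -
  have "\<exists>F w. F \<in> MXc \<and> w \<in> UB \<and> z = tsum (recip w) F" using assms
  proof (rule T.tensor_induct)
    show "\<exists>F w. F \<in> MXc \<and> w \<in> UB \<and> \<one>\<^bsub>T.TP\<^esub> = tsum (recip w) F"
      using one_notin_p by (intro exI[of _ "\<lambda>_. \<zero>\<^bsub>M\<^esub>"] exI[of _ \<one>]) auto
  next
    fix y m assume y: "y \<in> carrier N" and m: "m \<in> carrier M"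
    then obtain s t where st: "(s, t) \<in> QB" "y = B.cls s t" by (metis N_simps(1) B.F_cases)
    have s: "s \<in> carrier S" and t: "t \<in> UB" using st by auto
    have d: "delta deg_zero m \<in> MXc" using m by simp
    have "tsum (recip t) (act s (delta deg_zero m)) = tsum (recip t \<otimes>\<^bsub>B.F\<^esub> over_one s) (delta
        deg_zero m)"
      by (rule tsum_act[OF recip_closed[OF t] s d])
    also have "recip t \<otimes>\<^bsub>B.F\<^esub> over_one s = y" using B_split_denominator[of s t] st by auto
    also have "tsum y (delta deg_zero m) = T.tens y m"
      using y by (subst tsum_delta[OF _ Nvec_zero m]) (auto simp: x_over_one_zero)
    finally show "\<exists>F w. F \<in> MXc \<and> w \<in> UB \<and> T.tens y m = tsum (recip w) F"
      using act_closed[OF s d] t by metis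
  next
    fix a b assume "\<exists>F w. F \<in> MXc \<and> w \<in> UB \<and> a = tsum (recip w) F" "\<exists>F w. F \<in> MXc \<and> w \<in> UB \<and> b =
        tsum (recip w) F"
    then obtain F w F' w' where F: "F \<in> MXc" "w \<in> UB" "a = tsum (recip w) F"
        and F': "F' \<in> MXc" "w' \<in> UB" "b = tsum (recip w') F'" by blast
    have ww: "w' \<otimes> w \<in> UB" "w \<otimes> w' = w' \<otimes> w" using F F' mult_notin_p by (auto simp: m_comm)
    have wc: "w \<in> carrier S" "w' \<in> carrier S" using F F' by auto
    have a: "a = tsum (recip (w' \<otimes> w)) (act w' F)" unfolding F(3)
        by (rule tsum_rescale[OF F'(2) F(2,1), symmetric])
    have b: "b = tsum (recip (w' \<otimes> w)) (act w F')"
      unfolding F'(3) ww(2)[symmetric] by (rule tsum_rescale[OF F(2) F'(2,1), symmetric])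
    have "a \<otimes>\<^bsub>T.TP\<^esub> inv\<^bsub>T.TP\<^esub> b = tsum (recip (w' \<otimes> w)) (\<lambda>n. act w' F n \<oplus>\<^bsub>M\<^esub> (\<ominus>\<^bsub>M\<^esub> act w F' n))"
      unfolding a b using tsum_neg[OF recip_closed[OF ww(1)] act_closed[OF wc(1) F'(1)]]
       tsum_add_right[OF recip_closed[OF ww(1)] act_closed[OF wc(2) F(1)] neg_MXc[OF act_closed[OF
           wc(1) F'(1)]]] by simp
    moreover have "(\<lambda>n. act w' F n \<oplus>\<^bsub>M\<^esub> (\<ominus>\<^bsub>M\<^esub> act w F' n)) \<in> MXc"
      by (intro add_MXc neg_MXc act_closed wc F(1) F'(1))
    ultimately show "\<exists>F w. F \<in> MXc \<and> w \<in> UB \<and> a \<otimes>\<^bsub>T.TP\<^esub> inv\<^bsub>T.TP\<^esub> b = tsum (recip w) F"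
        using ww(1) by blast
  qed
  then show thesis using that by blast
qed

text \<open>The balanced map \<open>(s / t, m) \<mapsto> (s \<cdot> m) / t\<close> that detects zero in the tensor product, where
  \<open>s \<cdot> m\<close> is \<open>s\<close> acting on the constant polynomial \<open>m\<close>. The choice of a representative is
  immaterial by \<open>beta_cls\<close>.\<close>

definition beta :: "('a \<times> 'a) set \<Rightarrow> 'm \<Rightarrow> ((mdeg \<Rightarrow> 'm) \<times> 'a) set" where
  "beta y m = (let (s, t) = (SOME (s, t). (s, t) \<in> QB \<and> y = B.cls s t)
      in L.cls (act s (delta deg_zero m)) t)"

lemma beta_cls:
  assumes st: "(s, t) \<in> QB" and m: "m \<in> carrier M"
  shows "beta (B.cls s t) m = L.cls (act s (delta deg_zero m)) t"
proof -
  let ?P = "\<lambda>(s', t'). (s', t') \<in> QB \<and> B.cls s t = B.cls s' t'"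
  have "?P (s, t)" unfolding prod.case by (rule conjI[OF st refl])
  then have P: "?P (Eps ?P)" by (rule someI[of ?P])
  obtain s' t' where q1: "Eps ?P = (s', t')" by (rule prod.exhaust)
  from P have q23: "(s', t') \<in> QB" "B.cls s t = B.cls s' t'" unfolding q1 prod.case by blast+
  note q = q1 q23
  have d: "delta deg_zero m \<in> MXc" using m by simp
  from q(2,3) st obtain u where u: "u \<in> UB" "u \<otimes> (t' \<otimes> s) = u \<otimes> (t \<otimes> s')"
      by (auto simp: B.cls_eq_iff)
  have c: "s \<in> carrier S" "t \<in> carrier S" "s' \<in> carrier S" "t' \<in> carrier S" "u \<in> carrier S"
      using st q u by auto
  have "act u (act t' (act s (delta deg_zero m))) = act (u \<otimes> (t' \<otimes> s)) (delta deg_zero m)"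
    using c d by (simp add: act_assoc act_closed)
  also have "\<dots> = act u (act t (act s' (delta deg_zero m)))"
    unfolding u(2) using c d by (simp add: act_assoc act_closed)
  finally have "L.cls (act s (delta deg_zero m)) t = L.cls (act s' (delta deg_zero m)) t'"
    using u(1) st q(2) c d act_closed by (subst L.cls_eq_iff) auto
  then show ?thesis unfolding beta_def q(1) Let_def prod.case by (rule sym)
qed

lemma delta_add: "m \<in> carrier M \<Longrightarrow> m' \<in> carrier M \<Longrightarrow> delta n (m \<oplus>\<^bsub>M\<^esub> m') =
    (\<lambda>l. delta n m l \<oplus>\<^bsub>M\<^esub> delta n m' l)"
  by (auto simp: delta_def)

lemma QL_I: "F \<in> MXc \<Longrightarrow> t \<in> UB \<Longrightarrow> (F, t) \<in> QL" by auto

lemma L_cls_add_same: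
  assumes "F \<in> MXc" "F' \<in> MXc" "t \<in> UB"
  shows "L.cls (\<lambda>l. F l \<oplus>\<^bsub>M\<^esub> F' l) t = L.cls F t \<oplus>\<^bsub>L.F\<^esub> L.cls F' t"
proof -
  have t: "t \<in> carrier S" using assms by simp
  have "act (t \<otimes> t) (\<lambda>l. F l \<oplus>\<^bsub>M\<^esub> F' l) = act t (\<lambda>n. act t F n \<oplus>\<^bsub>M\<^esub> act t F' n)"
    using assms t by (simp add: act_assoc act_add_right act_closed)
  then show ?thesis using assms t L.Q_add[OF QL_I[OF assms(1,3)] QL_I[OF assms(2,3)]]
    unfolding L.cls_add[OF QL_I[OF assms(1,3)] QL_I[OF assms(2,3)]] by (intro L.cls_eqI) auto
qed

text \<open>Balancedness over \<open>A.F\<close>, for \<open>a = b / c\<close> with \<open>b\<close> and \<open>c\<close> of the same degree \<open>e\<close>, comes down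
  to \<open>b \<cdot> m = c \<cdot> (a m)\<close> in \<open>M[X]\<close>. Both sides are monomials of exponent \<open>e\<close>, and \<open>(c / x e) a = b
  / x e\<close>.\<close>

lemma tensor_to_L:
  obtains h where "h \<in> hom T.TP (add_monoid L.F)"
    "\<And>y m. y \<in> carrier B.F \<Longrightarrow> m \<in> carrier M \<Longrightarrow> h (T.tens y m) = beta y m"
proof -
  interpret L: abelian_group L.F by (rule L.F_abelian_group)
  have cl: "beta y m \<in> carrier L.F" if y: "y \<in> carrier B.F" and m: "m \<in> carrier M" for y m
  proof -
    obtain s t where st: "(s, t) \<in> QB" "y = B.cls s t" using y by (metis B.F_cases)
    show ?thesis unfolding st(2) beta_cls[OF st(1) m] using st m
        by (intro L.cls_closed QL_I act_closed) auto
  qed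
  have al: "beta (y \<oplus>\<^bsub>B.F\<^esub> y') m = beta y m \<oplus>\<^bsub>L.F\<^esub> beta y' m"
    if y: "y \<in> carrier B.F" "y' \<in> carrier B.F" and m: "m \<in> carrier M" for y y' m
  proof -
    obtain s t where st: "(s, t) \<in> QB" "y = B.cls s t" using y by (metis B.F_cases)
    obtain s' t' where st': "(s', t') \<in> QB" "y' = B.cls s' t'" using y by (metis B.F_cases)
    have c: "s \<in> carrier S" "s' \<in> carrier S" "t \<in> carrier S" "t' \<in> carrier S" using st st' by auto
    have d: "delta deg_zero m \<in> MXc" using m by simp
    have q: "(act s (delta deg_zero m), t) \<in> QL" "(act s' (delta deg_zero m), t') \<in> QL"
      using st st' d act_closed by auto
    have "(t' \<otimes> s \<oplus> t \<otimes> s', t \<otimes> t') \<in> QB" using B.Q_add[OF st(1) st'(1)] by simp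
    then show ?thesis
      unfolding st(2) st'(2) B.cls_add[OF st(1) st'(1)] beta_cls[OF st(1) m] beta_cls[OF st'(1) m]
          L.cls_add[OF q]
      using beta_cls m c d by (simp add: act_add_left act_assoc)
  qed
  have ar: "beta y (m \<oplus>\<^bsub>M\<^esub> m') = beta y m \<oplus>\<^bsub>L.F\<^esub> beta y m'"
    if y: "y \<in> carrier B.F" and m: "m \<in> carrier M" "m' \<in> carrier M" for y m m'
  proof -
    obtain s t where st: "(s, t) \<in> QB" "y = B.cls s t" using y by (metis B.F_cases)
    have c: "s \<in> carrier S" "t \<in> UB" using st by auto
    have d: "delta deg_zero m \<in> MXc" "delta deg_zero m' \<in> MXc" using m by simp_all
    show ?thesis unfolding st(2) beta_cls[OF st(1) m(1)] beta_cls[OF st(1) m(2)]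
        beta_cls[OF st(1) M.M.a_closed[OF m]] delta_add[OF m] act_add_right[OF c(1) d]
      by (rule L_cls_add_same[OF act_closed[OF c(1) d(1)] act_closed[OF c(1) d(2)] c(2)])
  qed
  have bal: "beta (\<iota> a \<otimes>\<^bsub>B.F\<^esub> y) m = beta y (a \<odot>\<^bsub>M\<^esub> m)"
    if a: "a \<in> carrier A.F" and y: "y \<in> carrier B.F" and m: "m \<in> carrier M" for a y m
  proof -
    obtain s t where st: "(s, t) \<in> QB" "y = B.cls s t" using y by (metis B.F_cases)
    obtain b c where bc: "(b, c) \<in> QA" "a = A.cls b c" using a by (metis A.F_cases)
    then obtain e where e: "e \<in> Nvec r" "b \<in> G e" "c \<in> G e" "c \<notin> p" "b \<in> carrier S" "c \<in>
        carrier S" by (metis QA_E)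
    have am: "a \<odot>\<^bsub>M\<^esub> m \<in> carrier M" using a m by simp
    have d: "delta deg_zero m \<in> MXc" "delta deg_zero (a \<odot>\<^bsub>M\<^esub> m) \<in> MXc" using m am by simp_all
    have bcB: "(b, c) \<in> QB" using e by simp
    have cst: "s \<in> carrier S" "t \<in> UB" "t \<in> carrier S" using st by auto
    have q1: "(c, x e) \<in> QA" "(b, x e) \<in> QA" using e QA_x by auto
    have "gcoef e c \<otimes>\<^bsub>A.F\<^esub> a = gcoef e b"
      unfolding gcoef_homog[OF e(1,2)] gcoef_homog[OF e(1,3)] bc(2) A.cls_mult[OF q1(1) bc(1)]
      using A.Q_mult[OF q1(1) bc(1)] q1(2) e x_carrier[OF e(1)]
          by (intro A.cls_eqI) (auto simp: m_ac)
    then have ph: "gcoef e c \<odot>\<^bsub>M\<^esub> (a \<odot>\<^bsub>M\<^esub> m) = gcoef e b \<odot>\<^bsub>M\<^esub> m"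
      using a m e by (subst M.smult_assoc1[symmetric]) auto
    have key: "act b (delta deg_zero m) = act c (delta deg_zero (a \<odot>\<^bsub>M\<^esub> m))"
      unfolding act_delta[OF e(1,2) Nvec_zero m] act_delta[OF e(1,3) Nvec_zero am] ph ..
    have "act (b \<otimes> s) (delta deg_zero m) = act s (act b (delta deg_zero m))"
      using e cst d by (simp add: m_comm[of b s] act_assoc)
    also have "\<dots> = act c (act s (delta deg_zero (a \<odot>\<^bsub>M\<^esub> m)))"
      unfolding key using e cst d by (simp add: act_assoc[symmetric] m_comm)
    finally have k2: "act (b \<otimes> s) (delta deg_zero m) = act c (act s (delta deg_zero (a \<odot>\<^bsub>M\<^esub> m)))" .
    have "beta (\<iota> a \<otimes>\<^bsub>B.F\<^esub> y) m = L.cls (act (b \<otimes> s) (delta deg_zero m)) (c \<otimes> t)"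
      unfolding bc(2) \<iota>_cls[OF bc(1)] st(2) B.cls_mult[OF bcB st(1)]
      by (rule beta_cls[OF B.Q_mult[OF bcB st(1)] m])
    also have "\<dots> = L.cls (act s (delta deg_zero (a \<odot>\<^bsub>M\<^esub> m))) t"
      unfolding k2 using e cst d act_closed mult_notin_p[of c t]
      by (intro L.cls_eqI) (auto simp: act_assoc[symmetric] m_ac)
    also have "\<dots> = beta y (a \<odot>\<^bsub>M\<^esub> m)" unfolding st(2) by (rule beta_cls[OF st(1) am, symmetric])
    finally show ?thesis .
  qed
  obtain h where h: "h \<in> hom T.TP (add_monoid L.F)"
    "\<And>y m. y \<in> carrier N \<Longrightarrow> m \<in> carrier M \<Longrightarrow> h (T.tens y m) = beta y m"
  proof (rule T.tensor_universal[of "add_monoid L.F" beta])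
    show "comm_group (add_monoid L.F)" by (rule L.a_comm_group)
  qed (use cl al ar bal in simp_all)
  then show thesis using that[of h] by simp
qed

text \<open>So \<open>S\<^sub>p \<otimes> M\<close> is the localization of \<open>M[X]\<close> at \<open>p\<close>: the homomorphism of \<open>tensor_to_L\<close> maps
  the element represented by \<open>F\<close> and \<open>w\<close> to the fraction \<open>F / w\<close>.\<close>

lemma tensor_zero_iff:
  assumes F: "F \<in> MXc" and w: "w \<in> UB"
  shows "tsum (recip w) F = \<one>\<^bsub>T.TP\<^esub> \<longleftrightarrow> (\<exists>u\<in>UB. act u F = (\<lambda>_. \<zero>\<^bsub>M\<^esub>))"
proof
  assume "\<exists>u\<in>UB. act u F = (\<lambda>_. \<zero>\<^bsub>M\<^esub>)"
  then show "tsum (recip w) F = \<one>\<^bsub>T.TP\<^esub>" using tsum_rescale[OF _ w F] by (metis tsum_zero_right)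
next
  assume k: "tsum (recip w) F = \<one>\<^bsub>T.TP\<^esub>"
  obtain h where h: "h \<in> hom T.TP (add_monoid L.F)"
    "\<And>y m. y \<in> carrier B.F \<Longrightarrow> m \<in> carrier M \<Longrightarrow> h (T.tens y m) = beta y m" by (rule tensor_to_L) blast
  interpret L: abelian_group L.F by (rule L.F_abelian_group)
  interpret h: group_hom T.TP "add_monoid L.F" h
    using h(1) L.a_group T.TP.group_axioms by (simp add: group_hom_def group_hom_axioms_def)
  have h1: "h \<one>\<^bsub>T.TP\<^esub> = \<zero>\<^bsub>L.F\<^esub>" using h.hom_one by simp
  have z: "L.cls (\<lambda>_. \<zero>\<^bsub>M\<^esub>) t = \<zero>\<^bsub>L.F\<^esub>" if "t \<in> UB" for t
    unfolding L.F_zero using that one_notin_p by (simp, intro L.cls_eqI) auto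
  have "h (tsum (recip w) F) = L.cls F w" using F
  proof (induction F rule: MX_induct)
    case zero
    then show ?case using z[OF w] h1 by simp
  next
    case (add F F')
    have "h (tsum (recip w) (\<lambda>n. F n \<oplus>\<^bsub>M\<^esub> F' n)) = h (tsum (recip w) F) \<oplus>\<^bsub>L.F\<^esub> h (tsum (recip w)
        F')"
      using h.hom_mult[OF tsum_closed[OF recip_closed[OF w] add(1)] tsum_closed[OF recip_closed[OF
          w] add(2)]]
      unfolding tsum_add_right[OF recip_closed[OF w] add(1,2)] by simp
    then show ?case unfolding L_cls_add_same[OF add(1,2) w] using add by simp
  next
    case (delta n m)
    have xc: "x n \<in> carrier S" by (rule x_carrier[OF delta(1)])
    have q: "(\<one>, w) \<in> QB" "(x n, \<one>) \<in> QB" "(x n, w) \<in> QB" using w xc one_notin_p by auto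
    have "tsum (recip w) (delta n m) = T.tens (B.cls (x n) w) m"
      unfolding tsum_delta[OF recip_closed[OF w] delta] B.cls_mult[OF q(1,2)] using xc w by simp
    then have "h (tsum (recip w) (delta n m)) = beta (B.cls (x n) w) m"
      using h(2)[OF B.cls_closed[OF q(3)] delta(2)] by simp
    also have "\<dots> = L.cls (act (x n) (delta deg_zero m)) w" by (rule beta_cls[OF q(3) delta(2)])
    also have "act (x n) (delta deg_zero m) = delta n m"
      unfolding act_delta[OF delta(1) x_G[OF delta(1)] Nvec_zero delta(2)] using delta
          by (simp add: gcoef_x)
    finally show ?case .
  qed
  then have "L.cls F w = L.cls \<zero>\<^bsub>MX\<^esub> \<one>" using k h1 by (simp add: L.F_zero)
  then show "\<exists>u\<in>UB. act u F = (\<lambda>_. \<zero>\<^bsub>M\<^esub>)" using L.cls_zero_iff[OF QL_I[OF F w]] by simp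
qed

end

section \<open>Faithful flatness\<close>

locale flat_morphism = F1: flat_module S r G p x M1 + F2: flat_module S r G p x M2
  for S :: "('a, 's) ring_scheme" (structure) and r G p x
    and M1 :: "(('a \<times> 'a) set, 'm) module" and M2 :: "(('a \<times> 'a) set, 'm2) module" +
  fixes f assumes f: "f \<in> linear_maps F1.A.F M1 M2"
begin

sublocale tf: tensor_functor F1.A.F F1.N M1 M2 f
  by (intro tensor_functor.intro tensor_functor_axioms.intro F1.T.two_modules_axioms
      F2.T.two_modules_axioms f)

lemma f_zero: "f \<zero>\<^bsub>M1\<^esub> = \<zero>\<^bsub>M2\<^esub>"
  using tf.f_smult[of "\<zero>\<^bsub>F1.A.F\<^esub>" "\<zero>\<^bsub>M1\<^esub>"] by simp

lemma comp_MXc: "F \<in> F1.MXc \<Longrightarrow> (\<lambda>n. f (F n)) \<in> F2.MXc"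
proof (rule F2.MXcI)
  assume F: "F \<in> F1.MXc"
  show "f (F n) \<in> carrier M2" for n by (rule tf.f_closed[OF F1.MXc_D[OF F]])
  show "n \<notin> Nvec r \<Longrightarrow> f (F n) = \<zero>\<^bsub>M2\<^esub>" for n using F1.MXc_zero[OF F] f_zero by simp
  have "{n. f (F n) \<noteq> \<zero>\<^bsub>M2\<^esub>} \<subseteq> {n. F n \<noteq> \<zero>\<^bsub>M1\<^esub>}" using f_zero by auto
  then show "finite {n. f (F n) \<noteq> \<zero>\<^bsub>M2\<^esub>}" by (rule finite_subset[OF _ F1.MXc_finite[OF F]])
qed

lemma f_delta: "(\<lambda>l. f (F1.delta n m l)) = F2.delta n (f m)"
  using f_zero by (auto simp: F1.delta_def F2.delta_def)

lemma tensor_map_tsum: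
  assumes y: "y \<in> carrier F1.B.F" and F: "F \<in> F1.MXc"
  shows "tensor_map F1.A.F F1.N M2 f (F1.tsum y F) = F2.tsum y (\<lambda>n. f (F n))"
proof -
  interpret h: group_hom F1.T.TP F2.T.TP "tensor_map F1.A.F F1.N M2 f"
    using tf.tensor_map_hom F1.T.TP.group_axioms F2.T.TP.group_axioms
        by (simp add: group_hom_def group_hom_axioms_def)
  show ?thesis using F
  proof (induction F rule: F1.MX_induct)
    case zero
    then show ?case using h.hom_one f_zero by simp
  next
    case (add F F')
    have "(\<lambda>n. f (F n \<oplus>\<^bsub>M1\<^esub> F' n)) = (\<lambda>n. f (F n) \<oplus>\<^bsub>M2\<^esub> f (F' n))"
      by (rule ext) (rule tf.f_add[OF F1.MXc_D[OF add(1)] F1.MXc_D[OF add(2)]])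
    then show ?case
      unfolding F1.tsum_add_right[OF y add(1,2)] h.hom_mult[OF F1.tsum_closed[OF y add(1)]
          F1.tsum_closed[OF y add(2)]] add(3,4)
      using F2.tsum_add_right[OF y comp_MXc[OF add(1)] comp_MXc[OF add(2)]] by simp
  next
    case (delta n m)
    have yx: "y \<otimes>\<^bsub>F1.B.F\<^esub> F1.x_over_one n \<in> carrier F1.N" using y delta by simp
    show ?case unfolding F1.tsum_delta[OF y delta] f_delta F2.tsum_delta[OF y delta(1)
        tf.f_closed[OF delta(2)]]
      by (rule tf.tensor_map_tens[OF yx delta(2)])
  qed
qed

lemma act_comp:
  assumes u: "u \<in> carrier S" and F: "F \<in> F1.MXc"
  shows "F2.act u (\<lambda>n. f (F n)) = (\<lambda>n. f (F1.act u F n))"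
  using u
proof (rule F1.homogeneous_induct)
  show "F2.act \<zero> (\<lambda>n. f (F n)) = (\<lambda>n. f (F1.act \<zero> F n))"
    using F comp_MXc[OF F] f_zero by simp
next
  fix d v assume d: "d \<in> Nvec r" and v: "v \<in> G d"
  have vc: "v \<in> carrier S" by (rule F1.G_carrier[OF d v])
  show "F2.act v (\<lambda>n. f (F n)) = (\<lambda>n. f (F1.act v F n))"
    unfolding F1.act_homog[OF d v F] F2.act_homog[OF d v comp_MXc[OF F]] fun_eq_iff
    using tf.f_smult[OF F1.gcoef_closed[OF vc] F1.MXc_D[OF F]] by simp
next
  fix u v assume uv: "u \<in> carrier S" "v \<in> carrier S"
    and e: "F2.act u (\<lambda>n. f (F n)) = (\<lambda>n. f (F1.act u F n))" "F2.act v (\<lambda>n. f (F n)) =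
        (\<lambda>n. f (F1.act v F n))"
  show "F2.act (u \<oplus> v) (\<lambda>n. f (F n)) = (\<lambda>n. f (F1.act (u \<oplus> v) F n))"
    unfolding F1.act_add_left[OF uv F] F2.act_add_left[OF uv comp_MXc[OF F]] e fun_eq_iff
    using tf.f_add[OF F1.act_closed_pt[OF uv(1) F] F1.act_closed_pt[OF uv(2) F]] by simp
qed

end

text \<open>As \<open>p\<close> is homogeneous, \<open>u\<close> has a component outside \<open>p\<close>, whose coefficient is a unit of
  \<open>A.F\<close>. This is what makes the localized polynomial modules remember \<open>M\<close>; applied with \<open>K = {0}\<close>
  and with \<open>K\<close> an image.\<close>

lemma (in flat_module) act_values_unit:
  assumes u: "u \<in> UB" and m: "m \<in> carrier M"
    and K: "\<And>a y. a \<in> carrier A.F \<Longrightarrow> y \<in> K \<Longrightarrow> a \<odot>\<^bsub>M\<^esub> y \<in> K"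
    and h: "\<And>l. act u (delta deg_zero m) l \<in> K"
  shows "m \<in> K"
proof -
  have uc: "u \<in> carrier S" "u \<notin> p" using u by auto
  obtain d where d: "d \<in> Nvec r" "hcomp d u \<notin> p"
    using homogeneous_mem_iff[OF p.is_ideal _ uc(1)] p_homog uc(2) by blast
  have dl: "delta deg_zero m \<in> MXc" using m by simp
  \<comment> \<open>The index set is enlarged by \<open>d\<close>, which makes it contain the only nonzero summand.\<close>
  have "act u (delta deg_zero m) d = (\<Oplus>\<^bsub>M\<^esub>e\<in>insert d (supp u). gcoef e u \<odot>\<^bsub>M\<^esub> delta deg_zero m
      (\<lambda>i. d i - e i))"
    using uc by (intro act_eq_sum dl) auto
  also have "\<dots> = (\<Oplus>\<^bsub>M\<^esub>e\<in>insert d (supp u). if d = e then gcoef e u \<odot>\<^bsub>M\<^esub> m else \<zero>\<^bsub>M\<^esub>)"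
    using m uc by (intro M.M.finsum_cong') (auto simp: delta_def fun_eq_iff)
  also have "\<dots> = gcoef d u \<odot>\<^bsub>M\<^esub> m"
    using m uc by (intro M.M.add.finprod_singleton) auto
  finally have pK: "gcoef d u \<odot>\<^bsub>M\<^esub> m \<in> K" using h[of d] by simp
  obtain b where b: "b \<in> carrier A.F" "b \<otimes>\<^bsub>A.F\<^esub> gcoef d u = \<one>\<^bsub>A.F\<^esub>"
      using gcoef_unit[OF d(1) uc(1) d(2)] .
  have "b \<odot>\<^bsub>M\<^esub> (gcoef d u \<odot>\<^bsub>M\<^esub> m) \<in> K" by (rule K[OF b(1) pK])
  moreover have "b \<odot>\<^bsub>M\<^esub> (gcoef d u \<odot>\<^bsub>M\<^esub> m) = m"
    using M.smult_assoc1[OF b(1) gcoef_closed[OF uc(1), of d] m] b(2) m by simp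
  ultimately show ?thesis by simp
qed

locale flat_sequence = f: flat_morphism S r G p x M1 M2 f + g: flat_morphism S r G p x M2 M3 g
  for S :: "('a, 's) ring_scheme" (structure) and r G p x
    and M1 :: "(('a \<times> 'a) set, 'm) module" and M2 :: "(('a \<times> 'a) set, 'm2) module"
    and M3 :: "(('a \<times> 'a) set, 'm3) module" and f g
begin

abbreviation "tm_f \<equiv> tensor_map f.F1.A.F f.F1.N M2 f"
abbreviation "tm_g \<equiv> tensor_map f.F1.A.F f.F1.N M3 g"

text \<open>Let \<open>F / w\<close> represent an element killed by \<open>g\<close>. Then some \<open>u\<close> outside \<open>p\<close> makes \<open>g\<close> kill all
  values of \<open>u F\<close>, so \<open>u F\<close> lifts along \<open>f\<close> value by value, and \<open>F / w = u F / u w\<close>.\<close>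

lemma exact_imp_tensor_exact:
  assumes ex: "f ` carrier M1 = a_kernel M2 M3 g"
  shows "tm_f ` carrier f.F1.T.TP = kernel f.F2.T.TP g.F2.T.TP tm_g"
proof (intro equalityI subsetI)
  fix z assume "z \<in> tm_f ` carrier f.F1.T.TP"
  then obtain c where c: "c \<in> carrier f.F1.T.TP" "z = tm_f c" by blast
  obtain F w where F: "F \<in> f.F1.MXc" "w \<in> f.F1.UB" "c = f.F1.tsum (f.F1.recip w) F"
      by (rule f.F1.tensor_rep[OF c(1)])
  have recip: "f.F1.recip w \<in> carrier f.F1.B.F" by (rule f.F1.recip_closed[OF F(2)])
  have z: "z = f.F2.tsum (f.F1.recip w) (\<lambda>n. f (F n))" unfolding c F(3)
      by (rule f.tensor_map_tsum[OF recip F(1)])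
  have "g (f (F n)) = \<zero>\<^bsub>M3\<^esub>" for n
    using ex f.F1.MXc_D[OF F(1), of n] by (auto simp: a_kernel_def')
  then have "tm_g z = \<one>\<^bsub>g.F2.T.TP\<^esub>"
    unfolding z using g.tensor_map_tsum[OF recip f.comp_MXc[OF F(1)]] by simp
  moreover have "z \<in> carrier f.F2.T.TP" unfolding z
      by (rule f.F2.tsum_closed[OF recip f.comp_MXc[OF F(1)]])
  ultimately show "z \<in> kernel f.F2.T.TP g.F2.T.TP tm_g" unfolding kernel_def by blast
next
  fix z assume "z \<in> kernel f.F2.T.TP g.F2.T.TP tm_g"
  then have z: "z \<in> carrier f.F2.T.TP" "tm_g z = \<one>\<^bsub>g.F2.T.TP\<^esub>" by (auto simp: kernel_def)
  obtain F w where F: "F \<in> f.F2.MXc" "w \<in> f.F1.UB" "z = f.F2.tsum (f.F1.recip w) F"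
      by (rule f.F2.tensor_rep[OF z(1)])
  have recip: "f.F1.recip w \<in> carrier f.F1.B.F" by (rule f.F1.recip_closed[OF F(2)])
  have "g.F2.tsum (f.F1.recip w) (\<lambda>n. g (F n)) = \<one>\<^bsub>g.F2.T.TP\<^esub>"
    using z(2) unfolding F(3) g.tensor_map_tsum[OF recip F(1)] .
  then obtain u where u: "u \<in> f.F1.UB" "g.F2.act u (\<lambda>n. g (F n)) = (\<lambda>_. \<zero>\<^bsub>M3\<^esub>)"
    using g.F2.tensor_zero_iff[OF g.comp_MXc[OF F(1)] F(2)] by blast
  have uc: "u \<in> carrier S" using u by simp
  have aF: "f.F2.act u F \<in> f.F2.MXc" by (rule f.F2.act_closed[OF uc F(1)])
  have "g (f.F2.act u F n) = \<zero>\<^bsub>M3\<^esub>" for n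
    using g.act_comp[OF uc F(1)] u(2) by (metis (no_types))
  then have "f.F2.act u F n \<in> f ` carrier M1" for n
    unfolding ex a_kernel_def' using f.F2.MXc_D[OF aF] by blast
  then have "\<exists>m\<in>carrier M1. f.F2.act u F n = f m" for n by blast
  then obtain c where c: "\<And>n. c n \<in> carrier M1" "\<And>n. f.F2.act u F n = f (c n)" by metis
  define F' where "F' n = (if f.F2.act u F n = \<zero>\<^bsub>M2\<^esub> then \<zero>\<^bsub>M1\<^esub> else c n)" for n
  have fF': "f.F2.act u F = (\<lambda>n. f (F' n))" using c f.f_zero by (auto simp: F'_def)
  have F': "F' \<in> f.F1.MXc"
  proof (rule f.F1.MXcI)
    show "F' n \<in> carrier M1" for n using c by (simp add: F'_def)
    show "n \<notin> Nvec r \<Longrightarrow> F' n = \<zero>\<^bsub>M1\<^esub>" for n using f.F2.MXc_zero[OF aF] by (simp add: F'_def)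
    have "{n. F' n \<noteq> \<zero>\<^bsub>M1\<^esub>} \<subseteq> {n. f.F2.act u F n \<noteq> \<zero>\<^bsub>M2\<^esub>}" by (auto simp: F'_def)
    then show "finite {n. F' n \<noteq> \<zero>\<^bsub>M1\<^esub>}" by (rule finite_subset[OF _ f.F2.MXc_finite[OF aF]])
  qed
  have uw: "u \<otimes> w \<in> f.F1.UB" using u(1) F(2) f.F1.mult_notin_p by auto
  have iuw: "f.F1.recip (u \<otimes> w) \<in> carrier f.F1.B.F" by (rule f.F1.recip_closed[OF uw])
  have "z = f.F2.tsum (f.F1.recip (u \<otimes> w)) (f.F2.act u F)"
    unfolding F(3) by (rule f.F2.tsum_rescale[OF u(1) F(2,1), symmetric])
  also have "\<dots> = tm_f (f.F1.tsum (f.F1.recip (u \<otimes> w)) F')"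
    unfolding fF' by (rule f.tensor_map_tsum[OF iuw F', symmetric])
  finally show "z \<in> tm_f ` carrier f.F1.T.TP" using f.F1.tsum_closed[OF iuw F'] by blast
qed

lemma one_UB: "\<one> \<in> f.F1.UB"
  using f.F1.one_notin_p by simp

text \<open>Both inclusions are tested on \<open>1 \<otimes> m\<close>, that is on constant polynomials. A relation in the
  tensor product becomes a relation between polynomials after multiplication with elements outside
  \<open>p\<close>, and \<open>act_values_unit\<close> brings it back to \<open>m\<close>.\<close>

lemma tensor_exact_imp_exact:
  assumes ex: "tm_f ` carrier f.F1.T.TP = kernel f.F2.T.TP g.F2.T.TP tm_g"
  shows "f ` carrier M1 = a_kernel M2 M3 g"
proof (intro equalityI subsetI)
  have i1: "f.F1.recip \<one> \<in> carrier f.F1.B.F" by (rule f.F1.recip_closed[OF one_UB])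
  fix y assume "y \<in> f ` carrier M1"
  then obtain m where m: "m \<in> carrier M1" "y = f m" by blast
  have d: "f.F1.delta deg_zero m \<in> f.F1.MXc" using m by simp
  have "tm_f (f.F1.tsum (f.F1.recip \<one>) (f.F1.delta deg_zero m)) \<in> kernel f.F2.T.TP g.F2.T.TP tm_g"
    using ex f.F1.tsum_closed[OF i1 d] by blast
  then have "tm_g (f.F2.tsum (f.F1.recip \<one>) (f.F2.delta deg_zero y)) = \<one>\<^bsub>g.F2.T.TP\<^esub>"
    unfolding f.tensor_map_tsum[OF i1 d] f.f_delta m(2) by (simp add: kernel_def)
  then have k: "g.F2.tsum (f.F1.recip \<one>) (g.F2.delta deg_zero (g y)) = \<one>\<^bsub>g.F2.T.TP\<^esub>"
    using g.tensor_map_tsum[OF i1, of "f.F2.delta deg_zero y"] f.comp_MXc[OF d]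
        unfolding f.f_delta g.f_delta m(2)[symmetric] by simp
  have y: "y \<in> carrier M2" "g y \<in> carrier M3" using m by simp_all
  have d3: "g.F2.delta deg_zero (g y) \<in> g.F2.MXc" using y by simp
  obtain u where u: "u \<in> f.F1.UB" "g.F2.act u (g.F2.delta deg_zero (g y)) = (\<lambda>_. \<zero>\<^bsub>M3\<^esub>)"
    using k g.F2.tensor_zero_iff[OF d3 one_UB] by blast
  have "g y \<in> {\<zero>\<^bsub>M3\<^esub>}"
    by (rule g.F2.act_values_unit[OF u(1) y(2)]) (simp_all add: u(2))
  then show "y \<in> a_kernel M2 M3 g" using y by (simp add: a_kernel_def')
next
  have i1: "f.F1.recip \<one> \<in> carrier f.F1.B.F" by (rule f.F1.recip_closed[OF one_UB])
  fix m assume "m \<in> a_kernel M2 M3 g"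
  then have m: "m \<in> carrier M2" "g m = \<zero>\<^bsub>M3\<^esub>" by (auto simp: a_kernel_def')
  have d: "f.F2.delta deg_zero m \<in> f.F2.MXc" using m by simp
  have z0: "g.F2.delta deg_zero \<zero>\<^bsub>M3\<^esub> = (\<lambda>_. \<zero>\<^bsub>M3\<^esub>)" by (auto simp: g.F2.delta_def)
  have "tm_g (f.F2.tsum (f.F1.recip \<one>) (f.F2.delta deg_zero m)) = \<one>\<^bsub>g.F2.T.TP\<^esub>"
    unfolding g.tensor_map_tsum[OF i1 d] g.f_delta m(2) z0 by simp
  then have "f.F2.tsum (f.F1.recip \<one>) (f.F2.delta deg_zero m) \<in> tm_f ` carrier f.F1.T.TP"
    unfolding ex kernel_def using f.F2.tsum_closed[OF i1 d] by blast
  then obtain c where c: "c \<in> carrier f.F1.T.TP" "f.F2.tsum (f.F1.recip \<one>) (f.F2.delta deg_zero m)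
      = tm_f c" by blast
  obtain F w where F: "F \<in> f.F1.MXc" "w \<in> f.F1.UB" "c = f.F1.tsum (f.F1.recip w) F"
      by (rule f.F1.tensor_rep[OF c(1)])
  have recip: "f.F1.recip w \<in> carrier f.F1.B.F" by (rule f.F1.recip_closed[OF F(2)])
  have wc: "w \<in> carrier S" using F by simp
  have fF: "(\<lambda>n. f (F n)) \<in> f.F2.MXc" by (rule f.comp_MXc[OF F(1)])
  have wd: "f.F2.act w (f.F2.delta deg_zero m) \<in> f.F2.MXc" by (rule f.F2.act_closed[OF wc d])
  have "f.F2.tsum (f.F1.recip w) (f.F2.act w (f.F2.delta deg_zero m)) =
      f.F2.tsum (f.F1.recip w) (\<lambda>n. f (F n))"
    using c(2) f.F2.tsum_rescale[OF F(2) one_UB d] wc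
        unfolding F(3) f.tensor_map_tsum[OF recip F(1)] by simp
  then have "f.F2.tsum (f.F1.recip w) (\<lambda>n. f.F2.act w (f.F2.delta deg_zero m) n \<oplus>\<^bsub>M2\<^esub> \<ominus>\<^bsub>M2\<^esub> f (F
      n)) = \<one>\<^bsub>f.F2.T.TP\<^esub>"
    unfolding f.F2.tsum_add_right[OF recip wd f.F2.neg_MXc[OF fF]] f.F2.tsum_neg[OF recip fF]
    using f.F2.tsum_closed[OF recip fF] by simp
  then obtain u where u: "u \<in> f.F1.UB"
    "f.F2.act u (\<lambda>n. f.F2.act w (f.F2.delta deg_zero m) n \<oplus>\<^bsub>M2\<^esub> \<ominus>\<^bsub>M2\<^esub> f (F n)) = (\<lambda>_. \<zero>\<^bsub>M2\<^esub>)"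
    using f.F2.tensor_zero_iff[OF f.F2.add_MXc[OF wd f.F2.neg_MXc[OF fF]] F(2)] by blast
  have uc: "u \<in> carrier S" using u by simp
  let ?D = "f.F2.delta deg_zero m"
  have nF: "f.F2.act u (\<lambda>n. \<ominus>\<^bsub>M2\<^esub> f (F n)) l = \<ominus>\<^bsub>M2\<^esub> f (f.F1.act u F l)" for l
  proof -
    have "(\<lambda>n. f.F2.act u (\<lambda>n. \<ominus>\<^bsub>M2\<^esub> f (F n)) n \<oplus>\<^bsub>M2\<^esub> f.F2.act u (\<lambda>n. f (F n)) n) =
        f.F2.act u (\<lambda>n. \<ominus>\<^bsub>M2\<^esub> f (F n) \<oplus>\<^bsub>M2\<^esub> f (F n))"
      by (rule f.F2.act_add_right[OF uc f.F2.neg_MXc[OF fF] fF, symmetric])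
    also have "\<dots> = (\<lambda>_. \<zero>\<^bsub>M2\<^esub>)" using f.F2.MXc_D[OF fF] uc by (simp add: f.F2.M.M.l_neg)
    finally have "f.F2.act u (\<lambda>n. \<ominus>\<^bsub>M2\<^esub> f (F n)) l \<oplus>\<^bsub>M2\<^esub> f.F2.act u (\<lambda>n. f (F n)) l = \<zero>\<^bsub>M2\<^esub>"
        by (rule fun_cong)
    then show ?thesis using f.F2.M.M.minus_equality f.F2.act_closed_pt[OF uc fF]
        f.F2.act_closed_pt[OF uc f.F2.neg_MXc[OF fF]]
      unfolding f.act_comp[OF uc F(1)] by metis
  qed
  have "f.F2.act (u \<otimes> w) ?D l = f (f.F1.act u F l)" for l
  proof -
    have "f.F2.act u (f.F2.act w ?D) l \<oplus>\<^bsub>M2\<^esub> \<ominus>\<^bsub>M2\<^esub> f (f.F1.act u F l) = \<zero>\<^bsub>M2\<^esub>"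
      using fun_cong[OF u(2), of l] unfolding f.F2.act_add_right[OF uc wd f.F2.neg_MXc[OF fF]] nF .
    moreover have "f (f.F1.act u F l) \<in> carrier M2"
        by (rule f.tf.f_closed[OF f.F1.act_closed_pt[OF uc F(1)]])
    moreover have "f.F2.act u (f.F2.act w ?D) l \<in> carrier M2" by (rule f.F2.act_closed_pt[OF uc wd])
    ultimately have "f.F2.act u (f.F2.act w ?D) l = f (f.F1.act u F l)"
      by (metis f.F2.M.M.a_inv_closed f.F2.M.M.minus_equality f.F2.M.M.minus_minus)
    then show ?thesis using f.F2.act_assoc[OF uc wc d] by simp
  qed
  then have im: "f.F2.act (u \<otimes> w) ?D l \<in> f ` carrier M1" for l
      using f.F1.act_closed_pt[OF uc F(1)] by simp
  have uw: "u \<otimes> w \<in> f.F1.UB" using u(1) F(2) f.F1.mult_notin_p by auto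
  show "m \<in> f ` carrier M1"
  proof (rule f.F2.act_values_unit[OF uw m(1) _ im])
    fix a y assume a: "a \<in> carrier f.F1.A.F" and "y \<in> f ` carrier M1"
    then obtain k where k: "k \<in> carrier M1" "y = f k" by blast
    show "a \<odot>\<^bsub>M2\<^esub> y \<in> f ` carrier M1"
      unfolding k(2) f.tf.f_smult[OF a k(1), symmetric] using f.F1.M.smult_closed[OF a k(1)]
          by blast
  qed
qed

end

lemma (in graded_point) faithfully_flat:
  "faithfully_flat_extension TYPE('x) (hom_localization_ring (Nvec r) S G p) (localization S p) \<iota>"
  unfolding faithfully_flat_extension_def faithfully_flat_def A_eq B_eq
proof (intro conjI allI impI \<iota>.ring_hom_cring_axioms \<iota>.restrict_scalars_module)
  fix M1 M2 M3 :: "(('a \<times> 'a) set, 'x) module" and f g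
  assume h: "module A.F M1 \<and> module A.F M2 \<and> module A.F M3 \<and> f \<in> linear_maps A.F M1 M2 \<and> g \<in>
      linear_maps A.F M2 M3"
  interpret flat_sequence S r G p x M1 M2 M3 f g
    using h graded_point_axioms
    by (intro flat_sequence.intro flat_morphism.intro flat_morphism_axioms.intro
        flat_module.intro) auto
  show "(f ` carrier M1 = a_kernel M2 M3 g) = (tm_f ` carrier f.F1.T.TP =
      kernel f.F2.T.TP g.F2.T.TP tm_g)"
    using exact_imp_tensor_exact tensor_exact_imp_exact by blast
qed

section \<open>Elimination and integrality\<close>

text \<open>The set \<open>K\<close> of coefficients will be a subring, a prime ideal of a subring, or the set of
  polynomial expressions of bounded degree in an element.\<close>

primrec (in ring) lspan :: "'a set \<Rightarrow> 'a list \<Rightarrow> 'a set" where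
  "lspan K [] = {\<zero>}"
| "lspan K (m # ms) = {k \<otimes> m \<oplus> y | k y. k \<in> K \<and> y \<in> lspan K ms}"

context cring
begin

lemma lspan_closed: "K \<subseteq> carrier R \<Longrightarrow> set ms \<subseteq> carrier R \<Longrightarrow> lspan K ms \<subseteq> carrier R"
  by (induction ms) auto

lemma lspan_zero: "\<zero> \<in> K \<Longrightarrow> set ms \<subseteq> carrier R \<Longrightarrow> \<zero> \<in> lspan K ms"
proof (induction ms)
  case (Cons m ms)
  then have "\<zero> = \<zero> \<otimes> m \<oplus> \<zero>" "\<zero> \<in> lspan K ms" by auto
  then show ?case using Cons.prems(1) unfolding lspan.simps by blast
qed simp

lemma lspan_add:
  assumes K: "K \<subseteq> carrier R" "\<And>c d. c \<in> K \<Longrightarrow> d \<in> K \<Longrightarrow> c \<oplus> d \<in> K"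
  shows "set ms \<subseteq> carrier R \<Longrightarrow> x \<in> lspan K ms \<Longrightarrow> y \<in> lspan K ms \<Longrightarrow> x \<oplus> y \<in> lspan K ms"
proof (induction ms arbitrary: x y)
  case (Cons m ms)
  then obtain k x' l y' where xy: "x = k \<otimes> m \<oplus> x'" "k \<in> K" "x' \<in> lspan K ms" "y = l \<otimes> m \<oplus> y'" "l \<in>
      K" "y' \<in> lspan K ms"
    by auto
  have c: "k \<in> carrier R" "l \<in> carrier R" "m \<in> carrier R" "x' \<in> carrier R" "y' \<in> carrier R"
    using xy K lspan_closed[OF K(1), of ms] Cons.prems(1) by auto
  have "x \<oplus> y = (k \<oplus> l) \<otimes> m \<oplus> (x' \<oplus> y')" using c by (simp add: xy l_distr a_ac)
  moreover have "x' \<oplus> y' \<in> lspan K ms" using Cons xy by simp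
  ultimately show ?case using K(2)[OF xy(2,5)] unfolding lspan.simps by blast
qed simp

lemma lspan_scale:
  assumes K: "K \<subseteq> carrier R" "c \<in> carrier R" "\<And>k. k \<in> K \<Longrightarrow> c \<otimes> k \<in> K'"
  shows "set ms \<subseteq> carrier R \<Longrightarrow> x \<in> lspan K ms \<Longrightarrow> c \<otimes> x \<in> lspan K' ms"
proof (induction ms arbitrary: x)
  case (Cons m ms)
  then obtain k x' where x: "x = k \<otimes> m \<oplus> x'" "k \<in> K" "x' \<in> lspan K ms" by auto
  have cc: "k \<in> carrier R" "m \<in> carrier R" "x' \<in> carrier R"
    using x K lspan_closed[OF K(1), of ms] Cons.prems(1) by auto
  have "c \<otimes> x = (c \<otimes> k) \<otimes> m \<oplus> c \<otimes> x'" using cc K(2) by (simp add: x r_distr m_assoc)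
  moreover have "c \<otimes> x' \<in> lspan K' ms" using Cons x by simp
  ultimately show ?case using K(3)[OF x(2)] unfolding lspan.simps by blast
qed (use K in simp)

lemma lspan_minimal:
  assumes "\<zero> \<in> J" "\<And>x y. x \<in> J \<Longrightarrow> y \<in> J \<Longrightarrow> x \<oplus> y \<in> J"
  shows "(\<And>k m. k \<in> K \<Longrightarrow> m \<in> set ms \<Longrightarrow> k \<otimes> m \<in> J) \<Longrightarrow> lspan K ms \<subseteq> J"
  by (induction ms) (use assms in auto)

lemma lspan_mem:
  assumes K: "K \<subseteq> carrier R" "\<zero> \<in> K"
  shows "set ms \<subseteq> carrier R \<Longrightarrow> k \<in> K \<Longrightarrow> m \<in> set ms \<Longrightarrow> k \<otimes> m \<in> lspan K ms"
proof (induction ms)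
  case (Cons a ms)
  show ?case
  proof (cases "m = a")
    case True
    have "k \<otimes> m = k \<otimes> a \<oplus> \<zero>" using True Cons.prems K by auto
    moreover have "\<zero> \<in> lspan K ms" using Cons.prems K by (intro lspan_zero) auto
    ultimately show ?thesis using Cons.prems(2) unfolding lspan.simps by blast
  next
    case False
    then have "k \<otimes> m \<in> lspan K ms" using Cons by auto
    moreover have "k \<otimes> m = \<zero> \<otimes> a \<oplus> k \<otimes> m"
      using Cons.prems subsetD[OF K(1) Cons.prems(2)] subsetD[OF Cons.prems(1,3)] by simp
    ultimately show ?thesis using K(2) unfolding lspan.simps by blast
  qed
qed simp

text \<open>A replacement for the determinant trick. Think of \<open>U n\<close> as elements with leading term one
  and of \<open>Q n\<close> as lower terms. The hypothesis is a linear system \<open>s m = \<Sum>k. c m k * k\<close> modulo \<open>P\<close>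
  with lower terms as coefficients. The first equation, \<open>(s - c) m = \<dots>\<close> with \<open>s - c\<close> in \<open>U n\<close>,
  makes it possible to eliminate \<open>m\<close> from the others after multiplying them by \<open>s - c\<close>, and the shorter
  system has the same shape. For monic polynomial expressions in an element the conclusion is an
  equation of integral dependence; for \<open>U\<close> the complement of a prime \<open>q\<close> of a subring and \<open>Q = q\<close>
  it is Nakayama's lemma.\<close>

lemma elimination:
  fixes U Q :: "nat \<Rightarrow> 'a set"
  assumes P: "ideal P R"
    and Uc: "\<And>n. U n \<subseteq> carrier R" and Qc: "\<And>n. Q n \<subseteq> carrier R"
    and Qadd: "\<And>n c d. c \<in> Q n \<Longrightarrow> d \<in> Q n \<Longrightarrow> c \<oplus> d \<in> Q n"
    and UQ: "\<And>n u c. u \<in> U n \<Longrightarrow> c \<in> Q n \<Longrightarrow> u \<ominus> c \<in> U n"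
    and UU: "\<And>n m u v. u \<in> U n \<Longrightarrow> v \<in> U m \<Longrightarrow> u \<otimes> v \<in> U (n + m)"
    and UQm: "\<And>n m u c. u \<in> U n \<Longrightarrow> c \<in> Q m \<Longrightarrow> u \<otimes> c \<in> Q (n + m)"
    and QQ: "\<And>n m c d. c \<in> Q n \<Longrightarrow> d \<in> Q m \<Longrightarrow> c \<otimes> d \<in> Q (n + m)"
  shows "set ms \<subseteq> carrier R \<Longrightarrow> s \<in> U n \<Longrightarrow> (\<And>m. m \<in> set ms \<Longrightarrow> \<exists>y\<in>lspan (Q n) ms. s \<otimes> m \<ominus> y \<in> P) \<Longrightarrow>
    \<exists>n' u. u \<in> U n' \<and> (\<forall>m\<in>set ms. u \<otimes> m \<in> P)"
proof (induction ms arbitrary: s n)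
  case Nil
  then show ?case by auto
next
  case (Cons m ms)
  have mc: "m \<in> carrier R" "set ms \<subseteq> carrier R" and sc: "s \<in> carrier R" using Cons.prems Uc by auto
  obtain y where y: "y \<in> lspan (Q n) (m # ms)" "s \<otimes> m \<ominus> y \<in> P" using Cons.prems(3)[of m] by auto
  then obtain q y' where q: "q \<in> Q n" "y' \<in> lspan (Q n) ms" "y = q \<otimes> m \<oplus> y'" by auto
  have qc: "q \<in> carrier R" "y' \<in> carrier R" using q Qc lspan_closed[OF Qc mc(2)] by auto
  define u where "u = s \<ominus> q"
  have u: "u \<in> U n" unfolding u_def by (rule UQ[OF Cons.prems(2) q(1)])
  have uc: "u \<in> carrier R" using u Uc by auto
  have "u \<otimes> m \<ominus> y' = s \<otimes> m \<ominus> y" unfolding u_def q(3) using mc sc qc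
    by (simp add: minus_eq l_distr l_minus minus_add a_assoc)
  then have um: "u \<otimes> m \<ominus> y' \<in> P" using y by simp
  have "\<exists>n' v. v \<in> U n' \<and> (\<forall>k\<in>set ms. v \<otimes> k \<in> P)"
  proof (rule Cons.IH[OF mc(2)])
    show "u \<otimes> s \<in> U (n + n)" by (rule UU[OF u Cons.prems(2)])
    fix k assume k: "k \<in> set ms"
    have kc: "k \<in> carrier R" using k mc by auto
    obtain z where z: "z \<in> lspan (Q n) (m # ms)" "s \<otimes> k \<ominus> z \<in> P" using Cons.prems(3)[of k] k by auto
    then obtain c z' where c: "c \<in> Q n" "z' \<in> lspan (Q n) ms" "z = c \<otimes> m \<oplus> z'" by auto
    have cc: "c \<in> carrier R" "z' \<in> carrier R" using c Qc lspan_closed[OF Qc mc(2)] by auto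
    have "u \<otimes> s \<otimes> k \<ominus> (c \<otimes> y' \<oplus> u \<otimes> z') = u \<otimes> (s \<otimes> k \<ominus> z) \<oplus> c \<otimes> (u \<otimes> m \<ominus> y')"
    proof -
      have "u \<otimes> (s \<otimes> k \<ominus> z) \<oplus> c \<otimes> (u \<otimes> m \<ominus> y')
         = u \<otimes> s \<otimes> k \<oplus> (\<ominus> (c \<otimes> (u \<otimes> m)) \<oplus> c \<otimes> (u \<otimes> m)) \<oplus> (\<ominus> (c \<otimes> y') \<oplus> \<ominus> (u \<otimes> z'))"
        unfolding c(3) using uc sc kc mc cc qc
        by (simp add: minus_eq r_distr r_minus minus_add a_ac m_ac)
      then show ?thesis using uc sc kc mc cc qc by (simp add: minus_eq minus_add l_neg)
    qed
    moreover have "\<dots> \<in> P"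
      using z(2) um uc cc ideal.I_l_closed[OF P] additive_subgroup.a_closed[OF ideal.axioms(1)[OF
          P]] by simp
    moreover have "c \<otimes> y' \<oplus> u \<otimes> z' \<in> lspan (Q (n + n)) ms"
      using lspan_scale[OF Qc cc(1) _ mc(2) q(2), of "Q (n + n)"] lspan_scale[OF Qc uc _ mc(2)
          c(2), of "Q (n + n)"]
        QQ[OF c(1)] UQm[OF u] by (intro lspan_add[OF Qc Qadd mc(2)]) auto
    ultimately show "\<exists>y\<in>lspan (Q (n + n)) ms. u \<otimes> s \<otimes> k \<ominus> y \<in> P" by metis
  qed
  then obtain n' v where v: "v \<in> U n'" "\<And>k. k \<in> set ms \<Longrightarrow> v \<otimes> k \<in> P" by blast
  have vc: "v \<in> carrier R" using v Uc by auto
  have "lspan (Q n) ms \<subseteq> {x \<in> carrier R. v \<otimes> x \<in> P}"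
  proof (rule lspan_minimal)
    show "\<zero> \<in> {x \<in> carrier R. v \<otimes> x \<in> P}"
        using vc additive_subgroup.zero_closed[OF ideal.axioms(1)[OF P]] by simp
    show "x \<oplus> y \<in> {x \<in> carrier R. v \<otimes> x \<in> P}"
        if "x \<in> {x \<in> carrier R. v \<otimes> x \<in> P}" "y \<in> {x \<in> carrier R. v \<otimes> x \<in> P}" for x y
      using that vc additive_subgroup.a_closed[OF ideal.axioms(1)[OF P]] by (simp add: r_distr)
    fix k l assume k: "k \<in> Q n" and l: "l \<in> set ms"
    have kl: "k \<in> carrier R" "l \<in> carrier R" using k l Qc mc by auto
    have "v \<otimes> (k \<otimes> l) = k \<otimes> (v \<otimes> l)" using kl vc by (simp add: m_ac)
    then show "k \<otimes> l \<in> {x \<in> carrier R. v \<otimes> x \<in> P}"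
        using kl ideal.I_l_closed[OF P v(2)[OF l] kl(1)] by simp
  qed
  then have vy: "v \<otimes> y' \<in> P" using q by auto
  have "v \<otimes> u \<otimes> m = v \<otimes> (u \<otimes> m \<ominus> y') \<oplus> v \<otimes> y'"
    using vc uc mc qc by (simp add: minus_eq r_distr r_minus m_assoc a_assoc l_neg)
  also have "\<dots> \<in> P" using vy ideal.I_l_closed[OF P um vc] additive_subgroup.a_closed[OF
      ideal.axioms(1)[OF P]] by simp
  finally have "v \<otimes> u \<otimes> m \<in> P" .
  moreover have "v \<otimes> u \<otimes> k \<in> P" if k: "k \<in> set ms" for k
  proof -
    have "v \<otimes> u \<otimes> k = u \<otimes> (v \<otimes> k)" using vc uc k mc by (simp add: m_ac subset_iff)
    then show ?thesis using ideal.I_l_closed[OF P v(2)[OF k] uc] by simp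
  qed
  moreover have "v \<otimes> u \<in> U (n' + n)" by (rule UU[OF v(1) u])
  ultimately show ?case by auto
qed

end

text \<open>The values at \<open>x\<close> of the monic polynomials of degree \<open>n\<close> with coefficients in \<open>K\<close>, and then
  of the polynomials of degree less than \<open>n\<close>, both in Horner form.\<close>

primrec (in ring) monics :: "'a set \<Rightarrow> 'a \<Rightarrow> nat \<Rightarrow> 'a set" where
  "monics K x 0 = {\<one>}"
| "monics K x (Suc n) = {x \<otimes> u \<oplus> k | u k. u \<in> monics K x n \<and> k \<in> K}"

primrec (in ring) lowers :: "'a set \<Rightarrow> 'a \<Rightarrow> nat \<Rightarrow> 'a set" where
  "lowers K x 0 = {\<zero>}"
| "lowers K x (Suc n) = {x \<otimes> y \<oplus> k | y k. y \<in> lowers K x n \<and> k \<in> K}"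

locale subring_point = cring R for R (structure) + fixes K x
  assumes K: "subring K R" and xc: "x \<in> carrier R"
begin

lemmas Kf = subringE[OF K]

lemma Kc: "k \<in> K \<Longrightarrow> k \<in> carrier R" using Kf(1) by auto

lemma lowers_carrier: "lowers K x n \<subseteq> carrier R"
  by (induction n) (use xc Kc in auto)

lemma monics_carrier: "monics K x n \<subseteq> carrier R"
  by (induction n) (use xc Kc in auto)

lemma lowers_zero: "\<zero> \<in> lowers K x n"
proof (induction n)
  case (Suc n)
  have "\<zero> = x \<otimes> \<zero> \<oplus> \<zero>" using xc by simp
  then show ?case using Suc Kf(2) by auto
qed simp

lemma lowers_add: "a \<in> lowers K x n \<Longrightarrow> b \<in> lowers K x n \<Longrightarrow> a \<oplus> b \<in> lowers K x n"
proof (induction n arbitrary: a b)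
  case (Suc n)
  then obtain y k z l where h: "a = x \<otimes> y \<oplus> k" "y \<in> lowers K x n" "k \<in> K" "b = x \<otimes> z \<oplus> l" "z \<in>
      lowers K x n" "l \<in> K" by auto
  have c: "y \<in> carrier R" "z \<in> carrier R" "k \<in> carrier R" "l \<in> carrier R"
      using h lowers_carrier Kc by blast+
  have "a \<oplus> b = x \<otimes> (y \<oplus> z) \<oplus> (k \<oplus> l)" using c xc by (simp add: h r_distr a_ac)
  then show ?case using Suc.IH[OF h(2,5)] Kf(7)[OF h(3,6)] by auto
qed simp

lemma lowers_scale: "a \<in> lowers K x n \<Longrightarrow> c \<in> K \<Longrightarrow> c \<otimes> a \<in> lowers K x n"
proof (induction n arbitrary: a)
  case (Suc n)
  then obtain y k where h: "a = x \<otimes> y \<oplus> k" "y \<in> lowers K x n" "k \<in> K" by auto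
  have c: "y \<in> carrier R" "k \<in> carrier R" "c \<in> carrier R" using h Suc.prems lowers_carrier Kc
      by blast+
  have "c \<otimes> a = x \<otimes> (c \<otimes> y) \<oplus> c \<otimes> k" using c xc by (simp add: h r_distr m_ac)
  then show ?case using Suc.IH[OF h(2) Suc.prems(2)] Kf(6)[OF Suc.prems(2) h(3)] by auto
qed (use Kc in auto)

lemma lowers_Suc: "a \<in> lowers K x n \<Longrightarrow> a \<in> lowers K x (Suc n)"
proof (induction n arbitrary: a)
  case 0
  have "\<zero> = x \<otimes> \<zero> \<oplus> \<zero>" using xc by simp
  then show ?case using 0 Kf(2) by auto
next
  case (Suc n)
  then show ?case unfolding lowers.simps(2)[of K x "Suc n"] by auto
qed

lemma lowers_mono: "a \<in> lowers K x n \<Longrightarrow> n \<le> m \<Longrightarrow> a \<in> lowers K x m"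
  using lowers_Suc by (induction m rule: nat_induct) (auto simp: le_Suc_eq simp del: lowers.simps)

lemma lowers_shift: "a \<in> lowers K x n \<Longrightarrow> x \<otimes> a \<in> lowers K x (Suc n)"
proof -
  assume a: "a \<in> lowers K x n"
  have "x \<otimes> a = x \<otimes> a \<oplus> \<zero>" using a xc lowers_carrier by (simp add: subset_iff)
  then show ?thesis using a Kf(2) by auto
qed

lemma lowers_mult: "a \<in> lowers K x n \<Longrightarrow> b \<in> lowers K x m \<Longrightarrow> a \<otimes> b \<in> lowers K x (n + m)"
proof (induction n arbitrary: a)
  case 0
  then show ?case using lowers_zero lowers_carrier[of m] by (auto simp: subset_iff)
next
  case (Suc n)
  then obtain y k where h: "a = x \<otimes> y \<oplus> k" "y \<in> lowers K x n" "k \<in> K" by auto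
  have c: "y \<in> carrier R" "k \<in> carrier R" "b \<in> carrier R" using h Suc.prems lowers_carrier Kc
      by blast+
  have "a \<otimes> b = x \<otimes> (y \<otimes> b) \<oplus> k \<otimes> b" using c xc by (simp add: h l_distr m_assoc)
  moreover have "k \<otimes> b \<in> lowers K x (Suc n + m)"
      by (rule lowers_mono[OF lowers_scale[OF Suc.prems(2) h(3)]]) simp
  ultimately show ?case using lowers_add[OF lowers_shift[OF Suc.IH[OF h(2) Suc.prems(2)]]] by simp
qed

lemma monics_lowers: "u \<in> monics K x n \<Longrightarrow> u \<in> lowers K x (Suc n)"
proof (induction n arbitrary: u)
  case 0
  have "\<one> = x \<otimes> \<zero> \<oplus> \<one>" using xc by simp
  then show ?case using 0 Kf(3) by auto
next
  case (Suc n)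
  then show ?case unfolding lowers.simps(2)[of K x "Suc n"] by auto
qed

lemma monics_add: "u \<in> monics K x n \<Longrightarrow> c \<in> lowers K x n \<Longrightarrow> u \<oplus> c \<in> monics K x n"
proof (induction n arbitrary: u c)
  case (Suc n)
  then obtain y k z l where h: "u = x \<otimes> y \<oplus> k" "y \<in> monics K x n" "k \<in> K" "c = x \<otimes> z \<oplus> l" "z \<in>
      lowers K x n" "l \<in> K" by auto
  have c: "y \<in> carrier R" "z \<in> carrier R" "k \<in> carrier R" "l \<in> carrier R"
      using h lowers_carrier monics_carrier Kc by blast+
  have "u \<oplus> c = x \<otimes> (y \<oplus> z) \<oplus> (k \<oplus> l)" using c xc by (simp add: h r_distr a_ac)
  then show ?case using Suc.IH[OF h(2,5)] Kf(7)[OF h(3,6)] by auto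
qed simp

lemma monics_minus: "u \<in> monics K x n \<Longrightarrow> c \<in> lowers K x n \<Longrightarrow> u \<ominus> c \<in> monics K x n"
proof -
  assume u: "u \<in> monics K x n" and c: "c \<in> lowers K x n"
  have cc: "c \<in> carrier R" using c lowers_carrier by auto
  have "\<ominus> c = (\<ominus> \<one>) \<otimes> c" using cc by (simp add: l_minus)
  then have "\<ominus> c \<in> lowers K x n" using lowers_scale[OF c, of "\<ominus> \<one>"] Kf(3,5) by simp
  then show ?thesis unfolding minus_eq by (rule monics_add[OF u])
qed

lemma monics_mult_lowers: "u \<in> monics K x n \<Longrightarrow> b \<in> lowers K x m \<Longrightarrow> u \<otimes> b \<in> lowers K x (n + m)"
proof (induction n arbitrary: u)
  case 0
  then show ?case using lowers_carrier[of m] by (auto simp: subset_iff)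
next
  case (Suc n)
  then obtain y k where h: "u = x \<otimes> y \<oplus> k" "y \<in> monics K x n" "k \<in> K" by auto
  have c: "y \<in> carrier R" "k \<in> carrier R" "b \<in> carrier R"
      using h Suc.prems lowers_carrier monics_carrier Kc by blast+
  have "u \<otimes> b = x \<otimes> (y \<otimes> b) \<oplus> k \<otimes> b" using c xc by (simp add: h l_distr m_assoc)
  moreover have "k \<otimes> b \<in> lowers K x (Suc n + m)"
      by (rule lowers_mono[OF lowers_scale[OF Suc.prems(2) h(3)]]) simp
  ultimately show ?case using lowers_add[OF lowers_shift[OF Suc.IH[OF h(2) Suc.prems(2)]]] by simp
qed

lemma monics_mult: "u \<in> monics K x n \<Longrightarrow> v \<in> monics K x m \<Longrightarrow> u \<otimes> v \<in> monics K x (n + m)"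
proof (induction n arbitrary: u)
  case 0
  then show ?case using monics_carrier[of m] by (auto simp: subset_iff)
next
  case (Suc n)
  then obtain y k where h: "u = x \<otimes> y \<oplus> k" "y \<in> monics K x n" "k \<in> K" by auto
  have c: "y \<in> carrier R" "k \<in> carrier R" "v \<in> carrier R" using h Suc.prems monics_carrier Kc
      by blast+
  have yv: "y \<otimes> v \<in> monics K x (n + m)" by (rule Suc.IH[OF h(2) Suc.prems(2)])
  have "x \<otimes> (y \<otimes> v) = x \<otimes> (y \<otimes> v) \<oplus> \<zero>" using c xc by simp
  then have xyv: "x \<otimes> (y \<otimes> v) \<in> monics K x (Suc n + m)" using yv Kf(2) by auto
  have "u \<otimes> v = x \<otimes> (y \<otimes> v) \<oplus> k \<otimes> v" using c xc by (simp add: h l_distr m_assoc)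
  moreover have "k \<otimes> v \<in> lowers K x (Suc n + m)"
    by (rule lowers_mono[OF lowers_scale[OF monics_lowers[OF Suc.prems(2)] h(3)]]) simp
  ultimately show ?case using monics_add[OF xyv] by simp
qed

lemma monics_eval: "u \<in> monics K x n \<Longrightarrow> \<exists>as. set as \<subseteq> K \<and> eval (\<one> # as) x = u"
proof (induction n arbitrary: u)
  case 0
  then show ?case using xc by (intro exI[of _ "[]"]) simp
next
  case (Suc n)
  then obtain y k where h: "u = x \<otimes> y \<oplus> k" "y \<in> monics K x n" "k \<in> K" by auto
  from Suc.IH[OF h(2)] obtain as where as: "set as \<subseteq> K" "eval (\<one> # as) x = y" by blast
  have yc: "y \<in> carrier R" using h monics_carrier by blast
  have "eval ((\<one> # as) @ [k]) x = u"
    using eval_append_aux[of "\<one> # as" k x] as h Kf(1) Kc xc yc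
        by (auto simp: m_comm simp del: eval.simps)
  then show ?case using as h by (intro exI[of _ "as @ [k]"]) simp
qed

text \<open>Elimination shows that a monic expression in \<open>x\<close> kills all generators of the module, hence
  also \<open>\<one>\<close>.\<close>

lemma integral_if_finite:
  assumes ms: "set ms \<subseteq> carrier R" "carrier R \<subseteq> lspan K ms"
  shows "\<exists>n. \<zero> \<in> monics K x n"
proof -
  have e: "x \<otimes> \<zero> \<oplus> k = k" if "k \<in> K" for k using that xc Kc by simp
  have l1: "lowers K x 1 = K" unfolding One_nat_def lowers.simps using e by force
  have "x = x \<otimes> \<one> \<oplus> \<zero>" using xc by simp
  then have x1: "x \<in> monics K x 1" unfolding One_nat_def monics.simps using Kf(2) by blast
  have "\<exists>n' u. u \<in> monics K x n' \<and> (\<forall>m\<in>set ms. u \<otimes> m \<in> {\<zero>})"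
  proof (rule elimination[where U = "monics K x"
      and Q = "lowers K x", OF zeroideal monics_carrier lowers_carrier lowers_add monics_minus
      monics_mult monics_mult_lowers lowers_mult ms(1) x1])
    fix m assume m: "m \<in> set ms"
    have "x \<otimes> m \<in> carrier R" using m ms(1) xc by auto
    then have "x \<otimes> m \<in> lspan (lowers K x 1) ms" unfolding l1 by (rule subsetD[OF ms(2)])
    then show "\<exists>y\<in>lspan (lowers K x 1) ms. x \<otimes> m \<ominus> y \<in> {\<zero>}"
      using m ms xc by (intro bexI[of _ "x \<otimes> m"]) auto
  qed
  then obtain n u where u: "u \<in> monics K x n" "\<And>m. m \<in> set ms \<Longrightarrow> u \<otimes> m = \<zero>" by auto
  have uc: "u \<in> carrier R" using u monics_carrier by blast
  have "lspan K ms \<subseteq> {y \<in> carrier R. u \<otimes> y = \<zero>}"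
    using uc u(2) Kc ms(1) by (intro lspan_minimal) (auto simp: r_distr m_lcomm subset_iff)
  then have "u \<otimes> \<one> = \<zero>" using ms(2) by auto
  then show ?thesis using u uc by auto
qed

end

section \<open>Chains of primes in finite extensions\<close>

text \<open>An ideal that is maximal among those containing \<open>J\<close> and disjoint from \<open>W\<close> is prime.\<close>

lemma (in cring) prime_avoiding:
  assumes J: "ideal J R" and W: "W \<subseteq> carrier R" "\<one> \<in> W" "\<And>a b. a \<in> W \<Longrightarrow> b \<in> W \<Longrightarrow> a \<otimes> b \<in> W"
    and JW: "J \<inter> W = {}"
  obtains P where "primeideal P R" "J \<subseteq> P" "P \<inter> W = {}"
proof -
  let ?A = "{I. ideal I R \<and> J \<subseteq> I \<and> I \<inter> W = {}}"
  have "\<exists>M\<in>?A. \<forall>I\<in>?A. M \<subseteq> I \<longrightarrow> I = M"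
  proof (rule subset_Zorn_nonempty)
    show "?A \<noteq> {}" using J JW by auto
    fix C assume C: "C \<noteq> {}" "subset.chain ?A C"
    then have CA: "C \<subseteq> ?A" and ch: "\<And>a b. a \<in> C \<Longrightarrow> b \<in> C \<Longrightarrow> a \<subset> b \<or> a = b \<or> b \<subset> a"
      unfolding pred_on.chain_def by blast+
    have "subset.chain {I. ideal I R} C" unfolding pred_on.chain_def using CA ch by blast
    then have "ideal (\<Union>C) R" using chain_Union_is_ideal[of C] C(1) by simp
    moreover have "J \<subseteq> \<Union>C" using CA C(1) by blast
    moreover have "\<Union>C \<inter> W = {}" using CA by blast
    ultimately show "\<Union>C \<in> ?A" by blast
  qed
  then obtain P where PA: "P \<in> ?A" and PM: "\<forall>I\<in>?A. P \<subseteq> I \<longrightarrow> I = P" by (rule bexE)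
  from PA have P: "ideal P R" "J \<subseteq> P" "P \<inter> W = {}" by simp_all
  have max: "I = P" if "ideal I R" "J \<subseteq> I" "I \<inter> W = {}" "P \<subseteq> I" for I
    using PM that by simp
  interpret P: ideal P R by (rule P(1))
  have meet: "\<exists>z\<in>P. \<exists>c\<in>carrier R. z \<oplus> c \<otimes> a \<in> W" if a: "a \<in> carrier R" "a \<notin> P" for a
  proof (rule ccontr)
    assume n: "\<not> ?thesis"
    let ?I = "{z \<oplus> c \<otimes> a | z c. z \<in> P \<and> c \<in> carrier R}"
    have "ideal ?I R"
    proof (rule idealI')
      show "?I \<subseteq> carrier R" using a P.Icarr by auto
      have "\<zero> = \<zero> \<oplus> \<zero> \<otimes> a" using a by simp
      then show "\<zero> \<in> ?I" using P.zero_closed by blast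
      fix u v assume "u \<in> ?I"
      then obtain z c where u: "u = z \<oplus> c \<otimes> a" "z \<in> P" "c \<in> carrier R" by auto
      have zc: "z \<in> carrier R" by (rule P.Icarr[OF u(2)])
      { assume "v \<in> ?I"
        then obtain z' c' where v: "v = z' \<oplus> c' \<otimes> a" "z' \<in> P" "c' \<in> carrier R" by auto
        have z'c: "z' \<in> carrier R" by (rule P.Icarr[OF v(2)])
        have "u \<oplus> v = (z \<oplus> z') \<oplus> (c \<oplus> c') \<otimes> a" unfolding u(1) v(1) using zc z'c u(3) v(3) a(1)
            by (simp add: l_distr a_ac)
        then show "u \<oplus> v \<in> ?I" using P.a_closed[OF u(2) v(2)] add.m_closed[OF u(3) v(3)] by blast }
      assume v: "v \<in> carrier R"
      have "v \<otimes> u = v \<otimes> z \<oplus> (v \<otimes> c) \<otimes> a" unfolding u(1) using zc u(3) v a(1)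
          by (simp add: r_distr m_assoc)
      then show vu: "v \<otimes> u \<in> ?I" using P.I_l_closed[OF u(2) v] m_closed[OF v u(3)] by blast
      have "u \<in> carrier R" unfolding u(1) using zc u(3) a(1) by simp
      from m_comm[OF this v] show "u \<otimes> v \<in> ?I" using vu by simp
    qed
    moreover have PI: "P \<subseteq> ?I"
    proof
      fix z assume z: "z \<in> P"
      have "z = z \<oplus> \<zero> \<otimes> a" using P.Icarr[OF z] a by simp
      then show "z \<in> ?I" using z by blast
    qed
    moreover have "?I \<inter> W = {}" using n by auto
    ultimately have "?I = P" using max[of ?I] P(2) by blast
    moreover have "a = \<zero> \<oplus> \<one> \<otimes> a" using a by simp
    then have "a \<in> ?I" using P.zero_closed by blast
    ultimately show False using a by simp
  qed
  have "primeideal P R"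
  proof (rule primeidealI[OF P(1) is_cring])
    show "carrier R \<noteq> P" using P(3) W by auto
    fix a b assume ab: "a \<in> carrier R" "b \<in> carrier R" "a \<otimes> b \<in> P"
    show "a \<in> P \<or> b \<in> P"
    proof (rule ccontr)
      assume "\<not> ?thesis"
      then have nab: "a \<notin> P" "b \<notin> P" by auto
      obtain z c where z: "z \<in> P" "c \<in> carrier R" "z \<oplus> c \<otimes> a \<in> W" using meet[OF ab(1) nab(1)]
          by blast
      obtain y d where y: "y \<in> P" "d \<in> carrier R" "y \<oplus> d \<otimes> b \<in> W" using meet[OF ab(2) nab(2)]
          by blast
      have zy: "z \<in> carrier R" "y \<in> carrier R" using P.Icarr[OF z(1)] P.Icarr[OF y(1)] .
      have "(z \<oplus> c \<otimes> a) \<otimes> (y \<oplus> d \<otimes> b) = ((y \<oplus> d \<otimes> b) \<otimes> z \<oplus> (c \<otimes> a) \<otimes> y) \<oplus> (c \<otimes> d) \<otimes> (a \<otimes> b)"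
        using zy z(2) y(2) ab(1,2) by (simp add: l_distr r_distr m_ac a_ac)
      moreover have "\<dots> \<in> P"
        by (intro P.a_closed P.I_l_closed z(1) y(1) ab(3) m_closed add.m_closed[simplified] z(2)
            y(2) ab(1,2) zy(2))
      ultimately show False using W(3)[OF z(3) y(3)] P(3) by auto
    qed
  qed
  then show thesis using that P by blast
qed

lemma (in ring) contract_ideal:
  assumes K: "subring K R" and J: "ideal J R"
  shows "ideal (J \<inter> K) (R\<lparr>carrier := K\<rparr>)"
proof -
  interpret KR: ring "R\<lparr>carrier := K\<rparr>" by (rule subring_is_ring[OF K])
  interpret J: ideal J R by (rule J)
  note Kf = subringE[OF K]
  show ?thesis
  proof (rule KR.idealI')
    fix a b assume a: "a \<in> J \<inter> K"
    { assume "b \<in> J \<inter> K"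
      then show "a \<oplus>\<^bsub>R\<lparr>carrier := K\<rparr>\<^esub> b \<in> J \<inter> K" using a Kf(7)[of a b] J.a_closed[of a b] by simp }
    assume b: "b \<in> carrier (R\<lparr>carrier := K\<rparr>)"
    have bR: "b \<in> carrier R" using b Kf(1) by auto
    show "b \<otimes>\<^bsub>R\<lparr>carrier := K\<rparr>\<^esub> a \<in> J \<inter> K" using a b Kf(6)[of b a] J.I_l_closed[OF _ bR, of a]
        by simp
    show "a \<otimes>\<^bsub>R\<lparr>carrier := K\<rparr>\<^esub> b \<in> J \<inter> K" using a b Kf(6)[of a b] J.I_r_closed[OF _ bR, of a]
        by simp
  qed (use Kf(2) J.zero_closed in simp_all)
qed

lemma (in ring) contract_prime:
  assumes K: "subring K R" and P: "primeideal P R"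
  shows "primeideal (P \<inter> K) (R\<lparr>carrier := K\<rparr>)"
proof -
  interpret P: primeideal P R by fact
  note Kf = subringE[OF K]
  show ?thesis
  proof (rule primeidealI)
    show "cring (R\<lparr>carrier := K\<rparr>)" using P.subcringI'[OF K] subcring_iff[OF Kf(1)] by simp
    show "ideal (P \<inter> K) (R\<lparr>carrier := K\<rparr>)" by (rule contract_ideal[OF K P.is_ideal])
    show "carrier (R\<lparr>carrier := K\<rparr>) \<noteq> P \<inter> K"
      using Kf(3) P.one_imp_carrier P.I_notcarr by auto
    fix a b assume "a \<in> carrier (R\<lparr>carrier := K\<rparr>)" "b \<in> carrier (R\<lparr>carrier := K\<rparr>)"
        "a \<otimes>\<^bsub>R\<lparr>carrier := K\<rparr>\<^esub> b \<in> P \<inter> K"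
    then show "a \<in> P \<inter> K \<or> b \<in> P \<inter> K" using P.I_prime[of a b] Kf(1) by auto
  qed
qed

locale spanned_extension = cring R for R (structure) + fixes K ms
  assumes K: "subring K R" and ms: "set ms \<subseteq> carrier R" "carrier R \<subseteq> lspan K ms"
begin

lemmas Kf = subringE[OF K]

abbreviation "RK \<equiv> R\<lparr>carrier := K\<rparr>"

lemma integral: "x \<in> carrier R \<Longrightarrow> \<exists>n. \<zero> \<in> monics K x n"
  using ms by (intro subring_point.integral_if_finite) (simp_all add: subring_point_def
      subring_point_axioms_def is_cring K)

lemma integral_extension:
  assumes "\<one> \<noteq> \<zero>" shows "integral_extension K R"
  unfolding integral_extension_def
proof (intro conjI K ballI)
  fix x assume x: "x \<in> carrier R"
  interpret x: subring_point R K x by (intro subring_point.intro subring_point_axioms.intro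
      is_cring K x)
  obtain n where "\<zero> \<in> monics K x n" using integral[OF x] by blast
  then obtain as where as: "set as \<subseteq> K" "eval (\<one> # as) x = \<zero>" using x.monics_eval by blast
  have "polynomial K (\<one> # as)" using as Kf(3) assms by (simp add: polynomial_def)
  then have "\<one> # as \<in> carrier (K[X])" by (simp add: univ_poly_carrier)
  then show "\<exists>f\<in>carrier (K[X]). f \<noteq> [] \<and> lead_coeff f = \<one> \<and> eval f x = \<zero>"
    using as(2) by (intro bexI[of _ "\<one> # as"]) (auto simp del: eval.simps)
qed

text \<open>Lying over and going up in one statement, for \<open>I = 0\<close> and for \<open>I\<close> a prime. It suffices that
  the ideal \<open>I + q R\<close> does not meet \<open>K - q\<close>. If it contained such an element \<open>s\<close>, then \<open>s R\<close> would
  lie in \<open>q R\<close> modulo \<open>I\<close>, and elimination would give an element of \<open>K - q\<close> in \<open>I\<close>.\<close>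

lemma lie_over:
  assumes I: "ideal I R" and q: "primeideal q RK" and Iq: "I \<inter> K \<subseteq> q"
  obtains P where "primeideal P R" "I \<subseteq> P" "P \<inter> K = q"
proof -
  interpret q: primeideal q RK by fact
  have qK: "q \<subseteq> K" using q.a_subset by simp
  have qc: "q \<subseteq> carrier R" using qK Kf(1) by blast
  have q_add: "c \<oplus> d \<in> q" if "c \<in> q" "d \<in> q" for c d
      using additive_subgroup.a_closed[OF ideal.axioms(1)[OF q.is_ideal] that] by simp
  have q_zero: "\<zero> \<in> q" using additive_subgroup.zero_closed[OF ideal.axioms(1)[OF q.is_ideal]]
      by simp
  have q_mult: "c \<otimes> d \<in> q" if "c \<in> K" "d \<in> q" for c d using q.I_l_closed[OF that(2), of c] that(1)
      by simp
  have q_neg: "\<ominus> c \<in> q" if "c \<in> q" for c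
  proof -
    have "\<ominus> c = (\<ominus> \<one>) \<otimes> c" using that qc by (simp add: l_minus subset_iff)
    then show ?thesis using q_mult[OF _ that, of "\<ominus> \<one>"] Kf(3,5) by simp
  qed
  have q_prime: "a \<in> q \<or> b \<in> q" if "a \<in> K" "b \<in> K" "a \<otimes> b \<in> q" for a b
      using q.I_prime[of a b] that by simp
  have q_one: "\<one> \<notin> q" using q.one_imp_carrier q.I_notcarr by auto
  let ?qR = "lspan q ms"
  have qRc: "?qR \<subseteq> carrier R" by (rule lspan_closed[OF qc ms(1)])
  let ?J = "{y \<oplus> z | y z. y \<in> I \<and> z \<in> ?qR}"
  have qR_scale: "c \<otimes> z \<in> ?qR" if c: "c \<in> carrier R" and z: "z \<in> ?qR" for c z
  proof -
    have "?qR \<subseteq> {z \<in> carrier R. c \<otimes> z \<in> ?qR}"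
    proof (rule lspan_minimal)
      show "\<zero> \<in> {z \<in> carrier R. c \<otimes> z \<in> ?qR}" using c lspan_zero[OF q_zero ms(1)] by simp
      show "x \<oplus> y \<in> {z \<in> carrier R. c \<otimes> z \<in> ?qR}"
          if "x \<in> {z \<in> carrier R. c \<otimes> z \<in> ?qR}" "y \<in> {z \<in> carrier R. c \<otimes> z \<in> ?qR}" for x y
        using that c lspan_add[OF qc q_add ms(1)] by (simp add: r_distr)
      fix k m assume k: "k \<in> q" and m: "m \<in> set ms"
      have kc: "k \<in> carrier R" "m \<in> carrier R" using k qc m ms(1) by auto
      have "c \<otimes> m \<in> lspan K ms" using ms(2) c kc by auto
      then have "k \<otimes> (c \<otimes> m) \<in> ?qR"
        using lspan_scale[OF Kf(1) kc(1) _ ms(1), of q "c \<otimes> m"] k q_mult m_comm[OF kc(1)] Kf(1)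
            by (metis subsetD)
      then show "k \<otimes> m \<in> {z \<in> carrier R. c \<otimes> z \<in> ?qR}" using kc c by (simp add: m_lcomm)
    qed
    then show ?thesis using z by blast
  qed
  have J: "ideal ?J R"
  proof (rule idealI')
    show "?J \<subseteq> carrier R" using ideal.Icarr[OF I] qRc by auto
    have "\<zero> = \<zero> \<oplus> \<zero>" by simp
    then show "\<zero> \<in> ?J" using lspan_zero[OF q_zero ms(1)] additive_subgroup.zero_closed[OF
        ideal.axioms(1)[OF I]] by blast
    fix u v assume "u \<in> ?J"
    then obtain y z where u: "u = y \<oplus> z" "y \<in> I" "z \<in> ?qR" by auto
    have uc: "y \<in> carrier R" "z \<in> carrier R" using ideal.Icarr[OF I u(2)] u(3) qRc by auto
    { assume "v \<in> ?J"
      then obtain y' z' where v: "v = y' \<oplus> z'" "y' \<in> I" "z' \<in> ?qR" by auto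
      have vc: "y' \<in> carrier R" "z' \<in> carrier R" using ideal.Icarr[OF I v(2)] v(3) qRc by auto
      have "u \<oplus> v = (y \<oplus> y') \<oplus> (z \<oplus> z')" unfolding u(1) v(1) using uc vc by (simp add: a_ac)
      then show "u \<oplus> v \<in> ?J" using additive_subgroup.a_closed[OF ideal.axioms(1)[OF I] u(2) v(2)]
          lspan_add[OF qc q_add ms(1) u(3) v(3)] by blast }
    assume v: "v \<in> carrier R"
    have "v \<otimes> u = v \<otimes> y \<oplus> v \<otimes> z" unfolding u(1) using uc v by (simp add: r_distr)
    then show vu: "v \<otimes> u \<in> ?J" using ideal.I_l_closed[OF I u(2) v] qR_scale[OF v u(3)] by blast
    show "u \<otimes> v \<in> ?J" using vu m_comm[of u v] u(1) uc v by simp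
  qed
  have disj: "?J \<inter> (K - q) = {}"
  proof (rule ccontr)
    assume "\<not> ?thesis"
    then obtain y z where yz: "y \<in> I" "z \<in> ?qR" "y \<oplus> z \<in> K" "y \<oplus> z \<notin> q" by auto
    let ?s = "y \<oplus> z"
    have c: "y \<in> carrier R" "z \<in> carrier R" using ideal.Icarr[OF I yz(1)] yz(2) qRc by auto
    have "\<exists>(n'::nat) u. u \<in> K - q \<and> (\<forall>m\<in>set ms. u \<otimes> m \<in> I)"
    proof (rule elimination[where P = I and U = "\<lambda>_. K - q" and Q = "\<lambda>_. q" and s = ?s and n = 0
        and ms = ms,
          OF I _ qc q_add _ _ _ _ ms(1)])
      show "K - q \<subseteq> carrier R" using Kf(1) by auto
      show "u \<ominus> c \<in> K - q" if "u \<in> K - q" "c \<in> q" for u c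
      proof -
        have uc: "u \<in> carrier R" "c \<in> carrier R" using that Kf(1) qc by auto
        have "u \<ominus> c \<in> K" using that qK Kf(5,7) by (auto simp: minus_eq)
        moreover have "u = (u \<ominus> c) \<oplus> c" using uc by (simp add: minus_eq a_assoc l_neg)
        then have "u \<ominus> c \<notin> q" using q_add[of "u \<ominus> c" c] that by auto
        ultimately show ?thesis by simp
      qed
      show "u \<otimes> v \<in> K - q" if "u \<in> K - q" "v \<in> K - q" for u v using that Kf(6) q_prime by blast
      show "u \<otimes> c \<in> q" if "u \<in> K - q" "c \<in> q" for u c using that q_mult by blast
      show "u \<otimes> c \<in> q" if "u \<in> q" "c \<in> q" for u c using that q_mult qK by blast
      show "?s \<in> K - q" using yz by simp
      fix m assume m: "m \<in> set ms"
      have mc: "m \<in> carrier R" using m ms(1) by auto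
      have "?s \<otimes> m \<ominus> m \<otimes> z = m \<otimes> y" using c mc
          by (simp add: minus_eq m_comm[of _ m] r_distr a_assoc r_neg)
      then show "\<exists>y'\<in>lspan q ms. ?s \<otimes> m \<ominus> y' \<in> I"
        using ideal.I_l_closed[OF I yz(1) mc] qR_scale[OF mc yz(2)]
            by (intro bexI[of _ "m \<otimes> z"]) auto
    qed
    then obtain u where u: "u \<in> K" "u \<notin> q" "\<And>m. m \<in> set ms \<Longrightarrow> u \<otimes> m \<in> I" by auto
    have uc: "u \<in> carrier R" using u Kf(1) by auto
    have "lspan K ms \<subseteq> {z \<in> carrier R. u \<otimes> z \<in> I}"
    proof (rule lspan_minimal)
      show "\<zero> \<in> {z \<in> carrier R. u \<otimes> z \<in> I}"
          using uc additive_subgroup.zero_closed[OF ideal.axioms(1)[OF I]] by simp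
      show "x \<oplus> y \<in> {z \<in> carrier R. u \<otimes> z \<in> I}"
          if "x \<in> {z \<in> carrier R. u \<otimes> z \<in> I}" "y \<in> {z \<in> carrier R. u \<otimes> z \<in> I}" for x y
        using that uc additive_subgroup.a_closed[OF ideal.axioms(1)[OF I]] by (simp add: r_distr)
      fix k m assume k: "k \<in> K" and m: "m \<in> set ms"
      have kc: "k \<in> carrier R" "m \<in> carrier R" using k Kf(1) m ms(1) by auto
      have "u \<otimes> (k \<otimes> m) = k \<otimes> (u \<otimes> m)" using kc uc by (simp add: m_lcomm)
      then show "k \<otimes> m \<in> {z \<in> carrier R. u \<otimes> z \<in> I}"
          using kc ideal.I_l_closed[OF I u(3)[OF m] kc(1)] by simp
    qed
    then have "u \<otimes> \<one> \<in> I" using ms(2) by blast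
    then show False using u uc Iq by auto
  qed
  obtain P where P: "primeideal P R" "?J \<subseteq> P" "P \<inter> (K - q) = {}"
  proof (rule prime_avoiding[OF J _ _ _ disj])
    show "K - q \<subseteq> carrier R" using Kf(1) by auto
    show "\<one> \<in> K - q" using Kf(3) q_one by simp
    show "a \<otimes> b \<in> K - q" if "a \<in> K - q" "b \<in> K - q" for a b using that Kf(6) q_prime by blast
  qed
  have "I \<subseteq> ?J"
  proof
    fix y assume y: "y \<in> I"
    have "y = y \<oplus> \<zero>" using ideal.Icarr[OF I y] by simp
    then show "y \<in> ?J" using y lspan_zero[OF q_zero ms(1)] by blast
  qed
  moreover have "q \<subseteq> ?J"
  proof
    fix y assume y: "y \<in> q"
    have yc: "y \<in> carrier R" using y qc by auto
    have "y \<otimes> \<one> \<in> ?qR"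
    proof (rule lspan_scale[OF Kf(1) yc _ ms(1)])
      show "y \<otimes> k \<in> q" if "k \<in> K" for k using q_mult[OF that y] m_comm[OF yc] that Kf(1)
          by (metis subsetD)
      show "\<one> \<in> lspan K ms" using ms(2) by auto
    qed
    moreover have "y = \<zero> \<oplus> y \<otimes> \<one>" using yc by simp
    ultimately show "y \<in> ?J" using additive_subgroup.zero_closed[OF ideal.axioms(1)[OF I]] by blast
  qed
  ultimately show thesis using that[OF P(1)] P(2,3) qK by blast
qed

text \<open>For \<open>x\<close> in \<open>P' - P\<close> no monic expression in \<open>x\<close> lies in \<open>P\<close>: the constant term of one that
  does is in \<open>P' \<inter> K = P \<inter> K\<close>, so the factor \<open>x\<close> can be cancelled and the degree drops.\<close>

lemma incomparable:
  assumes P: "primeideal P R" and P': "ideal P' R" and sub: "P \<subseteq> P'" and eq: "P \<inter> K = P' \<inter> K"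
      and one: "\<one> \<notin> P'"
  shows "P = P'"
proof (rule ccontr)
  assume "P \<noteq> P'"
  then obtain x where x: "x \<in> P'" "x \<notin> P" using sub by auto
  have xc: "x \<in> carrier R" by (rule ideal.Icarr[OF P' x(1)])
  interpret x: subring_point R K x by (intro subring_point.intro subring_point_axioms.intro
      is_cring K xc)
  have "u \<notin> P" if "u \<in> monics K x n" for n u using that
  proof (induction n arbitrary: u)
    case 0 then show ?case using one sub by auto
  next
    case (Suc n)
    then obtain y k where h: "u = x \<otimes> y \<oplus> k" "y \<in> monics K x n" "k \<in> K" by auto
    have c: "y \<in> carrier R" "k \<in> carrier R" using h x.monics_carrier x.Kc by blast+
    show ?case
    proof
      assume u: "u \<in> P"
      have xy: "x \<otimes> y \<in> P'" by (rule ideal.I_r_closed[OF P' x(1) c(1)])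
      have "k \<oplus> x \<otimes> y \<in> P'" using u sub c xc h(1) by (auto simp: a_comm)
      then have "k \<in> P'" using ideal.mem_if_add_mem[OF P' c(2) _ xy] by simp
      then have "k \<in> P" using h(3) eq by blast
      then have "x \<otimes> y \<in> P" using ideal.mem_if_add_mem[OF primeideal.axioms(1)[OF P], of "x \<otimes> y"
          k] u h(1) xc c by simp
      then show False using primeideal.I_prime[OF P xc c(1)] x(2) Suc.IH[OF h(2)] by simp
    qed
  qed
  moreover obtain n where "\<zero> \<in> monics K x n" using integral[OF xc] by blast
  moreover have "\<zero> \<in> P" using additive_subgroup.zero_closed[OF ideal.axioms(1)[OF
      primeideal.axioms(1)[OF P]]] .
  ultimately show False by blast
qed

lemma prime_one: "primeideal P R \<Longrightarrow> \<one> \<notin> P"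
  using primeideal.I_notcarr ideal.one_imp_carrier primeideal.axioms(1) by metis

lemma chain_contract:
  assumes "prime_chain R n d" shows "prime_chain RK n (\<lambda>k. d k \<inter> K)"
  unfolding prime_chain_def
proof (intro conjI allI impI)
  fix k assume "k \<le> n"
  then show "primeideal (d k \<inter> K) RK" using assms contract_prime[OF K]
      by (simp add: prime_chain_def)
next
  fix k assume k: "k < n"
  have p: "primeideal (d k) R" "primeideal (d (Suc k)) R" "d k \<subset> d (Suc k)" using assms k
      by (auto simp: prime_chain_def)
  then show "d k \<inter> K \<subset> d (Suc k) \<inter> K"
    using incomparable[OF p(1) primeideal.axioms(1)[OF p(2)] _ _ prime_one[OF p(2)]] by blast
qed

text \<open>Chains are lifted from the bottom by repeated going up.\<close>

lemma chain_lift: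
  assumes "prime_chain RK n c"
  shows "\<exists>d. prime_chain R n d \<and> (\<forall>k\<le>n. d k \<inter> K = c k)"
  using assms
proof (induction n)
  case 0
  then have q: "primeideal (c 0) RK" by (simp add: prime_chain_def)
  have "\<zero> \<in> c 0" using additive_subgroup.zero_closed[OF ideal.axioms(1)[OF primeideal.axioms(1)[OF
      q]]] by simp
  then obtain P where "primeideal P R" "P \<inter> K = c 0" using lie_over[OF zeroideal q] by auto
  then show ?case by (intro exI[of _ "\<lambda>_. P"]) (simp add: prime_chain_def)
next
  case (Suc n)
  then have "prime_chain RK n c" by (simp add: prime_chain_def)
  then obtain d where d: "prime_chain R n d" "\<forall>k\<le>n. d k \<inter> K = c k" using Suc.IH by blast
  have q: "primeideal (c (Suc n)) RK" and s: "c n \<subset> c (Suc n)" using Suc.prems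
      by (auto simp: prime_chain_def)
  have dn: "primeideal (d n) R" "d n \<inter> K = c n" using d by (auto simp: prime_chain_def)
  obtain P where P: "primeideal P R" "d n \<subseteq> P" "P \<inter> K = c (Suc n)"
    using lie_over[OF primeideal.axioms(1)[OF dn(1)] q] dn s by blast
  have "d n \<subset> P" using P dn s by blast
  then have "prime_chain R (Suc n) (d(Suc n := P))" using d(1) P(1)
    by (auto simp: prime_chain_def le_Suc_eq less_Suc_eq)
  moreover have "\<forall>k\<le>Suc n. (d(Suc n := P)) k \<inter> K = c k" using d(2) P(3) by (auto simp: le_Suc_eq)
  ultimately show ?case by blast
qed

lemma krull_dim_eq: "krull_dim RK = krull_dim R"
proof -
  have "(\<exists>c. prime_chain RK n c) \<longleftrightarrow> (\<exists>d. prime_chain R n d)" for n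
    using chain_lift chain_contract by blast
  then show ?thesis by (simp add: krull_dim_def)
qed

text \<open>The lift of a chain that ends in \<open>p \<inter> K\<close> ends in a prime over \<open>p \<inter> K\<close>, which is \<open>p\<close>. So
  going up suffices, where for general primes one needs going down.\<close>

lemma height_eq:
  assumes p: "primeideal p R" and uniq: "\<And>P. primeideal P R \<Longrightarrow> P \<inter> K = p \<inter> K \<Longrightarrow> P = p"
  shows "height RK (p \<inter> K) = height R p"
proof -
  have "(\<exists>c. prime_chain RK n c \<and> c n = p \<inter> K) \<longleftrightarrow> (\<exists>d. prime_chain R n d \<and> d n = p)" for n
  proof
    assume "\<exists>c. prime_chain RK n c \<and> c n = p \<inter> K"
    then obtain c where c: "prime_chain RK n c" "c n = p \<inter> K" by blast
    obtain d where d: "prime_chain R n d" "\<forall>k\<le>n. d k \<inter> K = c k" using chain_lift[OF c(1)] by blast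
    have "d n = p" using d c(2) by (intro uniq) (auto simp: prime_chain_def)
    then show "\<exists>d. prime_chain R n d \<and> d n = p" using d by blast
  next
    assume "\<exists>d. prime_chain R n d \<and> d n = p"
    then obtain d where d: "prime_chain R n d" "d n = p" by blast
    then show "\<exists>c. prime_chain RK n c \<and> c n = p \<inter> K" using chain_contract[OF d(1)]
        by (intro exI[of _ "\<lambda>k. d k \<inter> K"]) simp
  qed
  then show ?thesis by (simp add: height_def)
qed

end

lemma (in cring) pow_spanning:
  assumes B: "subring B R" and x: "x \<in> carrier R" and n: "0 < (n::nat)" "x [^] n \<in> B"
  shows "subring (lspan B (map (\<lambda>e. x [^] e) [0..<n])) R"
proof -
  note Bf = subringE[OF B]
  let ?xs = "map (\<lambda>e. x [^] e) [0..<n]"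
  let ?L = "lspan B ?xs"
  have xs: "set ?xs \<subseteq> carrier R" using x by auto
  have Lc: "?L \<subseteq> carrier R" by (rule lspan_closed[OF Bf(1) xs])
  have pow: "b \<otimes> x [^] (j::nat) \<in> ?L" if b: "b \<in> B" for b j
  proof -
    have "x [^] j = (x [^] n) [^] (j div n) \<otimes> x [^] (j mod n)"
      using x by (simp add: nat_pow_pow nat_pow_mult)
    moreover have "(x [^] n) [^] k \<in> B" for k :: nat by (induction k) (use Bf n in auto)
    ultimately have "b \<otimes> x [^] j = (b \<otimes> (x [^] n) [^] (j div n)) \<otimes> x [^] (j mod n)"
        "b \<otimes> (x [^] n) [^] (j div n) \<in> B"
      using b Bf x by (auto simp: m_assoc subset_iff)
    moreover have "x [^] (j mod n) \<in> set ?xs" using n by auto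
    ultimately show ?thesis using lspan_mem[OF Bf(1,2) xs] by metis
  qed
  have Ladd: "a \<oplus> b \<in> ?L" if "a \<in> ?L" "b \<in> ?L" for a b by (rule lspan_add[OF Bf(1,7) xs that])
  have L0: "\<zero> \<in> ?L" by (rule lspan_zero[OF Bf(2) xs])
  have Lmul: "a \<otimes> b \<in> ?L" if a: "a \<in> ?L" and b: "b \<in> ?L" for a b
  proof -
    have "?L \<subseteq> {a \<in> carrier R. a \<otimes> b \<in> ?L}"
    proof (rule lspan_minimal)
      show "\<zero> \<in> {a \<in> carrier R. a \<otimes> b \<in> ?L}" using b Lc L0 by auto
      show "u \<oplus> v \<in> {a \<in> carrier R. a \<otimes> b \<in> ?L}"
          if "u \<in> {a \<in> carrier R. a \<otimes> b \<in> ?L}" "v \<in> {a \<in> carrier R. a \<otimes> b \<in> ?L}" for u v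
        using that b Lc Ladd by (auto simp: l_distr subset_iff)
      fix k m assume k: "k \<in> B" and "m \<in> set ?xs"
      then obtain e :: nat where m: "m = x [^] e" by auto
      have kc: "k \<in> carrier R" using k Bf by auto
      have "?L \<subseteq> {b \<in> carrier R. k \<otimes> m \<otimes> b \<in> ?L}"
      proof (rule lspan_minimal)
        show "\<zero> \<in> {b \<in> carrier R. k \<otimes> m \<otimes> b \<in> ?L}" using kc m x L0 by auto
        show "u \<oplus> v \<in> {b \<in> carrier R. k \<otimes> m \<otimes> b \<in> ?L}"
            if "u \<in> {b \<in> carrier R. k \<otimes> m \<otimes> b \<in> ?L}" "v \<in> {b \<in> carrier R. k \<otimes> m \<otimes> b \<in> ?L}" for u v
          using that kc m x Ladd by (auto simp: r_distr)
        fix l m' assume l: "l \<in> B" and "m' \<in> set ?xs"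
        then obtain f :: nat where m': "m' = x [^] f" by auto
        have lc: "l \<in> carrier R" using l Bf by auto
        have "k \<otimes> m \<otimes> (l \<otimes> m') = (k \<otimes> l) \<otimes> x [^] (e + f)"
          using kc lc x by (simp add: m m' nat_pow_mult[symmetric] m_ac)
        then show "l \<otimes> m' \<in> {b \<in> carrier R. k \<otimes> m \<otimes> b \<in> ?L}" using pow[OF Bf(6)[OF k l]] lc m' x
            by auto
      qed
      then show "k \<otimes> m \<in> {a \<in> carrier R. a \<otimes> b \<in> ?L}" using b kc m x by auto
    qed
    then show ?thesis using a by auto
  qed
  show ?thesis
  proof (rule subringI[OF Lc])
    show one: "\<one> \<in> ?L" using pow[OF Bf(3), of 0] by simp
    have mone: "\<ominus> \<one> \<in> ?L" using pow[OF Bf(5)[OF Bf(3)], of 0] by simp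
    fix h assume h: "h \<in> ?L"
    have "\<ominus> h = (\<ominus> \<one>) \<otimes> h" using h Lc by (auto simp: l_minus)
    then show "\<ominus> h \<in> ?L" using Lmul[OF mone h] by simp
  qed (use Lmul Ladd in auto)
qed

text \<open>The generators are adjoined one at a time, by \<open>pow_spanning\<close>; products of module generators
  generate over the smaller ring.\<close>

lemma (in cring) finite_generation:
  assumes K: "subring K R" and Z: "finite Z" "Z \<subseteq> carrier R"
      and pw: "\<And>x. x \<in> Z \<Longrightarrow> \<exists>n>0. x [^] (n::nat) \<in> K"
    and gen: "generate_ring R (K \<union> Z) = carrier R"
  shows "\<exists>ms. set ms \<subseteq> carrier R \<and> carrier R \<subseteq> lspan K ms"
proof -
  note Kf = subringE[OF K]
  have "\<exists>B ms. subring B R \<and> K \<subseteq> B \<and> Z \<subseteq> B \<and> set ms \<subseteq> carrier R \<and> B \<subseteq> lspan K ms"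
    using Z pw
  proof (induction Z rule: finite_induct)
    case empty
    have "K \<subseteq> lspan K [\<one>]" using Kf(1) by force
    then show ?case using K by (intro exI[of _ K] exI[of _ "[\<one>]"]) simp
  next
    case (insert x Z)
    obtain B ms where B: "subring B R" "K \<subseteq> B" "Z \<subseteq> B" "set ms \<subseteq> carrier R" "B \<subseteq> lspan K ms"
      using insert.IH insert.prems by auto
    note Bf = subringE[OF B(1)]
    obtain n :: nat where n: "0 < n" "x [^] n \<in> K" using insert.prems by blast
    have xc: "x \<in> carrier R" using insert.prems by simp
    let ?xs = "map (\<lambda>e. x [^] e) [0..<n]"
    have xs: "set ?xs \<subseteq> carrier R" using xc by auto
    let ?L = "lspan B ?xs"
    have L: "subring ?L R" using pow_spanning[OF B(1) xc n(1)] n(2) B(2) by blast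
    have bL: "b \<in> ?L" if "b \<in> B" for b
    proof -
      have "b \<otimes> \<one> \<in> ?L" using n by (intro lspan_mem[OF Bf(1,2) xs that]) (auto intro!:
          image_eqI[of _ _ 0])
      then show ?thesis using that Bf(1) by auto
    qed
    have xL: "x \<in> ?L"
    proof (cases "n = 1")
      case True
      then show ?thesis using bL n B(2) xc by auto
    next
      case False
      then have "\<one> \<otimes> x \<in> ?L" using n xc by (intro lspan_mem[OF Bf(1,2) xs Bf(3)]) (auto intro!:
          image_eqI[of _ _ 1])
      then show ?thesis using xc by simp
    qed
    define ms' where "ms' = concat (map (\<lambda>y. map (\<lambda>m. m \<otimes> y) ms) ?xs)"
    have ms'c: "set ms' \<subseteq> carrier R" using xs B(4) by (auto simp: ms'_def)
    have K0: "\<zero> \<in> lspan K ms'" by (rule lspan_zero[OF Kf(2) ms'c])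
    have Kadd: "a \<oplus> b \<in> lspan K ms'" if "a \<in> lspan K ms'" "b \<in> lspan K ms'" for a b
      by (rule lspan_add[OF Kf(1,7) ms'c that])
    have "?L \<subseteq> lspan K ms'"
    proof (rule lspan_minimal[OF K0 Kadd])
      fix k y assume k: "k \<in> B" and y: "y \<in> set ?xs"
      have yc: "y \<in> carrier R" using y xs by auto
      have "lspan K ms \<subseteq> {k \<in> carrier R. k \<otimes> y \<in> lspan K ms'}"
      proof (rule lspan_minimal)
        show "\<zero> \<in> {k \<in> carrier R. k \<otimes> y \<in> lspan K ms'}" using K0 yc by simp
        show "a \<oplus> b \<in> {k \<in> carrier R. k \<otimes> y \<in> lspan K ms'}"
            if "a \<in> {k \<in> carrier R. k \<otimes> y \<in> lspan K ms'}" "b \<in> {k \<in> carrier R. k \<otimes> y \<in>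
            lspan K ms'}" for a b
          using that Kadd yc by (simp add: l_distr)
        fix l m assume l: "l \<in> K" and m: "m \<in> set ms"
        have c: "l \<in> carrier R" "m \<in> carrier R" using l m Kf(1) B(4) by auto
        have "m \<otimes> y \<in> set ms'" using m y by (auto simp: ms'_def)
        then have "l \<otimes> (m \<otimes> y) \<in> lspan K ms'" by (rule lspan_mem[OF Kf(1,2) ms'c l])
        then show "l \<otimes> m \<in> {k \<in> carrier R. k \<otimes> y \<in> lspan K ms'}" using c yc by (simp add: m_assoc)
      qed
      then show "k \<otimes> y \<in> lspan K ms'" using k B(5) by blast
    qed
    then show ?case using L bL xL B(2,3) ms'c by (intro exI[of _ ?L] exI[of _ ms']) blast
  qed
  then obtain B ms where B: "subring B R" "K \<subseteq> B" "Z \<subseteq> B" "set ms \<subseteq> carrier R" "B \<subseteq> lspan K ms"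
      by blast
  have "carrier R \<subseteq> B" using generate_ring_min_subring1[of "K \<union> Z" B] B Kf(1) Z gen by simp
  then show ?thesis using B by blast
qed

section \<open>Rings generated in unit degrees\<close>

lemma (in primeideal) pow_mem: "y \<in> carrier R \<Longrightarrow> y [^] (n::nat) \<in> I \<Longrightarrow> y \<in> I"
proof (induction n)
  case 0
  then show ?case using one_imp_carrier I_notcarr by auto
next
  case (Suc n)
  then show ?case using I_prime[of "y [^] n" y] by auto
qed

definition unit_deg :: "nat \<Rightarrow> mdeg" where
  "unit_deg i = (\<lambda>k. if k = i then 1 else 0)"

lemma unit_deg_Nvec: "i \<in> {1..r} \<Longrightarrow> unit_deg i \<in> Nvec r"
  by (auto simp: unit_deg_def Nvec_def Zvec_def)

definition dilate :: "mdeg \<Rightarrow> mdeg \<Rightarrow> mdeg" where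
  "dilate a n = (\<lambda>i. a i * n i)"

locale std_graded = multigraded_ring S r G for S (structure) and r G +
  fixes \<mu> :: "nat \<Rightarrow> nat" and g :: "nat \<Rightarrow> nat \<Rightarrow> 'a"
  assumes g_G: "i \<in> {1..r} \<Longrightarrow> j \<in> {1..\<mu> i} \<Longrightarrow> g i j \<in> G (unit_deg i)"
    and gen: "generate_ring S (G deg_zero \<union> {g i j | i j. i \<in> {1..r} \<and> j \<in> {1..\<mu> i}}) = carrier S"
begin

abbreviation "gens \<equiv> {g i j | i j. i \<in> {1..r} \<and> j \<in> {1..\<mu> i}}"

lemma gens_carrier: "gens \<subseteq> carrier S"
  using g_G G_carrier unit_deg_Nvec by blast

lemma gens_finite: "finite gens"
proof -
  have "gens = (\<Union>i\<in>{1..r}. g i ` {1..\<mu> i})" by blast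
  then show ?thesis by simp
qed

text \<open>Every element of \<open>S\<close> is a sum \<open>z + w\<close> with \<open>z\<close> supported in degrees whose \<open>i\<close>-th entry is
  zero and \<open>w\<close> in the ideal of the \<open>i\<close>-th generators: such sums form a subring that contains all
  generators.\<close>

lemma homog_in_gen_ideal:
  assumes i: "i \<in> {1..r}" and d: "d \<in> Nvec r" "d i \<noteq> 0" and y: "y \<in> G d"
  shows "y \<in> Idl (g i ` {1..\<mu> i})"
proof -
  let ?X = "g i ` {1..\<mu> i}" and ?E = "{e. e i = 0}"
  have Xc: "?X \<subseteq> carrier S" using gens_carrier i by blast
  let ?I = "Idl ?X"
  have I: "ideal ?I S" by (rule genideal_ideal[OF Xc])
  note Ia = additive_subgroup.a_closed[OF ideal.axioms(1)[OF I]]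
  note I0 = additive_subgroup.zero_closed[OF ideal.axioms(1)[OF I]]
  let ?Z = "{x \<in> carrier S. supp x \<subseteq> ?E}"
  have Z: "subring ?Z S" by (rule supported_subring) auto
  note Zf = subringE[OF Z]
  let ?B = "{z \<oplus> w | z w. z \<in> ?Z \<and> w \<in> ?I}"
  have B: "subring ?B S"
  proof (rule subringI)
    show "?B \<subseteq> carrier S" using Zf(1) ideal.Icarr[OF I] by auto
    have "\<one> = \<one> \<oplus> \<zero>" by simp
    then show "\<one> \<in> ?B" using Zf(3) I0 by blast
    fix u v assume "u \<in> ?B"
    then obtain z w where u: "u = z \<oplus> w" "z \<in> ?Z" "w \<in> ?I" by auto
    have uc: "z \<in> carrier S" "w \<in> carrier S" using u ideal.Icarr[OF I] by auto
    have "\<ominus> u = \<ominus> z \<oplus> \<ominus> w" unfolding u(1) using uc by (simp add: minus_add)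
    moreover have "\<ominus> w = (\<ominus> \<one>) \<otimes> w" using uc by (simp add: l_minus)
    then have "\<ominus> w \<in> ?I" using ideal.I_l_closed[OF I u(3), of "\<ominus> \<one>"] by simp
    ultimately show "\<ominus> u \<in> ?B" using Zf(5)[OF u(2)] by blast
    assume "v \<in> ?B"
    then obtain z' w' where v: "v = z' \<oplus> w'" "z' \<in> ?Z" "w' \<in> ?I" by auto
    have vc: "z' \<in> carrier S" "w' \<in> carrier S" using v ideal.Icarr[OF I] by auto
    have "u \<oplus> v = (z \<oplus> z') \<oplus> (w \<oplus> w')" unfolding u(1) v(1) using uc vc by (simp add: a_ac)
    then show "u \<oplus> v \<in> ?B" using Zf(7)[OF u(2) v(2)] Ia[OF u(3) v(3)] by blast
    have "u \<otimes> v = z \<otimes> z' \<oplus> (z \<otimes> w' \<oplus> (z' \<oplus> w') \<otimes> w)" unfolding u(1) v(1) using uc vc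
        by (simp add: l_distr r_distr m_comm a_ac)
    moreover have "z \<otimes> w' \<oplus> (z' \<oplus> w') \<otimes> w \<in> ?I"
      using Ia ideal.I_l_closed[OF I] u(3) v(3) uc vc by simp
    ultimately show "u \<otimes> v \<in> ?B" using Zf(6)[OF u(2) v(2)] by blast
  qed
  have ZB: "z \<in> ?B" if "z \<in> ?Z" for z
  proof -
    have "z = z \<oplus> \<zero>" using that by simp
    then show ?thesis using that I0 by blast
  qed
  have sub: "G deg_zero \<union> gens \<subseteq> ?B"
  proof
    fix y assume "y \<in> G deg_zero \<union> gens"
    then consider "y \<in> G deg_zero" | k j where "k \<in> {1..r}" "j \<in> {1..\<mu> k}" "y = g k j" by auto
    then show "y \<in> ?B"
    proof cases
      case 1
      then show ?thesis using supp_homog[OF Nvec_zero 1] G_carrier[OF Nvec_zero 1]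
          by (intro ZB) auto
    next
      case 2
      have yG: "y \<in> G (unit_deg k)" using g_G 2 by simp
      note yc = G_carrier[OF unit_deg_Nvec[OF 2(1)] yG]
      show ?thesis
      proof (cases "k = i")
        case True
        then have "y \<in> ?I" using 2 genideal_self[OF Xc] by auto
        moreover have "y = \<zero> \<oplus> y" using yc by simp
        ultimately show ?thesis using Zf(2) by blast
      next
        case False
        then have "unit_deg k \<in> ?E" by (simp add: unit_deg_def)
        then show ?thesis using supp_homog[OF unit_deg_Nvec[OF 2(1)] yG] yc by (intro ZB) auto
      qed
    qed
  qed
  have "G deg_zero \<union> gens \<subseteq> carrier S" using gens_carrier G_carrier[OF Nvec_zero] by blast
  from generate_ring_min_subring1[OF this B sub] have "carrier S \<subseteq> ?B" unfolding gen .
  then have "y \<in> ?B" using G_carrier[OF d(1) y] by blast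
  then obtain z w where zw: "y = z \<oplus> w" "z \<in> ?Z" "w \<in> ?I" by auto
  have c: "z \<in> carrier S" "w \<in> carrier S" using zw ideal.Icarr[OF I] by auto
  have "hcomp d z = \<zero>" using zw(2) d(2) by (auto simp: supp_def)
  then have "y = hcomp d w" using hcomp_homog[OF d(1) y, of d] c zw(1) by simp
  moreover have "?X \<subseteq> (\<Union>d \<in> Nvec r. G d)"
  proof
    fix z assume "z \<in> ?X"
    then have "z \<in> G (unit_deg i)" using g_G[OF i] by blast
    then show "z \<in> (\<Union>d \<in> Nvec r. G d)" by (rule UN_I[OF unit_deg_Nvec[OF i]])
  qed
  then have "homogeneous_ideal (Nvec r) S G ?I" by (rule genideal_homogeneous)
  ultimately show ?thesis using zw(3) by (simp add: homogeneous_ideal_iff)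
qed

lemma Proj_gen_notin:
  assumes p: "p \<in> Proj r S G" and i: "i \<in> {1..r}"
  obtains j where "j \<in> {1..\<mu> i}" "g i j \<notin> p"
proof -
  have pr: "primeideal p S" using p by (simp add: Proj_iff)
  obtain d where d: "d \<in> Nvec r" "d i \<noteq> 0" "\<not> G d \<subseteq> p" using p i unfolding Proj_iff by blast
  then obtain y where y: "y \<in> G d" "y \<notin> p" by auto
  have "\<exists>j\<in>{1..\<mu> i}. g i j \<notin> p"
  proof (rule ccontr)
    assume "\<not> ?thesis"
    then have "g i ` {1..\<mu> i} \<subseteq> p" by auto
    then have "Idl (g i ` {1..\<mu> i}) \<subseteq> p" by (rule genideal_minimal[OF primeideal.axioms(1)[OF pr]])
    then show False using homog_in_gen_ideal[OF i d(1,2) y(1)] y(2) by auto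
  qed
  then show thesis using that by blast
qed

text \<open>The monomials in one generator \<open>g i j\<close> outside \<open>p\<close> for each \<open>i\<close>.\<close>

lemma graded_point_exists:
  assumes p: "p \<in> Proj r S G"
  obtains x where "graded_point S r G p x"
proof -
  have pr: "primeideal p S" "\<forall>y\<in>p. \<forall>d. hcomp d y \<in> p" using p by (auto simp: Proj_iff)
  have "\<exists>j. i \<in> {1..r} \<longrightarrow> j \<in> {1..\<mu> i} \<and> g i j \<notin> p" for i using Proj_gen_notin[OF p] by metis
  then obtain j where j: "\<And>i. i \<in> {1..r} \<Longrightarrow> j i \<in> {1..\<mu> i} \<and> g i (j i) \<notin> p" by metis
  define h where "h i = g i (j i)" for i
  have h: "h i \<in> G (unit_deg i)" "h i \<notin> p" "h i \<in> carrier S" if "i \<in> {1..r}" for i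
    using g_G[OF that] j[OF that] G_carrier[OF unit_deg_Nvec[OF that]] by (auto simp: h_def)
  define x where "x d = (\<Otimes>i\<in>{1..r}. h i [^] nat (d i))" for d :: mdeg
  have "(\<Otimes>i\<in>F. h i [^] nat (d i)) \<in> G (\<lambda>i.
      if i \<in> F then d i else 0) \<and> (\<Otimes>i\<in>F. h i [^] nat (d i)) \<notin> p"
    if "finite F" "F \<subseteq> {1..r}" "d \<in> Nvec r" for F d using that
  proof (induction F rule: finite_induct)
    case empty
    then show ?case using ideal.one_imp_carrier[OF primeideal.axioms(1)[OF pr(1)]]
        primeideal.I_notcarr[OF pr(1)] by auto
  next
    case (insert k F)
    let ?P = "\<Otimes>i\<in>F. h i [^] nat (d i)"
    have k: "k \<in> {1..r}" using insert.prems by auto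
    have Pc: "?P \<in> carrier S" using insert.prems h by (intro finprod_closed) auto
    have IH: "?P \<in> G (\<lambda>i. if i \<in> F then d i else 0)" "?P \<notin> p" using insert by auto
    have dk: "0 \<le> d k" using insert.prems by (simp add: Nvec_def)
    have hG: "h k [^] nat (d k) \<in> G (\<lambda>i. d k * unit_deg k i)"
      using G_pow[OF unit_deg_Nvec[OF k] h(1)[OF k], of "nat (d k)"] dk by simp
    have N1: "(\<lambda>i. d k * unit_deg k i) \<in> Nvec r" using k dk
        by (auto simp: unit_deg_def Nvec_def Zvec_def)
    have N2: "(\<lambda>i. if i \<in> F then d i else 0) \<in> Nvec r" using insert.prems
        by (auto simp: Nvec_def Zvec_def)
    have eq: "(\<Otimes>i\<in>insert k F. h i [^] nat (d i)) = h k [^] nat (d k) \<otimes> ?P"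
      using insert h by (intro finprod_insert) auto
    have "deg_add (\<lambda>i. d k * unit_deg k i) (\<lambda>i. if i \<in> F then d i else 0) = (\<lambda>i.
        if i \<in> insert k F then d i else 0)"
      using insert(2) by (auto simp: unit_deg_def)
    then have "h k [^] nat (d k) \<otimes> ?P \<in> G (\<lambda>i. if i \<in> insert k F then d i else 0)"
      using G_mult[OF N1 N2 hG IH(1)] by simp
    moreover have "h k [^] nat (d k) \<notin> p" using primeideal.pow_mem[OF pr(1) h(3)[OF k]] h(2)[OF k]
        by blast
    then have "h k [^] nat (d k) \<otimes> ?P \<notin> p"
      using primeideal.I_prime[OF pr(1) nat_pow_closed[OF h(3)[OF k]] Pc] IH(2) by blast
    ultimately show ?case unfolding eq by blast
  qed
  from this[of "{1..r}"] have xx: "x d \<in> G (\<lambda>i. if i \<in> {1..r} then d i else 0)" "x d \<notin> p"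
      if "d \<in> Nvec r" for d
    using that by (auto simp: x_def)
  have "(\<lambda>i. if i \<in> {1..r} then d i else 0) = d" if "d \<in> Nvec r" for d
    using that by (auto simp: Nvec_def Zvec_def)
  then have x1: "x d \<in> G d" "x d \<notin> p" if "d \<in> Nvec r" for d using xx[OF that] that by auto
  have x2: "x deg_zero = \<one>" by (simp add: x_def finprod_one_eqI)
  have x3: "x (deg_add d e) = x d \<otimes> x e" if "d \<in> Nvec r" "e \<in> Nvec r" for d e
  proof -
    have "x (deg_add d e) = (\<Otimes>i\<in>{1..r}. h i [^] nat (d i) \<otimes> h i [^] nat (e i))"
      unfolding x_def
    proof (rule finprod_cong'[OF refl])
      show "(\<lambda>i. h i [^] nat (d i) \<otimes> h i [^] nat (e i)) \<in> {1..r} \<rightarrow> carrier S"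
        by (intro Pi_I m_closed nat_pow_closed h(3))
      fix i assume i: "i \<in> {1..r}"
      have "nat (d i + e i) = nat (d i) + nat (e i)"
        using that by (intro nat_add_distrib) (simp_all add: Nvec_def)
      then show "h i [^] nat (d i + e i) = h i [^] nat (d i) \<otimes> h i [^] nat (e i)"
        by (simp only: nat_pow_mult[OF h(3)[OF i]])
    qed
    also have "\<dots> = x d \<otimes> x e" unfolding x_def by (intro finprod_multf Pi_I nat_pow_closed h(3))
    finally show ?thesis .
  qed
  have "graded_point S r G p x"
    using pr x1 x2 x3 by (intro graded_point.intro graded_point_axioms.intro
        multigraded_ring_axioms) auto
  then show thesis by (rule that)
qed

end

section \<open>Veronese subrings\<close>

locale veronese = std_graded S r G \<mu> g for S (structure) and r G \<mu> g +
  fixes a :: mdeg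
  assumes a: "a \<in> Nvec_pos r"
begin

definition W :: "'a set" where "W = {x \<in> carrier S. supp x \<subseteq> dilate a ` Nvec r}"

abbreviation "V \<equiv> S\<lparr>carrier := W\<rparr>"
abbreviation "GV \<equiv> (\<lambda>n. G (dilate a n))"

lemma a_pos: "i \<in> {1..r} \<Longrightarrow> 0 < a i"
  using a by (simp add: Nvec_pos_def)

lemma a_out: "i \<notin> {1..r} \<Longrightarrow> a i = 0"
  using a by (simp add: Nvec_pos_def Zvec_def)

lemma dilate_Nvec: "n \<in> Nvec r \<Longrightarrow> dilate a n \<in> Nvec r"
  unfolding Nvec_def Zvec_def dilate_def using a_pos a_out
  by (auto intro!: mult_nonneg_nonneg) (metis less_eq_int_def linorder_not_less
      not_less_iff_gr_or_eq)

lemma dilate_zero: "dilate a deg_zero = deg_zero"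
  by (simp add: dilate_def)

lemma dilate_add: "dilate a (deg_add n m) = deg_add (dilate a n) (dilate a m)"
  by (simp add: dilate_def algebra_simps)

lemma dilate_inj: "inj_on (dilate a) (Nvec r)"
proof (rule inj_onI)
  fix n m assume n: "n \<in> Nvec r" "m \<in> Nvec r" and e: "dilate a n = dilate a m"
  show "n = m"
  proof
    fix i
    show "n i = m i"
      using fun_cong[OF e, of i] a_pos[of i] n
          by (cases "i \<in> {1..r}") (auto simp: dilate_def Nvec_def Zvec_def)
  qed
qed

lemma W_subring: "subring W S"
  unfolding W_def by (rule veronese_subring[OF dilate_Nvec dilate_zero dilate_add])

sublocale V: multigraded_ring V r GV
  unfolding W_def by (rule veronese_multigraded(1)[OF dilate_Nvec dilate_zero dilate_add
      dilate_inj])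

lemma V_hcomp: "n \<in> Nvec r \<Longrightarrow> x \<in> W \<Longrightarrow> V.hcomp n x = hcomp (dilate a n) x"
  unfolding W_def by (rule veronese_multigraded(2)[OF dilate_Nvec dilate_zero dilate_add
      dilate_inj])

lemma W_carrier: "W \<subseteq> carrier S" by (auto simp: W_def)

lemma GV_W: "n \<in> Nvec r \<Longrightarrow> y \<in> GV n \<Longrightarrow> y \<in> W"
  unfolding W_def using homog_in_veronese[of n "Nvec r" "dilate a" y] dilate_Nvec by blast

text \<open>The power of a homogeneous element of degree \<open>d\<close> with this exponent has degree \<open>expo * d\<close>,
  all of whose entries are divisible by those of \<open>a\<close>.\<close>

definition expo :: nat where "expo = nat (\<Prod>i\<in>{1..r}. a i)"

lemma expo_int: "int expo = (\<Prod>i\<in>{1..r}. a i)"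
proof -
  have "0 \<le> (\<Prod>i\<in>{1..r}. a i)" using a_pos by (intro prod_nonneg) (auto intro: less_imp_le)
  then show ?thesis by (simp add: expo_def)
qed

lemma expo_pos: "0 < expo"
proof -
  have "0 < (\<Prod>i\<in>{1..r}. a i)" using a_pos by (intro prod_pos) auto
  then show ?thesis using expo_int by simp
qed

lemma expo_multiple:
  assumes d: "d \<in> Nvec r"
  obtains n where "n \<in> Nvec r" "(\<lambda>i. int expo * d i) = dilate a n"
proof -
  let ?n = "\<lambda>i. (int expo div a i) * d i"
  have dvd: "a i dvd int expo" if "i \<in> {1..r}" for i
    unfolding expo_int using that by (intro dvd_prodI) auto
  have "?n \<in> Nvec r" using d a_pos by (auto simp: Nvec_def Zvec_def a_out pos_imp_zdiv_nonneg_iff)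
     (metis a_out a_pos atLeastAtMost_iff div_by_0 mult_nonneg_nonneg of_nat_0_le_iff order_refl
         pos_imp_zdiv_nonneg_iff)
  moreover have "(\<lambda>i. int expo * d i) = dilate a ?n"
  proof
    fix i
    show "int expo * d i = dilate a ?n i"
      using dvd[of i] d by (cases "i \<in> {1..r}") (auto simp: dilate_def Nvec_def Zvec_def)
  qed
  ultimately show thesis by (rule that)
qed

lemma pow_in_GV:
  assumes d: "d \<in> Nvec r" and y: "y \<in> G d"
  obtains n where "n \<in> Nvec r" "(\<lambda>i. int expo * d i) = dilate a n" "y [^] expo \<in> GV n"
      "y [^] expo \<in> W"
proof -
  obtain n where n: "n \<in> Nvec r" "(\<lambda>i. int expo * d i) = dilate a n" by (rule expo_multiple[OF d])
  then have "y [^] expo \<in> GV n" using G_pow[OF d y, of expo] by simp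
  then show thesis using that n GV_W[OF n(1)] by blast
qed

lemma spanned_extension_exists:
  obtains ms where "spanned_extension S W ms"
proof -
  have "\<exists>ms. set ms \<subseteq> carrier S \<and> carrier S \<subseteq> lspan W ms"
  proof (rule finite_generation[OF W_subring gens_finite gens_carrier])
    fix y assume "y \<in> gens"
    then obtain i j where ij: "i \<in> {1..r}" "j \<in> {1..\<mu> i}" "y = g i j" by auto
    then have y: "y \<in> G (unit_deg i)" using g_G by simp
    obtain n where "y [^] expo \<in> W" by (rule pow_in_GV[OF unit_deg_Nvec[OF ij(1)] y])
    then show "\<exists>n>0. y [^] (n::nat) \<in> W" using expo_pos by blast
  next
    have "G deg_zero \<subseteq> W" using GV_W[OF Nvec_zero] by (auto simp: dilate_zero)
    then have "generate_ring S (G deg_zero \<union> gens) \<subseteq> generate_ring S (W \<union> gens)"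
      using W_carrier gens_carrier by (intro mono_generate_ring) auto
    then show "generate_ring S (W \<union> gens) = carrier S"
      using gen generate_ring_incl[of "W \<union> gens"] W_carrier gens_carrier by auto
  qed
  then obtain ms where "set ms \<subseteq> carrier S" "carrier S \<subseteq> lspan W ms" by blast
  then show thesis using that W_subring is_cring
      by (simp add: spanned_extension_def spanned_extension_axioms_def)
qed

text \<open>A homogeneous ideal is determined up to radical by its contraction, since homogeneous
  elements have powers in \<open>W\<close>.\<close>

lemma homog_ideal_sub_iff:
  assumes J: "ideal J S" "\<forall>y\<in>J. \<forall>d. hcomp d y \<in> J" and P: "primeideal P S" and sub: "J \<inter> W \<subseteq> P"
  shows "J \<subseteq> P"
proof
  fix y assume y: "y \<in> J"
  have yc: "y \<in> carrier S" by (rule ideal.Icarr[OF J(1) y])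
  have "hcomp d y \<in> P" if d: "d \<in> supp y" for d
  proof -
    have dN: "d \<in> Nvec r" using d supp_Nvec by blast
    have c: "hcomp d y \<in> G d" "hcomp d y \<in> carrier S" "hcomp d y \<in> J" using J(2) y yc dN by auto
    obtain n where n: "hcomp d y [^] expo \<in> W" by (rule pow_in_GV[OF dN c(1)])
    have "hcomp d y [^] expo = hcomp d y [^] (expo - 1) \<otimes> hcomp d y"
      using expo_pos by (metis Suc_pred' nat_pow_Suc)
    then have "hcomp d y [^] expo \<in> J" using ideal.I_l_closed[OF J(1) c(3) nat_pow_closed[OF
        c(2)]] by simp
    then have "hcomp d y [^] expo \<in> P" using n sub by blast
    then show ?thesis by (rule primeideal.pow_mem[OF P c(2)])
  qed
  then have "(\<Oplus>d\<in>supp y. hcomp d y) \<in> P"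
    by (rule ideal.ideal_finsum_closed[OF primeideal.axioms(1)[OF P] finite_supp[OF yc]])
  then show "y \<in> P" using hcomp_decomp[OF yc] by simp
qed

text \<open>A prime \<open>P\<close> over \<open>p \<inter> W\<close> contains the homogeneous ideal \<open>p\<close> and is therefore equal to it.\<close>

lemma homog_prime_unique:
  assumes p: "primeideal p S" "\<forall>y\<in>p. \<forall>d. hcomp d y \<in> p" and P: "primeideal P S" "P \<inter> W = p \<inter> W"
  shows "P = p"
proof -
  obtain ms where "spanned_extension S W ms" by (rule spanned_extension_exists)
  then interpret fe: spanned_extension S W ms .
  have "p \<subseteq> P" using P(2) by (intro homog_ideal_sub_iff[OF primeideal.axioms(1)[OF p(1)] p(2)
      P(1)]) auto
  then show ?thesis
    using fe.incomparable[OF p(1) primeideal.axioms(1)[OF P(1)] _ P(2)[symmetric] fe.prime_one[OF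
        P(1)]] by simp
qed

lemma ProjD: "p \<in> Proj r S G \<Longrightarrow> primeideal p S" "p \<in> Proj r S G \<Longrightarrow> \<forall>y\<in>p. \<forall>d. hcomp d y \<in> p"
  by (auto simp: Proj_iff)

lemma contract_homog:
  assumes "\<forall>y\<in>J. \<forall>d. hcomp d y \<in> J" "\<zero> \<in> J" "y \<in> J \<inter> W"
  shows "V.hcomp n y \<in> J \<inter> W"
proof (cases "n \<in> Nvec r")
  case True
  have y: "y \<in> W" using assms(3) by simp
  have "hcomp (dilate a n) y \<in> W" using GV_W[OF True] hcomp_G[OF _ dilate_Nvec[OF True]] y
      W_carrier by blast
  then show ?thesis using assms(1,3) V_hcomp[OF True y] by auto
next
  case False
  then show ?thesis using V.hcomp_outside subringE(2)[OF W_subring] assms(2) by simp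
qed

lemma contract_Proj:
  assumes p: "p \<in> Proj r S G" shows "p \<inter> W \<in> Proj r V GV"
  unfolding V.Proj_iff
proof (intro conjI ballI allI)
  have z: "\<zero> \<in> p" using additive_subgroup.zero_closed[OF ideal.axioms(1)[OF
      primeideal.axioms(1)[OF ProjD(1)[OF p]]]] .
  show "primeideal (p \<inter> W) V" by (rule contract_prime[OF W_subring ProjD(1)[OF p]])
  show "V.hcomp n y \<in> p \<inter> W" if "y \<in> p \<inter> W" for y n
      by (rule contract_homog[OF ProjD(2)[OF p] z that])
  fix i assume i: "i \<in> {1..r}"
  obtain j where j: "j \<in> {1..\<mu> i}" "g i j \<notin> p" by (rule Proj_gen_notin[OF p i])
  let ?n = "\<lambda>k. int (nat (a i)) * unit_deg i k"
  have "g i j [^] nat (a i) \<in> G ?n" by (rule G_pow[OF unit_deg_Nvec[OF i] g_G[OF i j(1)]])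
  moreover have "?n = dilate a (unit_deg i)" using a_pos[OF i]
      by (auto simp: dilate_def unit_deg_def)
  ultimately have "g i j [^] nat (a i) \<in> GV (unit_deg i)" by simp
  moreover have "g i j [^] nat (a i) \<notin> p"
    using primeideal.pow_mem[OF ProjD(1)[OF p], of "g i j"] j(2) gens_carrier i j(1) by blast
  ultimately show "\<exists>d\<in>Nvec r. d i \<noteq> 0 \<and> (\<forall>k>i. d k = 0) \<and> \<not> GV d \<subseteq> p \<inter> W"
    using unit_deg_Nvec[OF i] by (intro bexI[of _ "unit_deg i"]) (auto simp: unit_deg_def)
qed

text \<open>A prime \<open>P\<close> over \<open>q\<close> need not be homogeneous, but the elements all of whose components lie
  in \<open>P\<close> form a homogeneous prime, and it has the same contraction because \<open>q\<close> is homogeneous.\<close>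

lemma Proj_lift:
  assumes q: "q \<in> Proj r V GV"
  obtains p where "p \<in> Proj r S G" "p \<inter> W = q"
proof -
  have qp: "primeideal q V" "\<forall>y\<in>q. \<forall>n. V.hcomp n y \<in> q" using q by (auto simp: V.Proj_iff)
  have qi: "ideal q V" by (rule primeideal.axioms(1)[OF qp(1)])
  obtain ms where "spanned_extension S W ms" by (rule spanned_extension_exists)
  then interpret fe: spanned_extension S W ms .
  have "\<zero> \<in> q" using additive_subgroup.zero_closed[OF ideal.axioms(1)[OF qi]] by simp
  then obtain P where P: "primeideal P S" "P \<inter> W = q" using fe.lie_over[OF zeroideal qp(1)] by auto
  have Pi: "ideal P S" by (rule primeideal.axioms(1)[OF P(1)])
  note Pa = additive_subgroup.a_closed[OF ideal.axioms(1)[OF Pi]]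
  note P0 = additive_subgroup.zero_closed[OF ideal.axioms(1)[OF Pi]]
  define p where "p = {y \<in> carrier S. \<forall>d. hcomp d y \<in> P}"
  have pid: "ideal p S"
  proof (rule idealI')
    fix u v assume u: "u \<in> p"
    have uc: "u \<in> carrier S" using u by (simp add: p_def)
    { assume "v \<in> p" then show "u \<oplus> v \<in> p" using u Pa by (simp add: p_def) }
    assume v: "v \<in> carrier S"
    have "hcomp m (v \<otimes> u) \<in> P" for m
      unfolding hcomp_mult[OF v uc] using u v
      by (intro ideal.ideal_finsum_closed[OF Pi] ideal.I_l_closed[OF Pi]) (auto simp: p_def)
    then show vu: "v \<otimes> u \<in> p" using uc v by (simp add: p_def)
    show "u \<otimes> v \<in> p" using vu m_comm[OF uc v] by simp
  qed (use P0 in \<open>auto simp: p_def\<close>)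
  have hp: "hcomp d y \<in> p" if "y \<in> p" for d y
  proof (cases "d \<in> Nvec r")
    case True
    then show ?thesis using that P0 hcomp_homog[OF True hcomp_G[OF _ True]] by (auto simp: p_def)
  next
    case False
    then show ?thesis using P0 by (simp add: hcomp_outside p_def)
  qed
  have homog: "y \<in> p \<longleftrightarrow> y \<in> P" if "d \<in> Nvec r" "y \<in> G d" for d y
    using G_carrier[OF that] P0 hcomp_homog[OF that] by (auto simp: p_def split: if_splits)
  have pp: "primeideal p S"
  proof (rule homogeneous_primeI[OF pid hp])
    show "\<one> \<notin> p" using homog[OF Nvec_zero G_one] fe.prime_one[OF P(1)] by simp
    fix d e x y assume h: "d \<in> Nvec r" "e \<in> Nvec r" "x \<in> G d" "y \<in> G e" "x \<otimes> y \<in> p"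
    then have "x \<otimes> y \<in> P" using homog[OF Nvec_add[OF h(1,2)] G_mult[OF h(1-4)]] by simp
    then have "x \<in> P \<or> y \<in> P" using primeideal.I_prime[OF P(1)] G_carrier[OF h(1,3)] G_carrier[OF
        h(2,4)] by blast
    then show "x \<in> p \<or> y \<in> p" using homog h by blast
  qed
  have pW: "p \<inter> W = q"
  proof -
    have "y \<in> p \<longleftrightarrow> y \<in> q" if y: "y \<in> W" for y
    proof -
      have yc: "y \<in> carrier S" using y W_carrier by blast
      have "y \<in> q \<longleftrightarrow> (\<forall>n\<in>Nvec r. V.hcomp n y \<in> q)"
        using V.homogeneous_mem_iff[OF qi qp(2)] y by simp
      also have "\<dots> \<longleftrightarrow> (\<forall>n\<in>Nvec r. hcomp (dilate a n) y \<in> P)"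
      proof (intro ball_cong refl)
        fix n assume n: "n \<in> Nvec r"
        have "hcomp (dilate a n) y \<in> W" using GV_W[OF n] hcomp_G[OF yc dilate_Nvec[OF n]] by blast
        then show "(V.hcomp n y \<in> q) = (hcomp (dilate a n) y \<in> P)"
            unfolding V_hcomp[OF n y] P(2)[symmetric] by blast
      qed
      also have "\<dots> \<longleftrightarrow> (\<forall>d. hcomp d y \<in> P)"
      proof (intro iffI allI)
        fix d assume h: "\<forall>n\<in>Nvec r. hcomp (dilate a n) y \<in> P"
        show "hcomp d y \<in> P"
        proof (cases "d \<in> dilate a ` Nvec r")
          case False
          then have "hcomp d y = \<zero>" using y unfolding W_def supp_def by blast
          then show ?thesis using P0 by simp
        qed (use h in blast)
      qed auto
      finally show ?thesis using yc by (simp add: p_def)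
    qed
    moreover have "q \<subseteq> W" using P(2) by blast
    ultimately show ?thesis by blast
  qed
  have "p \<in> Proj r S G"
    unfolding Proj_iff
  proof (intro conjI ballI allI pp hp)
    fix i assume "i \<in> {1..r}"
    then obtain d where d: "d \<in> Nvec r" "d i \<noteq> 0" "\<forall>k>i. d k = 0" "\<not> GV d \<subseteq> q" using q
        unfolding V.Proj_iff by blast
    obtain y where y: "y \<in> GV d" "y \<notin> q" using d(4) by blast
    have "y \<notin> p" using y(2) GV_W[OF d(1) y(1)] pW by blast
    then have "\<not> G (dilate a d) \<subseteq> p" using y(1) by blast
    moreover have "dilate a d i \<noteq> 0" using d(2) a_pos[OF \<open>i \<in> {1..r}\<close>] by (simp add: dilate_def)
    moreover have "\<forall>k>i. dilate a d k = 0" using d(3) by (simp add: dilate_def)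
    ultimately show "\<exists>d\<in>Nvec r. d i \<noteq> 0 \<and> (\<forall>k>i. d k = 0) \<and> \<not> G d \<subseteq> p" using dilate_Nvec[OF d(1)]
        by blast
  qed
  then show thesis using that pW by blast
qed

end

context multigraded_ring
begin

lemma carrier_homogeneous: "homogeneous_ideal (Nvec r) S G (carrier S)"
  unfolding homogeneous_ideal_iff using oneideal by simp

lemma Proj_topspace: "topspace (Proj_topology r S G) = Proj r S G"
proof -
  have "\<not> carrier S \<subseteq> p" if "p \<in> Proj r S G" for p
    using that primeideal.I_notcarr[of p S] ideal.Icarr[OF primeideal.axioms(1), of p S]
        by (auto simp: Proj_def)
  then show ?thesis unfolding Proj_topology_def topology_generated_by_topspace
      using carrier_homogeneous by blast
qed

lemma Proj_open: "homogeneous_ideal (Nvec r) S G J \<Longrightarrow> openin (Proj_topology r S G) {p \<in>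
    Proj r S G. \<not> J \<subseteq> p}"
  unfolding Proj_topology_def by (rule topology_generated_by_Basis) blast

end

context veronese
begin

text \<open>The open set of a homogeneous ideal \<open>J\<close> of the Veronese subring has as its preimage under
  contraction the open set of the ideal that \<open>J\<close> generates in \<open>S\<close>; the open set of a homogeneous
  ideal \<open>J\<close> of \<open>S\<close> is mapped onto the open set of \<open>J \<inter> W\<close>.\<close>

lemma Proj_homeomorphic: "Proj_topology r V GV homeomorphic_space Proj_topology r S G"
proof -
  let ?f = "\<lambda>p. p \<inter> W"
  have inj: "p = p'" if "p \<in> Proj r S G" "p' \<in> Proj r S G" "p \<inter> W = p' \<inter> W" for p p'
    using homog_prime_unique[OF ProjD[OF that(2)] ProjD(1)[OF that(1)] that(3)] .
  define k where "k q = (THE p. p \<in> Proj r S G \<and> p \<inter> W = q)" for q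
  have k: "k q \<in> Proj r S G \<and> k q \<inter> W = q" if "q \<in> Proj r V GV" for q
  proof -
    note q = that
    obtain p where p: "p \<in> Proj r S G" "p \<inter> W = q" by (rule Proj_lift[OF q])
    have "k q = p" unfolding k_def
    proof (rule the_equality)
      fix p' assume "p' \<in> Proj r S G \<and> p' \<inter> W = q"
      then show "p' = p" using inj[of p' p] p by simp
    qed (use p in simp)
    then show ?thesis using p by simp
  qed
  have kf: "k (p \<inter> W) = p" if "p \<in> Proj r S G" for p
    using k[OF contract_Proj[OF that]] inj[of "k (p \<inter> W)" p] that by simp
  have c1: "continuous_map (Proj_topology r S G) (Proj_topology r V GV) ?f"
    unfolding Proj_topology_def[of r V GV]
  proof (rule continuous_on_generated_topo)
    fix U assume "U \<in> {{p \<in> Proj r V GV. \<not> J \<subseteq> p} |J. homogeneous_ideal (Nvec r) V GV J}"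
    then obtain J where J: "homogeneous_ideal (Nvec r) V GV J" "U = {p \<in> Proj r V GV. \<not> J \<subseteq> p}"
        by blast
    have Ji: "ideal J V" "J = Idl\<^bsub>V\<^esub> (J \<inter> (\<Union>d \<in> Nvec r. GV d))" using J(1)
        unfolding homogeneous_ideal_def by simp_all
    let ?X = "J \<inter> (\<Union>d \<in> Nvec r. GV d)"
    have JW: "J \<subseteq> W" using ideal.Icarr[OF Ji(1)] by auto
    have Xc: "?X \<subseteq> carrier S" using JW W_carrier by blast
    let ?I = "Idl ?X"
    have "(\<Union>d \<in> Nvec r. GV d) \<subseteq> (\<Union>d \<in> Nvec r. G d)"
    proof (rule UN_least)
      fix d assume "d \<in> Nvec r"
      then show "GV d \<subseteq> (\<Union>d \<in> Nvec r. G d)" by (rule UN_upper[OF dilate_Nvec])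
    qed
    then have "homogeneous_ideal (Nvec r) S G ?I"
      by (intro genideal_homogeneous subset_trans[OF Int_lower2])
    moreover have "?f -` U \<inter> Proj r S G = {p \<in> Proj r S G. \<not> ?I \<subseteq> p}"
    proof -
      have "J \<subseteq> p \<inter> W \<longleftrightarrow> ?I \<subseteq> p" if p: "p \<in> Proj r S G" for p
      proof
        assume "J \<subseteq> p \<inter> W"
        then show "?I \<subseteq> p" by (intro genideal_minimal primeideal.axioms(1)[OF ProjD(1)[OF p]]) blast
      next
        assume "?I \<subseteq> p"
        then have "?X \<subseteq> p \<inter> W" using genideal_self[OF Xc] JW by blast
        moreover have "ideal (p \<inter> W) V" by (rule contract_ideal[OF W_subring
            primeideal.axioms(1)[OF ProjD(1)[OF p]]])
        ultimately have "Idl\<^bsub>V\<^esub> ?X \<subseteq> p \<inter> W" by (intro V.genideal_minimal)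
        then show "J \<subseteq> p \<inter> W" using Ji(2) by simp
      qed
      then show ?thesis using contract_Proj J(2) by auto
    qed
    ultimately show "openin (Proj_topology r S G) (?f -` U \<inter> topspace (Proj_topology r S G))"
      unfolding Proj_topspace by (simp add: Proj_open)
  next
    show "?f ` topspace (Proj_topology r S G) \<subseteq> \<Union>{{p \<in> Proj r V GV. \<not> J \<subseteq> p} |J. homogeneous_ideal
        (Nvec r) V GV J}"
      using V.Proj_topspace contract_Proj
          unfolding Proj_topspace Proj_topology_def topology_generated_by_topspace by blast
  qed
  have c2: "continuous_map (Proj_topology r V GV) (Proj_topology r S G) k"
    unfolding Proj_topology_def[of r S G]
  proof (rule continuous_on_generated_topo)
    fix U assume "U \<in> {{p \<in> Proj r S G. \<not> J \<subseteq> p} |J. homogeneous_ideal (Nvec r) S G J}"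
    then obtain J where J: "homogeneous_ideal (Nvec r) S G J" "U = {p \<in> Proj r S G. \<not> J \<subseteq> p}"
        by blast
    have Ji: "ideal J S" "\<forall>y\<in>J. \<forall>d. hcomp d y \<in> J" using J(1) by (auto simp: homogeneous_ideal_iff)
    have "homogeneous_ideal (Nvec r) V GV (J \<inter> W)"
      unfolding V.homogeneous_ideal_iff
      using contract_ideal[OF W_subring Ji(1)] contract_homog[OF Ji(2)]
          additive_subgroup.zero_closed[OF ideal.axioms(1)[OF Ji(1)]] by blast
    moreover have "k -` U \<inter> Proj r V GV = {q \<in> Proj r V GV. \<not> J \<inter> W \<subseteq> q}"
    proof -
      have "J \<subseteq> k q \<longleftrightarrow> J \<inter> W \<subseteq> q" if q: "q \<in> Proj r V GV" for q
        using homog_ideal_sub_iff[OF Ji ProjD(1), of "k q"] k[OF q] by blast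
      then show ?thesis using k J(2) by auto
    qed
    ultimately show "openin (Proj_topology r V GV) (k -` U \<inter> topspace (Proj_topology r V GV))"
      unfolding V.Proj_topspace by (simp add: V.Proj_open)
  next
    show "k ` topspace (Proj_topology r V GV) \<subseteq> \<Union>{{p \<in> Proj r S G. \<not> J \<subseteq> p} |J. homogeneous_ideal
        (Nvec r) S G J}"
      using Proj_topspace k unfolding V.Proj_topspace Proj_topology_def
          topology_generated_by_topspace by blast
  qed
  have "homeomorphic_maps (Proj_topology r V GV) (Proj_topology r S G) k ?f"
    unfolding homeomorphic_maps_def Proj_topspace V.Proj_topspace using c1 c2 k kf by auto
  then show ?thesis unfolding homeomorphic_space_def by blast
qed

end

section \<open>Homogeneous localization of Veronese transforms\<close>

lemma fractions_carrier_update: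
  "fractions (R\<lparr>carrier := C\<rparr>) (M\<lparr>carrier := D\<rparr>) Q U = fractions R M Q U"
  by (simp add: fractions_def frac_rel_def)

lemma reg_module_carrier_update: "reg_module (R\<lparr>carrier := C\<rparr>) = (reg_module R)\<lparr>carrier := C\<rparr>"
  by (simp add: reg_module_def)

context veronese
begin

text \<open>A relation between fractions over \<open>W\<close> that holds after multiplication by a homogeneous \<open>u\<close>
  also holds after multiplication by the power \<open>u^expo\<close>, which is a denominator over \<open>W\<close>: this is
  injectivity. Surjectivity is \<open>m / s = s^(expo - 1) m / s^expo\<close>.\<close>

lemma veronese_localization_iso:
  fixes M (structure)
  assumes M: "module S M" and p: "p \<in> Proj r S G"
    and HH: "\<And>n. n \<in> Nvec r \<Longrightarrow> additive_subgroup (HH n) M"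
      "\<And>n m y z. n \<in> Nvec r \<Longrightarrow> m \<in> Nvec r \<Longrightarrow> y \<in> G n \<Longrightarrow> z \<in> HH m \<Longrightarrow> y \<odot>\<^bsub>M\<^esub> z \<in> HH (deg_add n m)"
  defines "HV \<equiv> \<lambda>n. HH (dilate a n)"
  shows "natural_map (frac_rel M (hom_pairs (Nvec r) G HH p) (hom_denoms (Nvec r) G p)) \<in>
    linear_isos (fractions S (reg_module S) (hom_pairs (Nvec r) GV GV p) (hom_denoms (Nvec r) GV p))
      (fractions S M (hom_pairs (Nvec r) GV HV p) (hom_denoms (Nvec r) GV p))
      (restrict_scalars (natural_map (frac_rel (reg_module S) (hom_pairs (Nvec r) G G p)
          (hom_denoms (Nvec r) G p)))
        (fractions S M (hom_pairs (Nvec r) G HH p) (hom_denoms (Nvec r) G p)))"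
proof -
  have pp: "primeideal p S" by (rule ProjD(1)[OF p])
  let ?QA = "hom_pairs (Nvec r) G G p" and ?Q = "hom_pairs (Nvec r) G HH p"
      and ?U = "hom_denoms (Nvec r) G p"
  let ?QA1 = "hom_pairs (Nvec r) GV GV p" and ?Q1 = "hom_pairs (Nvec r) GV HV p"
      and ?U1 = "hom_denoms (Nvec r) GV p"
  interpret M: module S M by (rule M)
  have GVa: "additive_subgroup (GV n) S" if "n \<in> Nvec r" for n
      by (rule G_additive[OF dilate_Nvec[OF that]])
  have GV1: "\<one> \<in> GV deg_zero" by (simp add: dilate_zero)
  have GVm: "y \<otimes>\<^bsub>S\<^esub> z \<in> GV (deg_add n m)" if "n \<in> Nvec r" "m \<in> Nvec r" "y \<in> GV n" "z \<in> GV m"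
      for n m y z
    unfolding dilate_add by (rule G_mult[OF dilate_Nvec[OF that(1)] dilate_Nvec[OF that(2)]
        that(3,4)])
  have HVa: "additive_subgroup (HV n) M" if "n \<in> Nvec r" for n unfolding HV_def
      by (rule HH(1)[OF dilate_Nvec[OF that]])
  have HVm: "y \<odot>\<^bsub>M\<^esub> z \<in> HV (deg_add n m)" if "n \<in> Nvec r" "m \<in> Nvec r" "y \<in> GV n" "z \<in> HV m"
      for n m y z
    using HH(2)[OF dilate_Nvec[OF that(1)] dilate_Nvec[OF that(2)] that(3)] that(4)
        unfolding HV_def dilate_add .
  have GVc: "y \<in> carrier S" if "n \<in> Nvec r" "y \<in> GV n" for n y
    by (rule G_carrier[OF dilate_Nvec[OF that(1)] that(2)])
  interpret A: fraction_ring S ?QA ?U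
    by (rule hom_fraction_ring[where GG = G, OF is_cring pp]) (fact G_additive G_one G_mult)+
  interpret A1: fraction_ring S ?QA1 ?U1
    by (rule hom_fraction_ring[where GG = GV, OF is_cring pp]) (fact GVa GV1 GVm)+
  interpret F: fraction_system S M ?Q ?U
    by (rule hom_fraction_system[where GG = G
        and HH = HH, OF M pp]) (fact G_carrier G_one G_mult HH)+
  interpret F1: fraction_system S M ?Q1 ?U1
    by (rule hom_fraction_system[where GG = GV and HH = HV, OF M pp]) (fact GVc GV1 GVm HVa HVm)+
  have QAsub: "?QA1 \<subseteq> ?QA" unfolding hom_pairs_def using dilate_Nvec by fast
  have Qsub: "?Q1 \<subseteq> ?Q" unfolding hom_pairs_def HV_def using dilate_Nvec by fast
  have Usub: "?U1 \<subseteq> ?U" unfolding hom_denoms_def using dilate_Nvec by fast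
  note nA = natural_map_cls[OF A.fraction_system_axioms A1.fraction_system_axioms QAsub Usub]
  note nF = natural_map_cls[OF F.fraction_system_axioms F1.fraction_system_axioms Qsub Usub]
  have smult_pair: "(b \<odot>\<^bsub>M\<^esub> n, s \<otimes>\<^bsub>S\<^esub> t) \<in> ?Q" if q: "(b, s) \<in> ?QA" "(n, t) \<in> ?Q" for b s n t
  proof -
    obtain d e where h: "d \<in> Nvec r" "b \<in> G d" "s \<in> G d" "s \<notin> p" "e \<in> Nvec r" "n \<in> HH e" "t \<in> G e"
        "t \<notin> p"
      using q unfolding hom_pairs_def by blast
    have "s \<otimes>\<^bsub>S\<^esub> t \<notin> p" using primeideal.I_prime[OF pp G_carrier[OF h(1,3)] G_carrier[OF h(5,7)]]
        h(4,8) by blast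
    then show ?thesis
      unfolding hom_pairs_def using Nvec_add[OF h(1,5)] HH(2)[OF h(1,5,2,6)] G_mult[OF h(1,5,3,7)]
          by blast
  qed
  have smult_pair1: "(b \<odot>\<^bsub>M\<^esub> n, s \<otimes>\<^bsub>S\<^esub> t) \<in> ?Q1" if q: "(b, s) \<in> ?QA1" "(n, t) \<in> ?Q1" for b s n t
  proof -
    obtain d e where h: "d \<in> Nvec r" "b \<in> GV d" "s \<in> GV d" "s \<notin> p" "e \<in> Nvec r" "n \<in> HV e" "t \<in>
        GV e" "t \<notin> p"
      using q unfolding hom_pairs_def by blast
    have "s \<otimes>\<^bsub>S\<^esub> t \<notin> p" using primeideal.I_prime[OF pp A1.UD A1.UD, of s t] h
        unfolding hom_denoms_def by blast
    then show ?thesis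
      unfolding hom_pairs_def using Nvec_add[OF h(1,5)] HVm[OF h(1,5,2,6)] GVm[OF h(1,5,3,7)]
          by blast
  qed
  have sF: "A.cls b s \<odot>\<^bsub>F.F\<^esub> F.cls n t = F.cls (b \<odot>\<^bsub>M\<^esub> n) (s \<otimes>\<^bsub>S\<^esub> t)"
      if "(b, s) \<in> ?QA" "(n, t) \<in> ?Q" for b s n t
    by (rule smult_cls[OF A.fraction_system_axioms F.fraction_system_axioms _ that]) (rule
        smult_pair)
  have sF1: "A1.cls b s \<odot>\<^bsub>F1.F\<^esub> F1.cls n t = F1.cls (b \<odot>\<^bsub>M\<^esub> n) (s \<otimes>\<^bsub>S\<^esub> t)"
      if "(b, s) \<in> ?QA1" "(n, t) \<in> ?Q1" for b s n t
    by (rule smult_cls[OF A1.fraction_system_axioms F1.fraction_system_axioms _ that]) (rule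
        smult_pair1)
  let ?h = "natural_map F.E"
  have lin: "?h \<in> linear_maps A1.F F1.F (restrict_scalars (natural_map A.E) F.F)"
    unfolding linear_maps_def mem_Collect_eq
  proof (intro conjI ballI homI)
    fix y assume "y \<in> carrier (add_monoid F1.F)"
    then have "y \<in> carrier F1.F" by simp
    then obtain m s where ms: "(m, s) \<in> ?Q1" "y = F1.cls m s" by (rule F1.F_cases)
    then show "?h y \<in> carrier (add_monoid (restrict_scalars (natural_map A.E) F.F))"
      using F.cls_closed[OF subsetD[OF Qsub ms(1)]] by (simp add: nF)
    fix z assume "z \<in> carrier (add_monoid F1.F)"
    then have "z \<in> carrier F1.F" by simp
    then obtain n t where nt: "(n, t) \<in> ?Q1" "z = F1.cls n t" by (rule F1.F_cases)
    show "?h (y \<otimes>\<^bsub>add_monoid F1.F\<^esub> z) = ?h y \<otimes>\<^bsub>add_monoid (restrict_scalars (natural_map A.E)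
        F.F)\<^esub> ?h z"
      using F.cls_add[OF subsetD[OF Qsub ms(1)] subsetD[OF Qsub nt(1)]]
      by (simp add: ms nt nF F1.cls_add[OF ms(1) nt(1)] F1.Q_add[OF ms(1) nt(1)])
  next
    fix b y assume "b \<in> carrier A1.F" "y \<in> carrier F1.F"
    then obtain c s n t where q: "(c, s) \<in> ?QA1" "b = A1.cls c s" "(n, t) \<in> ?Q1" "y = F1.cls n t"
      by (metis A1.F_cases F1.F_cases)
    show "?h (b \<odot>\<^bsub>F1.F\<^esub> y) = b \<odot>\<^bsub>restrict_scalars (natural_map A.E) F.F\<^esub> ?h y"
      unfolding q(2,4) sF1[OF q(1,3)] nF[OF smult_pair1[OF q(1,3)]] nF[OF q(3)]
          restrict_scalars_simps nA[OF q(1)]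
      by (rule sF[OF subsetD[OF QAsub q(1)] subsetD[OF Qsub q(3)], symmetric])
  qed
  have pow_split: "y [^] expo = y [^] (expo - 1) \<otimes>\<^bsub>S\<^esub> y" for y
    using expo_pos by (metis Suc_pred' nat_pow_Suc)
  have pow_notin: "y [^] (k::nat) \<notin> p" if "y \<in> carrier S" "y \<notin> p" for y k
    using primeideal.pow_mem[OF pp that(1)] that(2) by blast
  have inj: "inj_on ?h (carrier F1.F)"
  proof (rule inj_onI)
    fix y z assume "y \<in> carrier F1.F" "z \<in> carrier F1.F" and e: "?h y = ?h z"
    then obtain m s n t where q: "(m, s) \<in> ?Q1" "y = F1.cls m s" "(n, t) \<in> ?Q1" "z = F1.cls n t"
      by (metis F1.F_cases)
    have c: "m \<in> carrier M" "n \<in> carrier M" "s \<in> carrier S" "t \<in> carrier S"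
      using F1.QD[OF q(1)] F1.QD[OF q(3)] by auto
    obtain u where u: "u \<in> ?U" "u \<odot>\<^bsub>M\<^esub> (t \<odot>\<^bsub>M\<^esub> m) = u \<odot>\<^bsub>M\<^esub> (s \<odot>\<^bsub>M\<^esub> n)"
      using e unfolding q(2,4) nF[OF q(1)] nF[OF q(3)] F.cls_eq_iff[OF subsetD[OF Qsub q(1)]
          subsetD[OF Qsub q(3)]] by blast
    obtain d where d: "d \<in> Nvec r" "u \<in> G d" "u \<notin> p" using u(1) unfolding hom_denoms_def by blast
    have uc: "u \<in> carrier S" by (rule G_carrier[OF d(1,2)])
    obtain k where "k \<in> Nvec r" "u [^] expo \<in> GV k" by (rule pow_in_GV[OF d(1,2)])
    then have uU: "u [^] expo \<in> ?U1" unfolding hom_denoms_def using pow_notin[OF uc d(3)] by blast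
    have "u [^] expo \<odot>\<^bsub>M\<^esub> (t \<odot>\<^bsub>M\<^esub> m) = u [^] (expo - 1) \<odot>\<^bsub>M\<^esub> (u \<odot>\<^bsub>M\<^esub> (t \<odot>\<^bsub>M\<^esub> m))"
      unfolding pow_split using uc c by (intro M.smult_assoc1) auto
    also have "\<dots> = u [^] expo \<odot>\<^bsub>M\<^esub> (s \<odot>\<^bsub>M\<^esub> n)"
      unfolding u(2) pow_split using uc c by (intro M.smult_assoc1[symmetric]) auto
    finally show "y = z" unfolding q(2,4) F1.cls_eq_iff[OF q(1,3)] using uU by blast
  qed
  have surj: "carrier F.F \<subseteq> ?h ` carrier F1.F"
  proof
    fix y assume "y \<in> carrier F.F"
    then obtain m s where q: "(m, s) \<in> ?Q" "y = F.cls m s" by (rule F.F_cases)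
    then obtain d where d: "d \<in> Nvec r" "m \<in> HH d" "s \<in> G d" "s \<notin> p" unfolding hom_pairs_def
        by blast
    have c: "m \<in> carrier M" "s \<in> carrier S" using F.QD[OF q(1)] by auto
    obtain k where k: "k \<in> Nvec r" "(\<lambda>i. int expo * d i) = dilate a k" "s [^] expo \<in> GV k"
        by (rule pow_in_GV[OF d(1,3)])
    have N: "(\<lambda>i. int (expo - 1) * d i) \<in> Nvec r" using d(1) by (simp add: Nvec_def Zvec_def)
    have "deg_add (\<lambda>i. int (expo - 1) * d i) d = (\<lambda>i. int expo * d i)"
      using expo_pos by (simp add: of_nat_diff algebra_simps)
    then have "s [^] (expo - 1) \<odot>\<^bsub>M\<^esub> m \<in> HV k"
      unfolding HV_def k(2)[symmetric] using HH(2)[OF N d(1) G_pow[OF d(1,3)] d(2)] by simp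
    then have q1: "(s [^] (expo - 1) \<odot>\<^bsub>M\<^esub> m, s [^] expo) \<in> ?Q1"
      unfolding hom_pairs_def using k(1,3) pow_notin[OF c(2) d(4)] by blast
    have "F.cls m s = F.cls (s [^] (expo - 1) \<odot>\<^bsub>M\<^esub> m) (s [^] expo)"
      by (rule F.cls_eqI[OF q(1) subsetD[OF Qsub q1]])
        (use c in \<open>simp add: pow_split M.smult_assoc1 F.smult_lcomm[of s]\<close>)
    then have "y = ?h (F1.cls (s [^] (expo - 1) \<odot>\<^bsub>M\<^esub> m) (s [^] expo))" unfolding q(2) nF[OF q1] .
    then show "y \<in> ?h ` carrier F1.F" using F1.cls_closed[OF q1] by blast
  qed
  have "?h ` carrier F1.F \<subseteq> carrier F.F"
  proof (rule image_subsetI)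
    fix y assume "y \<in> carrier F1.F"
    then obtain m s where ms: "(m, s) \<in> ?Q1" "y = F1.cls m s" by (rule F1.F_cases)
    then show "?h y \<in> carrier F.F" using F.cls_closed[OF subsetD[OF Qsub ms(1)]] by (simp add: nF)
  qed
  then have "bij_betw ?h (carrier F1.F) (carrier F.F)" using inj surj by (auto simp: bij_betw_def)
  then show ?thesis using lin unfolding linear_isos_def by simp
qed

end

section \<open>Regrading\<close>

definition lin_index :: "nat \<Rightarrow> (nat \<Rightarrow> mdeg) \<Rightarrow> mdeg \<Rightarrow> mdeg" where
  "lin_index r \<gamma> n = (\<lambda>k. \<Sum>i = 1..r. n i * \<gamma> i k)"

lemma veronese_index_eq: "veronese_index r \<gamma> a n = lin_index r \<gamma> (dilate a n)"
  by (simp add: veronese_index_def lin_index_def dilate_def mult.commute)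

lemma lin_index_add: "lin_index r \<gamma> (deg_add n m) = deg_add (lin_index r \<gamma> n) (lin_index r \<gamma> m)"
  by (simp add: lin_index_def distrib_right sum.distrib)

lemma lin_index_zero: "lin_index r \<gamma> deg_zero = deg_zero"
  by (simp add: lin_index_def)

lemma lin_index_unit: "i \<in> {1..r} \<Longrightarrow> lin_index r \<gamma> (unit_deg i) = \<gamma> i"
proof
  fix k assume i: "i \<in> {1..r}"
  have "lin_index r \<gamma> (unit_deg i) k = (\<Sum>j\<in>{1..r}. if j = i then \<gamma> i k else 0)"
    unfolding lin_index_def unit_deg_def by (intro sum.cong) auto
  then show "lin_index r \<gamma> (unit_deg i) k = \<gamma> i k" using i by simp
qed

locale triangular_degrees =
  fixes r :: nat and \<gamma> :: "nat \<Rightarrow> mdeg"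
  assumes \<gamma>: "\<And>i. i \<in> {1..r} \<Longrightarrow> \<gamma> i \<in> Nvec r \<and> (\<forall>k>i. \<gamma> i k = 0) \<and> \<gamma> i i \<noteq> 0"
begin

abbreviation "\<phi> \<equiv> lin_index r \<gamma>"

lemma \<phi>_Nvec: "n \<in> Nvec r \<Longrightarrow> \<phi> n \<in> Nvec r"
  using \<gamma> unfolding Nvec_def Zvec_def lin_index_def
  by (auto intro!: sum_nonneg sum.neutral mult_nonneg_nonneg)

text \<open>The triangular shape: the last nonzero entry of \<open>n\<close> determines that of \<open>\<phi> n\<close>.\<close>

lemma \<phi>_top:
  assumes "k \<in> {1..r}" "\<And>j. k < j \<Longrightarrow> n j = 0" shows "\<phi> n k = n k * \<gamma> k k"
proof -
  have "\<phi> n k = (\<Sum>i\<in>{1..r}. if i = k then n k * \<gamma> k k else 0)"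
    unfolding lin_index_def
  proof (rule sum.cong[OF refl])
    fix i assume i: "i \<in> {1..r}"
    show "n i * \<gamma> i k = (if i = k then n k * \<gamma> k k else 0)"
      using \<gamma>[OF i] assms(2)[of i] by (cases i k rule: linorder_cases) auto
  qed
  then show ?thesis using assms(1) by simp
qed

lemma \<phi>_above:
  assumes "\<And>j. i < j \<Longrightarrow> n j = 0" "i < k" shows "\<phi> n k = 0"
  unfolding lin_index_def
proof (rule sum.neutral, rule ballI)
  fix j assume j: "j \<in> {1..r}"
  show "n j * \<gamma> j k = 0" using \<gamma>[OF j] assms by (cases "j \<le> i") auto
qed

lemma top_index:
  assumes "n \<in> Zvec r" "n k \<noteq> 0"
  obtains l where "l \<in> {1..r}" "k \<le> l" "n l \<noteq> 0" "\<And>j. l < j \<Longrightarrow> n j = 0"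
proof -
  let ?A = "{i. n i \<noteq> 0}"
  have A: "?A \<subseteq> {1..r}" using assms by (auto simp: Zvec_def)
  then have fin: "finite ?A" by (rule finite_subset) simp
  have M: "Max ?A \<in> ?A" using fin assms by (intro Max_in) auto
  show thesis
  proof (rule that[of "Max ?A"])
    show "Max ?A \<in> {1..r}" using M A by blast
    show "k \<le> Max ?A" using fin assms by (intro Max_ge) auto
    show "n (Max ?A) \<noteq> 0" using M by simp
    show "n j = 0" if "Max ?A < j" for j using Max_ge[OF fin, of j] that
        by (auto simp: not_less[symmetric])
  qed
qed

lemma \<phi>_inj: "inj_on \<phi> (Nvec r)"
proof (rule inj_onI)
  fix n m assume nm: "n \<in> Nvec r" "m \<in> Nvec r" "\<phi> n = \<phi> m"
  show "n = m"
  proof (rule ccontr)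
    assume "n \<noteq> m"
    then obtain k where k: "n k \<noteq> m k" by auto
    let ?d = "\<lambda>i. n i - m i"
    have "?d \<in> Zvec r" using nm by (auto simp: Nvec_def Zvec_def)
    then obtain l where l: "l \<in> {1..r}" "?d l \<noteq> 0" "\<And>j. l < j \<Longrightarrow> ?d j = 0"
        using top_index[of ?d k] k by auto
    have "\<phi> ?d l = \<phi> n l - \<phi> m l" by (simp add: lin_index_def left_diff_distrib sum_subtractf)
    then show False using \<phi>_top[OF l(1), of ?d] l \<gamma>[OF l(1)] nm(3) by auto
  qed
qed

lemma \<phi>_last_iff:
  assumes n: "n \<in> Nvec r" and i: "i \<in> {1..r}"
  shows "\<phi> n i \<noteq> 0 \<and> (\<forall>k>i. \<phi> n k = 0) \<longleftrightarrow> n i \<noteq> 0 \<and> (\<forall>k>i. n k = 0)"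
proof
  assume h: "n i \<noteq> 0 \<and> (\<forall>k>i. n k = 0)"
  then show "\<phi> n i \<noteq> 0 \<and> (\<forall>k>i. \<phi> n k = 0)" using \<phi>_top[OF i, of n] \<phi>_above[of i n] \<gamma>[OF i] by auto
next
  assume h: "\<phi> n i \<noteq> 0 \<and> (\<forall>k>i. \<phi> n k = 0)"
  have z: "n k = 0" if k: "i < k" for k
  proof (rule ccontr)
    assume "n k \<noteq> 0"
    then obtain l where l: "l \<in> {1..r}" "k \<le> l" "n l \<noteq> 0" "\<And>j. l < j \<Longrightarrow> n j = 0"
        using top_index[of n k] n by (auto simp: Nvec_def)
    then show False using \<phi>_top[OF l(1), of n] \<gamma>[OF l(1)] h k by auto
  qed
  then show "n i \<noteq> 0 \<and> (\<forall>k>i. n k = 0)" using h \<phi>_top[OF i, of n] by auto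
qed

end

text \<open>The given grading \<open>G\<close> and its reindexing \<open>G1\<close>, in which the generators have unit vectors as
  degrees.\<close>

locale triangular_graded = multigraded_ring S r G + triangular_degrees r \<gamma>
  for S (structure) and r G \<gamma> +
  fixes \<mu> :: "nat \<Rightarrow> nat" and g :: "nat \<Rightarrow> nat \<Rightarrow> 'a"
  assumes g_\<gamma>: "\<And>i j. i \<in> {1..r} \<Longrightarrow> j \<in> {1..\<mu> i} \<Longrightarrow> g i j \<in> G (\<gamma> i)"
    and gen_\<gamma>: "generate_ring S (G deg_zero \<union> {g i j | i j. i \<in> {1..r} \<and> j \<in> {1..\<mu> i}}) = carrier S"
begin

abbreviation "G1 \<equiv> (\<lambda>n. G (\<phi> n))"

text \<open>The elements supported in the degrees \<open>\<phi> n\<close> form a subring that contains the generators.\<close>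

lemma all_supported: "{x \<in> carrier S. supp x \<subseteq> \<phi> ` Nvec r} = carrier S" (is "?W = _")
proof -
  have W: "subring ?W S" by (rule veronese_subring[OF \<phi>_Nvec lin_index_zero lin_index_add])
  have sub: "G deg_zero \<union> {g i j | i j. i \<in> {1..r} \<and> j \<in> {1..\<mu> i}} \<subseteq> ?W"
  proof
    fix y assume "y \<in> G deg_zero \<union> {g i j | i j. i \<in> {1..r} \<and> j \<in> {1..\<mu> i}}"
    then consider "y \<in> G deg_zero" | i j where "i \<in> {1..r}" "j \<in> {1..\<mu> i}" "y = g i j" by blast
    then have "\<exists>n\<in>Nvec r. y \<in> G (\<phi> n)"
    proof cases
      case 1
      then show ?thesis using lin_index_zero[of r \<gamma>] by (intro bexI[of _ deg_zero]) auto
    next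
      case 2
      then show ?thesis using g_\<gamma>[OF 2(1,2)] lin_index_unit[OF 2(1), of \<gamma>] unit_deg_Nvec[OF 2(1)]
        by (intro bexI[of _ "unit_deg i"]) auto
    qed
    then obtain n where "n \<in> Nvec r" "y \<in> G (\<phi> n)" by blast
    then show "y \<in> ?W" using homog_in_veronese[of n "Nvec r" \<phi> y] \<phi>_Nvec by blast
  qed
  have "?W \<subseteq> carrier S" by blast
  from generate_ring_min_subring1[OF subset_trans[OF sub this] W sub] show ?thesis unfolding gen_\<gamma>
      by blast
qed

lemma G_nonzero_index:
  assumes "d \<in> Nvec r" "y \<in> G d" "y \<noteq> \<zero>" obtains n where "n \<in> Nvec r" "d = \<phi> n"
proof -
  have "y \<in> {x \<in> carrier S. supp x \<subseteq> \<phi> ` Nvec r}" unfolding all_supported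
      by (rule G_carrier[OF assms(1,2)])
  moreover have "d \<in> supp y" using assms hcomp_homog[OF assms(1,2)] by (simp add: supp_def)
  ultimately show thesis using that by blast
qed

sublocale R1: std_graded S r G1 \<mu> g
proof (intro std_graded.intro std_graded_axioms.intro)
  show "multigraded_ring S r G1"
    using veronese_multigraded(1)[OF \<phi>_Nvec lin_index_zero lin_index_add \<phi>_inj]
        unfolding all_supported by simp
  show "g i j \<in> G1 (unit_deg i)" if "i \<in> {1..r}" "j \<in> {1..\<mu> i}" for i j
    unfolding lin_index_unit[OF that(1)] by (rule g_\<gamma>[OF that])
  show "generate_ring S (G1 deg_zero \<union> {g i j | i j. i \<in> {1..r} \<and> j \<in> {1..\<mu> i}}) = carrier S"
    unfolding lin_index_zero by (rule gen_\<gamma>)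
qed

text \<open>Besides the degrees \<open>\<phi> n\<close>, the zero element is the only homogeneous element. So both
  gradings have the same homogeneous ideals, irrelevant ideal and \<open>Proj\<close>, and since a denominator
  is nonzero, the same homogeneous fractions.\<close>

lemma homog_union_eq: "(\<Union>d \<in> Nvec r. G d) = (\<Union>n \<in> Nvec r. G1 n)"
proof (intro equalityI subsetI)
  fix y assume "y \<in> (\<Union>d \<in> Nvec r. G d)"
  then obtain d where d: "d \<in> Nvec r" "y \<in> G d" by blast
  show "y \<in> (\<Union>n \<in> Nvec r. G1 n)"
  proof (cases "y = \<zero>")
    case True then show ?thesis using R1.G_zero[OF Nvec_zero] by blast
  next
    case False
    then show ?thesis using G_nonzero_index[OF d] d(2) by blast
  qed
qed (use \<phi>_Nvec in blast)

lemma homogeneous_ideal_eq: "homogeneous_ideal (Nvec r) S G J = homogeneous_ideal (Nvec r) S G1 J"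
  unfolding homogeneous_ideal_def homog_union_eq ..

lemma irrelevant_factor_eq:
  assumes i: "i \<in> {1..r}"
  shows "irrelevant_factor r S G i = irrelevant_factor r S G1 i"
proof -
  have "(\<Union>d \<in> {d \<in> Nvec r. d i \<noteq> 0 \<and> (\<forall>k>i. d k = 0)}. G d) = (\<Union>n \<in> {n \<in> Nvec r. n i \<noteq> 0 \<and>
      (\<forall>k>i. n k = 0)}. G1 n)" (is "?L = ?R")
  proof (intro equalityI subsetI)
    fix y assume "y \<in> ?L"
    then obtain d where d: "d \<in> Nvec r" "d i \<noteq> 0 \<and> (\<forall>k>i. d k = 0)" "y \<in> G d" by blast
    show "y \<in> ?R"
    proof (cases "y = \<zero>")
      case True
      have "unit_deg i \<in> {n \<in> Nvec r. n i \<noteq> 0 \<and> (\<forall>k>i. n k = 0)}" using unit_deg_Nvec[OF i]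
          by (auto simp: unit_deg_def)
      then show ?thesis using True R1.G_zero[OF unit_deg_Nvec[OF i]] by blast
    next
      case False
      then obtain n where n: "n \<in> Nvec r" "d = \<phi> n" using G_nonzero_index[OF d(1,3)] by blast
      then show ?thesis using \<phi>_last_iff[OF n(1) i] d by blast
    qed
  next
    fix y assume "y \<in> ?R"
    then obtain n where n: "n \<in> Nvec r" "n i \<noteq> 0 \<and> (\<forall>k>i. n k = 0)" "y \<in> G1 n" by blast
    then show "y \<in> ?L" using \<phi>_last_iff[OF n(1) i] \<phi>_Nvec[OF n(1)] by blast
  qed
  then show ?thesis unfolding irrelevant_factor_def by simp
qed

lemma irrelevant_ideal_eq: "irrelevant_ideal r S G = irrelevant_ideal r S G1"
proof -
  interpret C: comm_monoid "ideals_set S" by (rule ideals_set_is_comm_monoid)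
  have "ideal (irrelevant_factor r S G1 i) S" for i
    unfolding irrelevant_factor_def using R1.G_carrier by (intro genideal_ideal) blast
  then show ?thesis unfolding irrelevant_ideal_def
    by (intro C.finprod_cong') (auto simp: irrelevant_factor_eq ideals_set_def)
qed

lemma Proj_eq: "Proj r S G = Proj r S G1"
  unfolding Proj_def homogeneous_ideal_eq irrelevant_ideal_eq ..

lemma Proj_topology_eq: "Proj_topology r S G = Proj_topology r S G1"
  unfolding Proj_topology_def homogeneous_ideal_eq Proj_eq ..

lemma hom_denoms_eq: "\<zero> \<in> p \<Longrightarrow> hom_denoms (Nvec r) G p = hom_denoms (Nvec r) G1 p"
proof -
  assume z: "\<zero> \<in> p"
  have "(\<exists>d\<in>Nvec r. s \<in> G d \<and> s \<notin> p) = (\<exists>n\<in>Nvec r. s \<in> G1 n \<and> s \<notin> p)" for s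
    using homog_union_eq by blast
  then show ?thesis unfolding hom_denoms_def by simp
qed

lemma hom_pairs_eq:
  assumes z: "\<zero> \<in> p" shows "hom_pairs (Nvec r) G HH p = hom_pairs (Nvec r) G1 (\<lambda>n. HH (\<phi> n)) p"
proof -
  have "(\<exists>d\<in>Nvec r. m \<in> HH d \<and> s \<in> G d \<and> s \<notin> p) = (\<exists>n\<in>Nvec r. m \<in> HH (\<phi> n) \<and> s \<in> G1 n \<and> s \<notin> p)"
      for m s
  proof
    assume "\<exists>d\<in>Nvec r. m \<in> HH d \<and> s \<in> G d \<and> s \<notin> p"
    then obtain d where d: "d \<in> Nvec r" "m \<in> HH d" "s \<in> G d" "s \<notin> p" by blast
    have "s \<noteq> \<zero>" using d(4) z by auto
    then obtain n where "n \<in> Nvec r" "d = \<phi> n" using G_nonzero_index[OF d(1,3)] by blast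
    then show "\<exists>n\<in>Nvec r. m \<in> HH (\<phi> n) \<and> s \<in> G1 n \<and> s \<notin> p" using d by blast
  qed (use \<phi>_Nvec in blast)
  then show ?thesis unfolding hom_pairs_def by simp
qed

lemma hom_localization_ring_eq:
  "\<zero> \<in> p \<Longrightarrow> hom_localization_ring (Nvec r) S G p = hom_localization_ring (Nvec r) S G1 p"
  unfolding hom_localization_ring_def hom_localization_def by (simp add: hom_pairs_eq hom_denoms_eq)

lemma veronese_grading_eq: "veronese_grading r \<gamma> a G = (\<lambda>n. G1 (dilate a n))"
  by (rule ext) (simp add: veronese_grading_def veronese_index_eq)

lemma veronese_ring_eq:
  assumes a: "a \<in> Nvec_pos r"
  shows "veronese_ring r \<gamma> a S G = S\<lparr>carrier := veronese.W S r G1 a\<rparr>"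
proof -
  interpret v: veronese S r G1 \<mu> g a by (intro veronese.intro veronese_axioms.intro
      R1.std_graded_axioms a)
  show ?thesis
    using R1.veronese_carrier[of "dilate a", OF v.dilate_Nvec]
    by (simp add: veronese_ring_def veronese_grading_eq v.W_def)
qed

end

section \<open>The comparison theorem\<close>

theorem proposition1p1:
  fixes r :: nat and \<gamma> :: "nat \<Rightarrow> mdeg"
    and S :: "('a, 's) ring_scheme" and G :: "mdeg \<Rightarrow> 'a set"
    and \<mu> :: "nat \<Rightarrow> nat" and g :: "nat \<Rightarrow> nat \<Rightarrow> 'a"
  assumes r: "1 \<le> r"
    and \<gamma>: "\<And>i. i \<in> {1..r} \<Longrightarrow> \<gamma> i \<in> Nvec r \<and> (\<forall>k>i. \<gamma> i k = 0) \<and> \<gamma> i i \<noteq> 0"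
    and graded: "graded_ring (Nvec r) S G"
    and noetherian: "noetherian_ring S"
    and g: "\<And>i j. i \<in> {1..r} \<Longrightarrow> j \<in> {1..\<mu> i} \<Longrightarrow> g i j \<in> G (\<gamma> i)"
    and generated: "generate_ring S (G deg_zero \<union> {g i j | i j. i \<in> {1..r} \<and> j \<in> {1..\<mu> i}}) = carrier S"
    and local: "local_ring (S\<lparr>carrier := G deg_zero\<rparr>)"
    and residue: "infinite (carrier (residue_field (S\<lparr>carrier := G deg_zero\<rparr>)))"
  shows "(\<forall>p \<in> Proj r S G.
           faithfully_flat_extension TYPE('x)
             (hom_localization_ring (Nvec r) S G p) (localization S p) (natural_map (loc_rel S p)) \<and>
           closed_fiber (hom_localization_ring (Nvec r) S G p) (localization S p)
             (natural_map (loc_rel S p)) = residue_field (localization S p)) \<and>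
         (\<forall>a \<in> Nvec_pos r.
           integral_extension (carrier (veronese_ring r \<gamma> a S G)) S \<and>
           krull_dim (veronese_ring r \<gamma> a S G) = krull_dim S \<and>
           Proj_topology r (veronese_ring r \<gamma> a S G) (veronese_grading r \<gamma> a G)
             homeomorphic_space Proj_topology r S G \<and>
           (\<forall>p \<in> Proj r S G.
              height (veronese_ring r \<gamma> a S G) (veronese_prime r \<gamma> a S G p) = height S p)) \<and>
         (\<forall>(M :: ('a, 'b) module) H.
           graded_module (Nvec r) S G (Zvec r) M H \<and> finitely_generated S M \<longrightarrow>
           (\<forall>p \<in> Proj r S G. \<forall>a \<in> Nvec_pos r. \<forall>b \<in> Nvec r.
              natural_map (hom_loc_rel (Nvec r) G M (shift_grading b H) p) \<in>
                linear_isos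
                  (hom_localization_ring (Nvec r) (veronese_ring r \<gamma> a S G) (veronese_grading r \<gamma> a G)
                    (veronese_prime r \<gamma> a S G p))
                  (hom_localization (Nvec r) (veronese_ring r \<gamma> a S G) (veronese_grading r \<gamma> a G)
                    (veronese_module r \<gamma> a b M H) (veronese_module_grading r \<gamma> a b H)
                    (veronese_prime r \<gamma> a S G p))
                  (restrict_scalars
                    (natural_map (hom_loc_rel (Nvec r) G (reg_module S) G p))
                    (hom_localization (Nvec r) S G M (shift_grading b H) p))))"
proof -
  have cr: "cring S" using graded by (simp add: graded_ring_def)
  interpret t: triangular_graded S r G \<gamma> \<mu> g
    by (intro triangular_graded.intro multigraded_ring.intro multigraded_ring_axioms.intro
        triangular_degrees.intro triangular_graded_axioms.intro cr graded \<gamma> g generated)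
  have ver: "veronese S r t.G1 \<mu> g a" if "a \<in> Nvec_pos r" for a
    by (intro veronese.intro veronese_axioms.intro t.R1.std_graded_axioms that)
  have zero_p: "\<zero>\<^bsub>S\<^esub> \<in> p" if "p \<in> Proj r S G" for p
    using that additive_subgroup.zero_closed[OF ideal.axioms(1)[OF primeideal.axioms(1)]]
        by (auto simp: Proj_def)
  \<comment> \<open>A monic polynomial is a nonempty list only if \<open>\<one> \<noteq> \<zero>\<close>, which holds since \<open>G deg_zero\<close> has a
    maximal ideal.\<close>
  have nontriv: "\<one>\<^bsub>S\<^esub> \<noteq> \<zero>\<^bsub>S\<^esub>"
  proof
    assume e: "\<one>\<^bsub>S\<^esub> = \<zero>\<^bsub>S\<^esub>"
    have c: "carrier S = {\<zero>\<^bsub>S\<^esub>}" using t.one_zeroD[OF e] by simp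
    obtain m where m: "maximalideal m (S\<lparr>carrier := G deg_zero\<rparr>)" using local
        by (auto simp: local_ring_def)
    have "\<zero>\<^bsub>S\<^esub> \<in> m" using additive_subgroup.zero_closed[OF ideal.axioms(1)[OF
        maximalideal.axioms(1)[OF m]]] by simp
    moreover have "m \<subseteq> G deg_zero" using ideal.Icarr[OF maximalideal.axioms(1)[OF m]] by auto
    moreover have "G deg_zero \<subseteq> {\<zero>\<^bsub>S\<^esub>}" using t.G_carrier[OF Nvec_zero] c by blast
    ultimately have "G deg_zero = m" by blast
    then show False using maximalideal.I_notcarr[OF m] by simp
  qed
  have part1: "faithfully_flat_extension TYPE('x)
             (hom_localization_ring (Nvec r) S G p) (localization S p) (natural_map (loc_rel S p)) \<and>
           closed_fiber (hom_localization_ring (Nvec r) S G p) (localization S p)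
             (natural_map (loc_rel S p)) = residue_field (localization S p)"
                 if p: "p \<in> Proj r S G" for p
  proof -
    obtain x where "graded_point S r t.G1 p x" using t.R1.graded_point_exists p
        unfolding t.Proj_eq by blast
    then interpret gp: graded_point S r t.G1 p x .
    show ?thesis unfolding t.hom_localization_ring_eq[OF zero_p[OF p]]
      using gp.faithfully_flat gp.closed_fiber_eq by blast
  qed
  have part2: "integral_extension (carrier (veronese_ring r \<gamma> a S G)) S \<and>
           krull_dim (veronese_ring r \<gamma> a S G) = krull_dim S \<and>
           Proj_topology r (veronese_ring r \<gamma> a S G) (veronese_grading r \<gamma> a G)
             homeomorphic_space Proj_topology r S G \<and>
           (\<forall>p \<in> Proj r S G.
              height (veronese_ring r \<gamma> a S G) (veronese_prime r \<gamma> a S G p) = height S p)"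
                  if a: "a \<in> Nvec_pos r" for a
  proof -
    interpret v: veronese S r t.G1 \<mu> g a by (rule ver[OF a])
    obtain ms where "spanned_extension S v.W ms" by (rule v.spanned_extension_exists)
    then interpret fe: spanned_extension S v.W ms .
    have "height v.V (p \<inter> v.W) = height S p" if "p \<in> Proj r S t.G1" for p
      using fe.height_eq[OF v.ProjD(1)[OF that]] v.homog_prime_unique[OF v.ProjD[OF that]] by blast
    then show ?thesis
      unfolding t.veronese_ring_eq[OF a] t.veronese_grading_eq t.Proj_topology_eq t.Proj_eq
          veronese_prime_def
      using fe.integral_extension[OF nontriv] fe.krull_dim_eq v.Proj_homeomorphic by simp
  qed
  have part3: "natural_map (hom_loc_rel (Nvec r) G M (shift_grading b H) p) \<in>
                linear_isos
                  (hom_localization_ring (Nvec r) (veronese_ring r \<gamma> a S G) (veronese_grading r \<gamma>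
                      a G)
                    (veronese_prime r \<gamma> a S G p))
                  (hom_localization (Nvec r) (veronese_ring r \<gamma> a S G) (veronese_grading r \<gamma> a G)
                    (veronese_module r \<gamma> a b M H) (veronese_module_grading r \<gamma> a b H)
                    (veronese_prime r \<gamma> a S G p))
                  (restrict_scalars
                    (natural_map (hom_loc_rel (Nvec r) G (reg_module S) G p))
                    (hom_localization (Nvec r) S G M (shift_grading b H) p))"
    if M: "graded_module (Nvec r) S G (Zvec r) M H" and p: "p \<in> Proj r S G"
        and a: "a \<in> Nvec_pos r" and b: "b \<in> Nvec r"
    for M :: "('a, 'b) module" and H p a b
  proof -
    interpret v: veronese S r t.G1 \<mu> g a by (rule ver[OF a])
    let ?HH = "\<lambda>n. H (deg_add (t.\<phi> n) b)"
    have idx: "deg_add (t.\<phi> n) b \<in> Zvec r" if "n \<in> Nvec r" for n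
      using Nvec_add[OF t.\<phi>_Nvec[OF that] b] by (simp add: Nvec_def)
    have HH1: "additive_subgroup (?HH n) M" if "n \<in> Nvec r" for n
      using M idx[OF that] by (simp add: graded_module_def is_direct_sum_def)
    have HH2: "y \<odot>\<^bsub>M\<^esub> z \<in> ?HH (deg_add n m)" if "n \<in> Nvec r" "m \<in> Nvec r" "y \<in> t.G1 n" "z \<in> ?HH m"
        for n m y z
    proof -
      have "\<forall>d\<in>Nvec r. \<forall>e\<in>Zvec r. \<forall>c\<in>G d. \<forall>x\<in>H e. c \<odot>\<^bsub>M\<^esub> x \<in> H (deg_add d e)"
        using M by (simp add: graded_module_def)
      from this[rule_format, OF t.\<phi>_Nvec[OF that(1)] idx[OF that(2)] that(3,4)]
      have "y \<odot>\<^bsub>M\<^esub> z \<in> H (deg_add (t.\<phi> n) (deg_add (t.\<phi> m) b))" .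
      then show ?thesis by (simp add: lin_index_add add.assoc)
    qed
    have mod: "module S M" using M by (simp add: graded_module_def)
    have p1: "p \<in> Proj r S t.G1" using p unfolding t.Proj_eq .
    have pv: "hom_denoms (Nvec r) v.GV (p \<inter> v.W) = hom_denoms (Nvec r) v.GV p"
      "hom_pairs (Nvec r) v.GV X' (p \<inter> v.W) = hom_pairs (Nvec r) v.GV X' p"
          for X' :: "mdeg \<Rightarrow> 'c set"
      unfolding hom_denoms_def hom_pairs_def using v.GV_W by blast+
    have mg: "veronese_module_grading r \<gamma> a b H = (\<lambda>n. ?HH (dilate a n))"
      by (rule ext) (simp add: veronese_module_grading_def veronese_index_eq)
    have sh: "(\<lambda>n. shift_grading b H (t.\<phi> n)) = ?HH" by (simp add: shift_grading_def)
    have cV: "carrier v.V = v.W" by simp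
    note iso = v.veronese_localization_iso[where HH = ?HH, OF mod p1 HH1 HH2]
    show ?thesis
      unfolding hom_loc_rel_def hom_localization_ring_def hom_localization_def veronese_module_def
        t.veronese_ring_eq[OF a] t.veronese_grading_eq veronese_prime_def mg
            reg_module_carrier_update
        fractions_carrier_update t.hom_pairs_eq[OF zero_p[OF p]] t.hom_denoms_eq[OF zero_p[OF p]] sh
        cV pv
      by (rule iso)
  qed
  show ?thesis
    by (intro conjI ballI allI impI; (elim conjE)?; (rule part1[THEN conjunct1] part1[THEN
        conjunct2] part2[THEN conjunct1]
      part2[THEN conjunct2, THEN conjunct1] part2[THEN conjunct2, THEN conjunct2, THEN conjunct1]
      part2[THEN conjunct2, THEN conjunct2, THEN conjunct2, rule_format] part3); assumption)
qed

end
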